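(* Let $h>0$, $R>0$, and let $F_0\in\mathcal{E}$ be supported in the centered ball $B_R$ of radius $R$ and bounded below on $B_R$ by some strictly positive constant. Then there exists $(a_0,b_0,\phi_0,\psi_0)\in\mathcal{U}$ such that $$J(a_0,b_0,\phi_0,\psi_0)\ge J(a,b,\phi,\psi)\qquad\text{for all }(a,b,\phi,\psi)\in\mathcal{U}.$$ Furthermore, if $$F_1(w)=(\eta^* )'\left(\frac{a_0\cdot w+b_0|w|^2/2+\psi_0(w)}{h}\right),$$ then $F_1\in\mathcal{E}$, $\nabla\psi_0\#F_1=F_0$, and $$\nabla\psi_0(w)=w+h\nabla\ln F_1(w)+h\,w-\frac{W_2^2(F_0,F_1)}{d}\,w .$$
   Context: $\mathcal{E}$ is the set of probability densities $F$ on $\mathbb{R}^d$ with $\int_{\mathbb{R}^d}vF(v)\,dv=0$ and $\int_{\mathbb{R}^d}|v|^2F(v)\,dv=d$ (i.e. $u=0$, $\theta=1$). The $2$-Wasserstein distance is normalized by $W_2^2(F_0,F_1)=\inf_\gamma\int_{\mathbb{R}^d\times\mathbb{R}^d}\tfrac12|v-w|^2\,\gamma(dv,dw)$ over couplings $\gamma$ of $F_0(v)dv$ and $F_1(w)dw$. $T\#F$ denotes the push-forward of the density $F$ under $T$. Let $\eta(t)=t\ln t$ for $t\ge0$ and $\eta(t)=+\infty$ for $t<0$; its Legendre transform is $\eta^*(s)=e^{s-1}$. $\mathcal{U}$ is the set of all quadruplets $(a,b,\phi,\psi)$ where $a\in\mathbb{R}^d$, $b\in\mathbb{R}$, and $\phi,\psi$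 are a pair of dual convex functions on $\mathbb{R}^d$ (each is the Legendre transform of the other: $\psi=\phi^*$, $\phi=\psi^*$, with $\psi^*(w)=\sup_{v}\{w\cdot v-\psi(v)\}$) satisfying $\phi(v)=\infty$ for $|v|>R$. On $\mathcal{U}$ define $$J(a,b,\phi,\psi)=d-\int_{\mathbb{R}^d}\phi(v)F_0(v)\,dv+\frac d2\,b-h\int_{\mathbb{R}^d}\eta^*\left(\frac{a\cdot w+b|w|^2/2+\psi(w)}{h}\right)dw,$$ with $J=-\infty$ allowed. *)

theory Defs
  imports "HOL-Analysis.Analysis"
begin

section \<open>Legendre duality for extended-valued functions\<close>

definition legendre :: "('a::real_inner \<Rightarrow> ereal) \<Rightarrow> 'a \<Rightarrow> ereal" where
  "legendre f y = (SUP x. ereal (inner y x) - f x)"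

text \<open>A convex function takes values in \<open>(-\<infinity>, \<infinity>]\<close> and is not identically \<open>\<infinity>\<close>. The only dual
  pair that this excludes below is \<open>\<phi> = \<infinity>\<close>, \<open>\<psi> = -\<infinity>\<close>, for which the functional \<open>J\<close> is \<open>-\<infinity>\<close>.\<close>

definition convex_fun :: "('a::real_vector \<Rightarrow> ereal) \<Rightarrow> bool" where
  "convex_fun f \<longleftrightarrow> (\<forall>x. f x \<noteq> -\<infinity>) \<and> (\<exists>x. f x \<noteq> \<infinity>) \<and> convex {(x, t). f x \<le> ereal t}"

definition dual_convex_pair :: "('a::real_inner \<Rightarrow> ereal) \<Rightarrow> ('a \<Rightarrow> ereal) \<Rightarrow> bool" where
  "dual_convex_pair \<phi> \<psi> \<longleftrightarrow>
     convex_fun \<phi> \<and> convex_fun \<psi> \<and> \<psi> = legendre \<phi> \<and> \<phi> = legendre \<psi>"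

section \<open>The entropy density and its Legendre transform\<close>

definition eta :: "real \<Rightarrow> ereal" where
  "eta t = (if 0 \<le> t then ereal (t * ln t) else \<infinity>)"

definition eta_star :: "real \<Rightarrow> real" where
  "eta_star s = real_of_ereal (legendre eta s)"

lemma legendre_eta: "legendre eta s = ereal (exp (s - 1))"
  unfolding legendre_def
proof (rule antisym)
  show "(SUP t. ereal (inner s t) - eta t) \<le> ereal (exp (s - 1))"
  proof (rule SUP_least)
    fix t :: real
    show "ereal (inner s t) - eta t \<le> ereal (exp (s - 1))"
    proof (cases "t > 0")
      case True
      have "1 + (s - 1 - ln t) \<le> exp (s - 1 - ln t)"
        by (rule exp_ge_add_one_self)
      also have "\<dots> = exp (s - 1) / t"
        using True by (simp add: exp_diff)
      finally have "s * t - t * ln t \<le> exp (s - 1)"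
        using True by (simp add: field_simps)
      then show ?thesis
        using True by (simp add: eta_def)
    qed (auto simp: eta_def)
  qed
  have "ereal (exp (s - 1)) = ereal (inner s (exp (s - 1))) - eta (exp (s - 1))"
    by (simp add: eta_def algebra_simps)
  also have "\<dots> \<le> (SUP t. ereal (inner s t) - eta t)"
    by (rule SUP_upper) simp
  finally show "ereal (exp (s - 1)) \<le> (SUP t. ereal (inner s t) - eta t)" .
qed

lemma eta_star_eq: "eta_star s = exp (s - 1)"
  by (simp add: eta_star_def legendre_eta)

section \<open>Densities, push-forward and Wasserstein distance\<close>

text \<open>Probability densities with zero mean velocity and unit temperature.\<close>

definition centered_densities :: "(real ^ 'n \<Rightarrow> real) set" where
  "centered_densities = {F. F \<in> borel_measurable borel \<and> (\<forall>v. 0 \<le> F v) \<and>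
     has_bochner_integral lborel F 1 \<and>
     has_bochner_integral lborel (\<lambda>v. F v *\<^sub>R v) 0 \<and>
     has_bochner_integral lborel (\<lambda>v. (norm v)\<^sup>2 * F v) (real CARD('n))}"

text \<open>\<open>T # F = G\<close>. The source measure lives on the complete \<open>\<sigma>\<close>-algebra \<open>lebesgue\<close>, so that it does
  not matter how a map defined only almost everywhere, such as the gradient of a convex function,
  is extended to the exceptional null set.\<close>

definition pushes_forward ::
    "('a::euclidean_space \<Rightarrow> 'b::euclidean_space) \<Rightarrow> ('a \<Rightarrow> real) \<Rightarrow> ('b \<Rightarrow> real) \<Rightarrow> bool" where
  "pushes_forward T F G \<longleftrightarrow> T \<in> borel_measurable lebesgue \<and>
     distr (density lebesgue (\<lambda>v. ennreal (F v))) borel T = density lborel (\<lambda>w. ennreal (G w))"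

definition couplings ::
    "('a::euclidean_space \<Rightarrow> real) \<Rightarrow> ('a \<Rightarrow> real) \<Rightarrow> ('a \<times> 'a) measure set" where
  "couplings F G = {\<gamma>. sets \<gamma> = sets (borel \<Otimes>\<^sub>M borel) \<and>
     distr \<gamma> borel fst = density lborel (\<lambda>v. ennreal (F v)) \<and>
     distr \<gamma> borel snd = density lborel (\<lambda>w. ennreal (G w))}"

definition wasserstein2_sq :: "('a::euclidean_space \<Rightarrow> real) \<Rightarrow> ('a \<Rightarrow> real) \<Rightarrow> ennreal" where
  "wasserstein2_sq F G =
     (INF \<gamma>\<in>couplings F G. \<integral>\<^sup>+ p. ennreal ((norm (fst p - snd p))\<^sup>2 / 2) \<partial>\<gamma>)"

text \<open>The gradient, meaningful at points of differentiability only.\<close>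

definition grad :: "('a::real_inner \<Rightarrow> real) \<Rightarrow> 'a \<Rightarrow> 'a" where
  "grad f x = (THE D. GDERIV f x :> D)"

lemma grad_eqI: "GDERIV f x :> D \<Longrightarrow> grad f x = D"
  unfolding grad_def
proof (rule the_equality)
  fix D' assume "GDERIV f x :> D" "GDERIV f x :> D'"
  then have "(\<lambda>h. inner h D') = (\<lambda>h. inner h D)"
    unfolding gderiv_def by (rule has_derivative_unique[rotated])
  then have "inner h (D' - D) = 0" for h
    by (metis inner_diff_right right_minus_eq)
  from this[of "D' - D"] show "D' = D"
    by simp
qed

section \<open>The dual problem\<close>

definition admissible ::
    "real \<Rightarrow> ((real ^ 'n) \<times> real \<times> (real ^ 'n \<Rightarrow> ereal) \<times> (real ^ 'n \<Rightarrow> ereal)) set" where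
  "admissible R = {(a, b, \<phi>, \<psi>). dual_convex_pair \<phi> \<psi> \<and> (\<forall>v. norm v > R \<longrightarrow> \<phi> v = \<infinity>)}"

text \<open>Hence passing from \<open>\<psi>\<close> to its real values loses nothing on admissible quadruplets.\<close>

lemma admissible_psi_finite:
  assumes "(a, b, \<phi>, \<psi>) \<in> admissible R"
  shows "\<psi> w = ereal (real_of_ereal (\<psi> w))"
proof -
  have conv: "convex_fun \<phi>" "convex_fun \<psi>" and psi: "\<psi> = legendre \<phi>" and phi: "\<phi> = legendre \<psi>"
    and out: "\<And>v. norm v > R \<Longrightarrow> \<phi> v = \<infinity>"
    using assms unfolding admissible_def dual_convex_pair_def by blast+
  obtain u where u: "\<psi> u \<noteq> \<infinity>" and fin: "\<And>v. \<psi> v \<noteq> -\<infinity>"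
    using conv(2) by (auto simp: convex_fun_def)
  obtain r where r: "\<psi> u = ereal r"
    using u fin[of u] by (cases "\<psi> u") auto
  have "ereal (inner w v) - \<phi> v \<le> ereal (R * norm (w - u) + r)" for v
  proof (cases "norm v > R")
    case True
    then show ?thesis using out[of v] by simp
  next
    case False
    have "ereal (inner v u - r) \<le> \<phi> v"
      unfolding phi legendre_def by (rule SUP_upper2[of u]) (simp_all add: r)
    then have "ereal (inner w v) - \<phi> v \<le> ereal (inner w v) - ereal (inner v u - r)"
      by (rule ereal_minus_mono[OF order_refl])
    also have "\<dots> = ereal (inner (w - u) v + r)"
      by (simp add: inner_diff_left inner_commute[of v u])
    also have "inner (w - u) v \<le> norm (w - u) * norm v"
      by (rule norm_cauchy_schwarz)
    also have "\<dots> \<le> R * norm (w - u)"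
      using False by (simp add: mult.commute[of "norm (w - u)"] mult_right_mono)
    finally show ?thesis by simp
  qed
  then have "\<psi> w \<le> ereal (R * norm (w - u) + r)"
    unfolding psi legendre_def by (rule SUP_least)
  then show ?thesis
    using fin[of w] by (cases "\<psi> w") auto
qed

text \<open>Positive minus negative part.  In \<open>dual_J\<close> the negative part has finite integral, since \<open>\<phi>\<close>
  is bounded below on the ball carrying \<open>F0\<close>; elsewhere \<open>\<infinity> * 0 = 0\<close> applies.\<close>

definition ereal_integral :: "'a measure \<Rightarrow> ('a \<Rightarrow> ereal) \<Rightarrow> ereal" where
  "ereal_integral M f =
     enn2ereal (\<integral>\<^sup>+ x. e2ennreal (f x) \<partial>M) - enn2ereal (\<integral>\<^sup>+ x. e2ennreal (- f x) \<partial>M)"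

definition dual_J ::
    "real \<Rightarrow> (real ^ 'n \<Rightarrow> real) \<Rightarrow>
     (real ^ 'n) \<times> real \<times> (real ^ 'n \<Rightarrow> ereal) \<times> (real ^ 'n \<Rightarrow> ereal) \<Rightarrow> ereal" where
  "dual_J h F0 = (\<lambda>(a, b, \<phi>, \<psi>).
     ereal (real CARD('n))
     - ereal_integral lborel (\<lambda>v. \<phi> v * ereal (F0 v))
     + ereal (real CARD('n) / 2 * b)
     - ereal h * enn2ereal (\<integral>\<^sup>+ w. ennreal (eta_star
         ((inner a w + b * (norm w)\<^sup>2 / 2 + real_of_ereal (\<psi> w)) / h)) \<partial>lborel))"

end

theory Submission
  imports Defs "HOL-Complex_Analysis.Great_Picard" "HOL-Probability.Distributions"
begin

text \<open>Write \<open>U = (a \<bullet> w + b |w|^2 / 2 + \<psi>) / h - 1\<close> and \<open>F1 = exp U\<close>.  It suffices to maximize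
  over \<open>a = 0\<close>, \<open>b < 0\<close>.  Convexity of \<open>\<psi>\<close> bounds \<open>\<integral> exp U\<close> below by a Gaussian integral, which
  confines \<open>b\<close> to a compact interval; \<open>\<psi>\<close> is \<open>R\<close>-Lipschitz, so maximizing sequences converge
  pointwise along subsequences, and Fatou's lemma gives upper semicontinuity of \<open>J\<close>.

  At the maximizer, varying \<open>\<phi>\<close> by a test function gives \<open>\<nabla>\<psi> # F1 = F0\<close> (hence unit mass), and
  varying \<open>b\<close> gives the temperature.  Translation invariance of \<open>\<integral> F1\<close> yields \<open>b \<integral> w F1 = - \<integral> v F0 = 0\<close>
  and dilation yields \<open>\<integral> w \<bullet> \<nabla>\<psi> F1 = - (b + h) d\<close>.  Since \<open>\<phi> v + \<psi> w \<ge> v \<bullet> w\<close> with equality for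
  \<open>v = \<nabla>\<psi> w\<close>, the coupling induced by \<open>\<nabla>\<psi>\<close> is optimal, so \<open>W\<^sub>2\<^sup>2 = d (1 + b + h)\<close>; the same
  inequality together with \<open>exp x \<ge> 1 + x\<close> shows that the maximizer with \<open>a = 0\<close> is global.\<close>

section \<open>Functions with bounded subgradients\<close>

text \<open>The dual pair is encoded by one real function: \<psi> is the second component of an
  admissible pair iff it has, at every point, a subgradient of norm at most \<open>R\<close>; \<phi>
  is then its Legendre transform. This class is closed under pointwise limits and under adding
  constants, which keeps extended reals out of the existence proof. Adding a constant to \<psi> is a
  noncompact direction. It is removed by solving the one-dimensional maximization explicitly, after
  which \<open>f 0 = 0\<close> may be imposed. The coefficient c = - b is confined because d c / 2 -
  (h d / 2) ln c tends to infinity at both ends. Dropping \<open>a\<close> costs nothing: a zero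
  mean of \<open>F1\<close> is stationarity in \<open>a\<close>, and concavity of J turns
  stationarity into global optimality. The potential is only convex and Lipschitz, so its gradient
  exists only almost everywhere. Identities for it therefore come from exact integrals along steps 1
  / (n + 1), not from integration by parts. A perturbation \<phi> + \<epsilon> g need not be convex.
  The competitor is its Legendre transform, whose own transform lies below \<phi> + \<epsilon> g;
  this is the direction in which optimality can be applied.\<close>

definition subgradient :: "('a::real_inner \<Rightarrow> real) \<Rightarrow> 'a \<Rightarrow> 'a \<Rightarrow> bool" where
  "subgradient f w v \<longleftrightarrow> (\<forall>x. f w + inner v (x - w) \<le> f x)"

text \<open>Real-valued description of the functions \<psi> occurring in
  \<open>admissible R\<close>; the two inclusions are \<open>admissible_legendre\<close> and
  \<open>admissible_subgradients_in_ball\<close>.\<close>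

definition subgradients_in_ball :: "real \<Rightarrow> ('a::real_inner \<Rightarrow> real) \<Rightarrow> bool" where
  "subgradients_in_ball R f \<longleftrightarrow> (\<forall>w. \<exists>v. norm v \<le> R \<and> subgradient f w v)"

lemma subgradients_in_ball_diff_le:
  assumes "subgradients_in_ball R f"
  shows "f x - f y \<le> R * norm (x - y)"
proof -
  obtain v where v: "norm v \<le> R" "subgradient f x v"
    using assms unfolding subgradients_in_ball_def by blast
  then have "f x - f y \<le> - inner v (y - x)"
    unfolding subgradient_def by (smt (verit))
  also have "\<dots> = inner v (x - y)"
    by (simp add: inner_diff_right)
  also have "\<dots> \<le> norm v * norm (x - y)"
    by (rule norm_cauchy_schwarz)
  also have "\<dots> \<le> R * norm (x - y)"
    by (rule mult_right_mono) (use v in auto)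
  finally show ?thesis .
qed

lemma subgradients_in_ball_lipschitz:
  assumes "subgradients_in_ball R f"
  shows "\<bar>f x - f y\<bar> \<le> R * norm (x - y)"
  using subgradients_in_ball_diff_le[OF assms, of x y] subgradients_in_ball_diff_le[OF assms, of y x]
  by (simp add: norm_minus_commute abs_le_iff)

lemma subgradients_in_ball_nonneg: "subgradients_in_ball R f \<Longrightarrow> 0 \<le> R"
  unfolding subgradients_in_ball_def using norm_ge_zero order_trans by blast

lemma subgradients_in_ball_continuous:
  assumes "subgradients_in_ball R f"
  shows "continuous_on UNIV f"
proof -
  have "R-lipschitz_on UNIV f"
    using subgradients_in_ball_nonneg[OF assms] subgradients_in_ball_lipschitz[OF assms]
    by (auto simp: lipschitz_on_def dist_norm)
  then show ?thesis
    by (rule lipschitz_on_continuous_on)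
qed

lemma subgradients_in_ball_borel [measurable]:
  fixes f :: "'a::euclidean_space \<Rightarrow> real"
  assumes "subgradients_in_ball R f"
  shows "f \<in> borel_measurable borel"
  using subgradients_in_ball_continuous[OF assms] by (rule borel_measurable_continuous_onI)

text \<open>The affine support at the intermediate point lies below \<open>f\<close> at both ends,
  and its slope terms cancel in the convex combination.\<close>

lemma subgradients_in_ball_convex:
  assumes "subgradients_in_ball R f"
  shows "convex_on UNIV f"
proof (rule convex_onI)
  fix t :: real and x y :: 'a
  assume t: "0 < t" "t < 1"
  define z where "z = (1 - t) *\<^sub>R x + t *\<^sub>R y"
  obtain v where v: "subgradient f z v"
    using assms unfolding subgradients_in_ball_def by blast
  have "f z + inner v (x - z) \<le> f x" "f z + inner v (y - z) \<le> f y"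
    using v unfolding subgradient_def by auto
  then have "(1 - t) * (f z + inner v (x - z)) + t * (f z + inner v (y - z))
      \<le> (1 - t) * f x + t * f y"
    using t by (intro add_mono mult_left_mono) auto
  moreover have "(1 - t) * (f z + inner v (x - z)) + t * (f z + inner v (y - z)) = f z"
    by (simp add: z_def inner_simps algebra_simps)
  ultimately show "f ((1 - t) *\<^sub>R x + t *\<^sub>R y) \<le> (1 - t) * f x + t * f y"
    by (simp add: z_def)
qed auto

lemma subgradients_in_ball_add_const:
  "subgradients_in_ball R (\<lambda>x. f x + c) \<longleftrightarrow> subgradients_in_ball R f"
  by (simp add: subgradients_in_ball_def subgradient_def algebra_simps)

text \<open>Compactness of the ball turns approximate subgradients of a convergent sequence into exact
  subgradients of the limit; a constant sequence is allowed.\<close>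

lemma subgradients_in_ball_limit:
  fixes f :: "'a::euclidean_space \<Rightarrow> real"
  assumes lim: "\<And>x. (\<lambda>n. g n x) \<longlonglongrightarrow> f x" and \<delta>: "\<delta> \<longlonglongrightarrow> 0"
    and sub: "\<And>n w. \<exists>v. norm v \<le> R \<and> (\<forall>x. g n w + inner v (x - w) - \<delta> n \<le> g n x)"
  shows "subgradients_in_ball R f"
  unfolding subgradients_in_ball_def
proof
  fix w
  have "\<exists>v. \<forall>n. norm (v n) \<le> R \<and> (\<forall>x. g n w + inner (v n) (x - w) - \<delta> n \<le> g n x)"
    by (rule choice) (use sub in blast)
  then obtain v where v: "\<And>n. norm (v n) \<le> R"
    "\<And>n x. g n w + inner (v n) (x - w) - \<delta> n \<le> g n x"
    by blast
  have "\<forall>n. v n \<in> cball 0 R"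
    using v by simp
  then obtain l r where l: "l \<in> cball 0 R" "strict_mono r" "(v \<circ> r) \<longlonglongrightarrow> l"
    using compact_cball[of 0 R] unfolding compact_def by metis
  have "subgradient f w l"
    unfolding subgradient_def
  proof
    fix x
    have "(\<lambda>n. g (r n) w + inner ((v \<circ> r) n) (x - w) - \<delta> (r n)) \<longlonglongrightarrow> f w + inner l (x - w) - 0"
      by (intro tendsto_intros l LIMSEQ_subseq_LIMSEQ[OF lim l(2), unfolded o_def]
          LIMSEQ_subseq_LIMSEQ[OF \<delta> l(2), unfolded o_def])
    moreover have "(\<lambda>n. g (r n) x) \<longlonglongrightarrow> f x"
      using LIMSEQ_subseq_LIMSEQ[OF lim l(2)] by (simp add: o_def)
    ultimately show "f w + inner l (x - w) \<le> f x"
      using v(2)[of "r _"] by (auto intro: LIMSEQ_le)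
  qed
  then show "\<exists>v. norm v \<le> R \<and> subgradient f w v"
    using l(1) by auto
qed

text \<open>An Arzela-Ascoli argument: a diagonal subsequence converges on a countable dense set,
  and the common Lipschitz constant spreads the Cauchy property to every point.\<close>

lemma subgradients_in_ball_seq_compact:
  fixes g :: "nat \<Rightarrow> 'a::euclidean_space \<Rightarrow> real"
  assumes sub: "\<And>n. subgradients_in_ball R (g n)" and zero: "\<And>n. g n 0 = 0"
  obtains f r where "strict_mono r" "subgradients_in_ball R f" "\<And>x. (\<lambda>n. g (r n) x) \<longlonglongrightarrow> f x"
proof -
  obtain D :: "'a set" where D: "countable D" "\<And>S. open S \<Longrightarrow> S \<noteq> {} \<Longrightarrow> \<exists>d\<in>D. d \<in> S"
    by (rule countable_dense_setE) blast
  have R: "0 \<le> R"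
    using subgradients_in_ball_nonneg[OF sub[of 0]] .
  \<comment> \<open>The diagonal extraction needs one bound for all points, while
    \<open>g n x\<close> may grow like \<open>R * norm x\<close>; the quotient removes this
    growth.\<close>
  have "norm (g n x / (1 + norm x)) \<le> R" for n x
  proof -
    have "\<bar>g n x\<bar> \<le> R * norm x"
      using subgradients_in_ball_lipschitz[OF sub[of n], of x 0] zero[of n] by simp
    also have "\<dots> \<le> R * (1 + norm x)"
      using R by (intro mult_left_mono) auto
    finally show ?thesis
      by (simp add: pos_divide_le_eq add_pos_nonneg)
  qed
  then obtain r where r: "strict_mono r"
    "\<And>x. x \<in> D \<Longrightarrow> \<exists>l. (\<lambda>n. g (r n) x / (1 + norm x)) \<longlonglongrightarrow> l"
    using function_convergent_subsequence[OF D(1), where f="\<lambda>n x. g n x / (1 + norm x)" and M=R]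
    by metis
  have conv: "convergent (\<lambda>n. g (r n) x)" for x
  proof -
    have "Cauchy (\<lambda>n. g (r n) x)"
    proof (rule metric_CauchyI)
      fix e :: real assume e: "e > 0"
      \<comment> \<open>The summand 1 covers the case \<open>R = 0\<close>.\<close>
      define d where "d = e / (3 * (R + 1))"
      have d: "d > 0" using e R by (simp add: d_def)
      obtain y where y: "y \<in> D" "dist x y < d"
        using D(2)[of "ball x d"] d by auto
      obtain l where "(\<lambda>n. g (r n) y / (1 + norm y)) \<longlonglongrightarrow> l"
        using r(2)[OF y(1)] by blast
      then have "(\<lambda>n. g (r n) y / (1 + norm y) * (1 + norm y)) \<longlonglongrightarrow> l * (1 + norm y)"
        by (intro tendsto_intros)
      moreover have "1 + norm y \<noteq> 0"
        using norm_ge_zero[of y] by linarith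
      ultimately have "Cauchy (\<lambda>n. g (r n) y)"
        by (simp add: LIMSEQ_imp_Cauchy)
      then obtain N where N: "\<And>m n. m \<ge> N \<Longrightarrow> n \<ge> N \<Longrightarrow> dist (g (r m) y) (g (r n) y) < e / 3"
        using metric_CauchyD[of "\<lambda>n. g (r n) y" "e/3"] e by auto
      have close: "\<bar>g k x - g k y\<bar> < e / 3" for k
      proof -
        have "\<bar>g k x - g k y\<bar> \<le> R * norm (x - y)"
          by (rule subgradients_in_ball_lipschitz[OF sub])
        also have "\<dots> \<le> (R + 1) * norm (x - y)"
          by (intro mult_right_mono) auto
        also have "\<dots> < (R + 1) * d"
          using y R by (intro mult_strict_left_mono) (auto simp: dist_norm)
        also have "\<dots> = e / 3"
          using R by (simp add: d_def field_simps)
        finally show ?thesis .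
      qed
      have "dist (g (r m) x) (g (r n) x) < e" if "m \<ge> N" "n \<ge> N" for m n
        using N[OF that] close[of "r m"] close[of "r n"] unfolding dist_real_def by linarith
      then show "\<exists>M. \<forall>m\<ge>M. \<forall>n\<ge>M. dist (g (r m) x) (g (r n) x) < e"
        by blast
    qed
    then show ?thesis
      by (simp add: Cauchy_convergent_iff)
  qed
  define f where "f x = lim (\<lambda>n. g (r n) x)" for x
  have f: "(\<lambda>n. g (r n) x) \<longlonglongrightarrow> f x" for x
    using conv[of x] by (simp add: f_def convergent_LIMSEQ_iff)
  have "subgradients_in_ball R f"
    by (rule subgradients_in_ball_limit[OF f, where \<delta>="\<lambda>_. 0"])
      (use sub in \<open>auto simp: subgradients_in_ball_def subgradient_def\<close>)
  with r(1) f that show thesis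
    by blast
qed

text \<open>The function \<open>f x - inner v x\<close> has a global minimum at \<open>w\<close>, so
  its derivative vanishes there.\<close>

lemma has_derivative_subgradient_unique:
  fixes f :: "'a::real_inner \<Rightarrow> real"
  assumes f: "subgradient f w v" and D: "(f has_derivative f') (at w)"
  shows "f' = inner v"
proof -
  have "((\<lambda>x. f x - inner v x) has_derivative (\<lambda>x. f' x - inner v x)) (at w)"
    by (intro derivative_intros D)
  moreover have "f w - inner v w \<le> f y - inner v y" for y
    using f unfolding subgradient_def by (auto simp: inner_diff_right dest: spec[of _ y])
  ultimately have "(\<lambda>x. f' x - inner v x) = (\<lambda>_. 0)"
    by (intro differential_zero_maxmin[of w UNIV "\<lambda>x. f x - inner v x"]) auto
  then show ?thesis
    by (metis (no_types) eq_iff_diff_eq_0 ext)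
qed

lemma grad_subgradient:
  fixes f :: "'a::real_inner \<Rightarrow> real"
  assumes "subgradient f w v" "f differentiable (at w)"
  shows "grad f w = v" "(f has_derivative inner v) (at w)"
proof -
  obtain f' where f': "(f has_derivative f') (at w)"
    using assms(2) unfolding differentiable_def by blast
  show D: "(f has_derivative inner v) (at w)"
    using has_derivative_subgradient_unique[OF assms(1) f'] f' by simp
  show "grad f w = v"
    by (rule grad_eqI) (use D in \<open>simp add: gderiv_def inner_commute[of _ v]\<close>)
qed

lemma subgradient_grad:
  assumes "subgradients_in_ball R f" "f differentiable (at w)"
  shows "subgradient f w (grad f w)" "norm (grad f w) \<le> R"
    "(f has_derivative inner (grad f w)) (at w)"
  using assms grad_subgradient unfolding subgradients_in_ball_def by metis+

section \<open>Integrals over Euclidean space\<close>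

lemma integrable_lborel_affine:
  fixes f :: "'a::euclidean_space \<Rightarrow> real"
  assumes c: "c \<noteq> 0" and f: "integrable lborel f"
  shows "integrable lborel (\<lambda>x. f (t + c *\<^sub>R x))"
    and "(\<integral>x. f (t + c *\<^sub>R x) \<partial>lborel) = (\<integral>x. f x \<partial>lborel) / \<bar>c\<bar> ^ DIM('a)"
proof -
  let ?T = "\<lambda>x::'a. t + c *\<^sub>R x"
  note [measurable] = borel_measurable_integrable[OF f]
  have eq: "lborel = density (distr lborel borel ?T) (\<lambda>_. ennreal (\<bar>c\<bar> ^ DIM('a)))"
    using lborel_affine[OF c, of t] by (simp add: ennreal_power)
  have "integrable (density (distr lborel borel ?T) (\<lambda>_. ennreal (\<bar>c\<bar> ^ DIM('a)))) f"
    using f eq by simp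
  then have "integrable (distr lborel borel ?T) (\<lambda>x. \<bar>c\<bar> ^ DIM('a) *\<^sub>R f x)"
    by (subst (asm) integrable_density) auto
  then have "integrable lborel (\<lambda>x. \<bar>c\<bar> ^ DIM('a) *\<^sub>R f (?T x))"
    by (subst (asm) integrable_distr_eq) auto
  then show "integrable lborel (\<lambda>x. f (?T x))"
    using c by simp
  have "(\<integral>x. f x \<partial>lborel) = (\<integral>x. f x \<partial>density (distr lborel borel ?T) (\<lambda>_. ennreal (\<bar>c\<bar> ^ DIM('a))))"
    using eq by simp
  also have "\<dots> = \<bar>c\<bar> ^ DIM('a) * (\<integral>x. f (?T x) \<partial>lborel)"
    by (subst integral_density) (auto simp: integral_distr)
  finally show "(\<integral>x. f (?T x) \<partial>lborel) = (\<integral>x. f x \<partial>lborel) / \<bar>c\<bar> ^ DIM('a)"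
    using c by (simp add: field_simps)
qed

text \<open>The norm is at most the sum of the absolute coordinates, and its square is the sum of
  their squares, so the integrand is dominated by a product of one-dimensional functions.\<close>

lemma integrable_exp_linear_minus_quadratic:
  fixes \<alpha> \<beta> :: real
  assumes \<beta>: "\<beta> > 0"
  shows "integrable lborel (\<lambda>x::'a::euclidean_space. exp (\<alpha> * norm x - \<beta> * (norm x)\<^sup>2))"
proof -
  let ?g = "\<lambda>x::'a. \<Prod>b\<in>Basis. exp (\<bar>\<alpha>\<bar> * \<bar>x \<bullet> b\<bar> - \<beta> * (x \<bullet> b)\<^sup>2)"
  have one: "integrable lborel (\<lambda>x::real. exp (\<bar>\<alpha>\<bar> * \<bar>x\<bar> - \<beta> * x\<^sup>2))"
  proof (rule Bochner_Integration.integrable_bound)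
    \<comment> \<open>Half of the quadratic term absorbs the linear one by completing the square;
      the other half is the exponent of a normal density with variance 1 / \<beta>.\<close>
    define s where "s = sqrt (1 / \<beta>)"
    have s: "s > 0" "s\<^sup>2 = 1 / \<beta>"
      using \<beta> by (simp_all add: s_def)
    show "integrable lborel (\<lambda>x. exp (\<alpha>\<^sup>2 / (2 * \<beta>)) * sqrt (2 * pi * s\<^sup>2) * normal_density 0 s x)"
      using s by (intro integrable_mult_right integrable_normal_density) simp
    show "AE x in lborel. norm (exp (\<bar>\<alpha>\<bar> * \<bar>x\<bar> - \<beta> * x\<^sup>2))
        \<le> norm (exp (\<alpha>\<^sup>2 / (2 * \<beta>)) * sqrt (2 * pi * s\<^sup>2) * normal_density 0 s x)"
    proof (intro AE_I2)
      fix x :: real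
      have "0 \<le> (\<beta> * \<bar>x\<bar> - \<bar>\<alpha>\<bar>)\<^sup>2 / (2 * \<beta>)"
        using \<beta> by simp
      also have "\<dots> = \<alpha>\<^sup>2 / (2 * \<beta>) + \<beta> * x\<^sup>2 / 2 - \<bar>\<alpha>\<bar> * \<bar>x\<bar>"
        using \<beta> by (simp add: power2_eq_square field_simps)
      finally have "\<bar>\<alpha>\<bar> * \<bar>x\<bar> - \<beta> * x\<^sup>2 \<le> \<alpha>\<^sup>2 / (2 * \<beta>) + - (x\<^sup>2 / (2 * s\<^sup>2))"
        by (simp add: s(2) mult.commute[of _ \<beta>])
      then have "exp (\<bar>\<alpha>\<bar> * \<bar>x\<bar> - \<beta> * x\<^sup>2) \<le> exp (\<alpha>\<^sup>2 / (2 * \<beta>)) * exp (- (x\<^sup>2 / (2 * s\<^sup>2)))"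
        by (simp flip: exp_add)
      moreover have "sqrt (2 * pi * s\<^sup>2) > 0"
        using s(1) by simp
      moreover have "s \<noteq> 0"
        using s(1) by simp
      ultimately show "norm (exp (\<bar>\<alpha>\<bar> * \<bar>x\<bar> - \<beta> * x\<^sup>2))
          \<le> norm (exp (\<alpha>\<^sup>2 / (2 * \<beta>)) * sqrt (2 * pi * s\<^sup>2) * normal_density 0 s x)"
        by (simp add: normal_density_def field_simps abs_mult)
    qed
  qed simp
  interpret product_sigma_finite "\<lambda>_::'a. lborel :: real measure"
    by standard
  have "integrable (\<Pi>\<^sub>M b\<in>(Basis::'a set). lborel)
      (\<lambda>x. \<Prod>b\<in>Basis. exp (\<bar>\<alpha>\<bar> * \<bar>x b\<bar> - \<beta> * (x b)\<^sup>2))"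
    by (rule product_integrable_prod) (auto intro: one)
  also have "(\<lambda>x. \<Prod>b\<in>Basis. exp (\<bar>\<alpha>\<bar> * \<bar>x b\<bar> - \<beta> * (x b)\<^sup>2)) = (\<lambda>x. ?g (\<Sum>b\<in>Basis. x b *\<^sub>R b))"
    by (intro ext prod.cong) auto
  finally have int_prod: "integrable (\<Pi>\<^sub>M b\<in>(Basis::'a set). lborel) (\<lambda>x. ?g (\<Sum>b\<in>Basis. x b *\<^sub>R b))" .
  have "(\<lambda>x. x b) \<in> borel_measurable (\<Pi>\<^sub>M b\<in>(Basis::'a set). lborel :: real measure)" if "b \<in> Basis" for b
    using measurable_component_singleton[OF that, of "\<lambda>_. lborel :: real measure"] by simp
  then have "(\<lambda>x. \<Sum>b\<in>Basis. x b *\<^sub>R b) \<in> borel_measurable (\<Pi>\<^sub>M b\<in>(Basis::'a set). lborel :: real measure)"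
    by (intro borel_measurable_sum borel_measurable_scaleR borel_measurable_const)
  then have "integrable (distr (\<Pi>\<^sub>M b\<in>(Basis::'a set). lborel) borel (\<lambda>x. \<Sum>b\<in>Basis. x b *\<^sub>R b)) ?g"
    by (rule integrable_distr_eq[THEN iffD2]) (measurable, rule int_prod)
  then have g: "integrable lborel ?g"
    by (simp only: lborel_def[where 'a='a] lborel_eq_real)
  show ?thesis
  proof (rule Bochner_Integration.integrable_bound[OF g])
    show "AE x::'a in lborel. norm (exp (\<alpha> * norm x - \<beta> * (norm x)\<^sup>2)) \<le> norm (?g x)"
    proof (intro AE_I2)
      fix x :: 'a
      have "\<alpha> * norm x \<le> \<bar>\<alpha>\<bar> * (\<Sum>b\<in>Basis. \<bar>x \<bullet> b\<bar>)"
        by (rule order_trans[OF mult_right_mono[OF abs_ge_self] mult_left_mono[OF norm_le_l1]]) auto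
      moreover have "(norm x)\<^sup>2 = (\<Sum>b\<in>Basis. (x \<bullet> b)\<^sup>2)"
        by (subst power2_norm_eq_inner, subst euclidean_inner) (simp add: power2_eq_square)
      ultimately have "\<alpha> * norm x - \<beta> * (norm x)\<^sup>2 \<le> (\<Sum>b\<in>Basis. \<bar>\<alpha>\<bar> * \<bar>x \<bullet> b\<bar> - \<beta> * (x \<bullet> b)\<^sup>2)"
        by (simp add: sum_subtractf sum_distrib_left)
      then show "norm (exp (\<alpha> * norm x - \<beta> * (norm x)\<^sup>2)) \<le> norm (?g x)"
        by (simp add: exp_sum[symmetric] del: exp_le_cancel_iff) (simp add: exp_sum[symmetric])
    qed
  qed simp
qed

section \<open>Positivity and elementary inequalities\<close>

lemma integral_lborel_pos:
  fixes g :: "'a::euclidean_space \<Rightarrow> real"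
  assumes "integrable lborel g" "\<And>x. g x > 0"
  shows "(\<integral>x. g x \<partial>lborel) > 0"
proof -
  have "(\<integral>x. g x \<partial>lborel) \<noteq> 0"
  proof
    assume "(\<integral>x. g x \<partial>lborel) = 0"
    then have "AE x in lborel. g x = 0"
      using assms by (subst (asm) integral_nonneg_eq_0_iff_AE) (auto simp: less_imp_le)
    then have "AE x::'a in lborel. False"
      by eventually_elim (use assms(2) in \<open>metis less_irrefl\<close>)
    then have "(UNIV :: 'a set) \<in> null_sets lborel"
      by (simp add: AE_iff_null_sets[of UNIV lborel, simplified, symmetric])
    then show False
      by (simp add: null_sets_def)
  qed
  moreover have "(\<integral>x. g x \<partial>lborel) \<ge> 0"
    using assms(2) by (intro Bochner_Integration.integral_nonneg) (simp add: less_imp_le)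
  ultimately show ?thesis
    by simp
qed

lemma norm_le_one_plus_norm_sq: "norm x \<le> 1 + (norm x)\<^sup>2" for x :: "'a::real_inner"
proof -
  have "0 \<le> (norm x - 1)\<^sup>2 + (norm x)\<^sup>2 + 1"
    by simp
  then show ?thesis
    by (simp add: power2_eq_square algebra_simps)
qed

text \<open>Coercivity of t - ln t at both ends of the half-line. The upper bound uses the tangent
  of ln at 2 together with ln 2 < 1, which gives ln t \<le> t / 2.\<close>

lemma diff_ln_le_imp_bounds:
  fixes t M :: real
  assumes "t > 0" "t - ln t \<le> M"
  shows "exp (- M) \<le> t" "t \<le> 2 * M"
proof -
  have "- M \<le> ln t"
    using assms by linarith
  then show "exp (- M) \<le> t"
    using assms(1) by (simp add: ln_ge_iff)
  have "ln (t / 2) \<le> t / 2 - 1"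
    using assms(1) by (intro ln_le_minus_one) simp
  then show "t \<le> 2 * M"
    using assms ln_2_less_1 by (simp add: ln_div)
qed

lemma abs_exp_minus_one_le: "\<bar>exp x - 1\<bar> \<le> \<bar>x\<bar> * exp \<bar>x\<bar>" for x :: real
proof (cases "x \<ge> 0")
  case True
  have "1 - x \<le> exp (- x)"
    using exp_ge_add_one_self[of "- x"] by simp
  then have "(1 - x) * exp x \<le> exp (- x) * exp x"
    by (intro mult_right_mono) auto
  also have "\<dots> = 1"
    by (simp flip: exp_add)
  finally show ?thesis
    using True by (simp add: algebra_simps)
next
  case False
  have "1 - exp x \<le> - x"
    using exp_ge_add_one_self[of x] by linarith
  also have "\<dots> \<le> - x * exp (- x)"
    using False by (simp add: mult_le_cancel_left1)
  finally show ?thesis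
    using False by simp
qed

text \<open>Differentiation of \<open>\<integral> F exp k\<close> at \<open>k = 0\<close> along a family \<open>k n = \<epsilon> n * k' + o(\<epsilon> n)\<close>.  All variations
  below (test functions, temperature, translations, dilations) are instances.\<close>

lemma integral_exp_perturbation:
  fixes F K k :: "'a \<Rightarrow> real" and kn :: "nat \<Rightarrow> 'a \<Rightarrow> real"
  assumes meas [measurable]: "F \<in> borel_measurable M" "K \<in> borel_measurable M" "k \<in> borel_measurable M"
      "\<And>n. kn n \<in> borel_measurable M"
    and F: "\<And>x. 0 \<le> F x" and \<delta>: "\<delta> > 0"
    and int: "integrable M (\<lambda>x. F x * exp (\<delta> * K x))"
    and \<epsilon>: "\<And>n. \<epsilon> n > 0" "\<epsilon> \<longlonglongrightarrow> 0"
    and bound: "\<And>n x. \<bar>kn n x\<bar> \<le> \<epsilon> n * K x"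
    and lim: "AE x in M. (\<lambda>n. kn n x / \<epsilon> n) \<longlonglongrightarrow> k x"
  shows "integrable M (\<lambda>x. F x * k x)"
    and "(\<lambda>n. ((\<integral>x. F x * exp (kn n x) \<partial>M) - (\<integral>x. F x \<partial>M)) / \<epsilon> n) \<longlonglongrightarrow> (\<integral>x. F x * k x \<partial>M)"
    and "eventually (\<lambda>n. integrable M (\<lambda>x. F x * exp (kn n x))) sequentially"
proof -
  have K: "K x \<ge> 0" for x
    using bound[of 0 x] \<epsilon>(1)[of 0] by (smt (verit) mult_pos_neg)
  have intF: "integrable M F"
  proof (rule Bochner_Integration.integrable_bound[OF int])
    have "norm (F x) \<le> norm (F x * exp (\<delta> * K x))" for x
      using F[of x] K[of x] \<delta> mult_left_mono[of 1 "exp (\<delta> * K x)" "F x"] by (simp add: abs_mult)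
    then show "AE x in M. norm (F x) \<le> norm (F x * exp (\<delta> * K x))"
      by simp
  qed simp
  have small: "eventually (\<lambda>n. \<epsilon> n < \<delta> / 2) sequentially"
    using order_tendstoD(2)[OF \<epsilon>(2), of "\<delta> / 2"] \<delta> by simp
  obtain N where N: "\<And>n. n \<ge> N \<Longrightarrow> \<epsilon> n < \<delta> / 2"
    using small unfolding eventually_sequentially by blast
  \<comment> \<open>Half of the available exponent dominates the linear factor \<open>K x\<close>.
    This is why \<epsilon> is kept below \<delta> / 2, and it makes a multiple of
    \<open>F x * exp (\<delta> * K x)\<close> dominate all difference quotients.\<close>
  have Kexp: "K x * exp (\<delta> / 2 * K x) \<le> 2 / \<delta> * exp (\<delta> * K x)" for x
  proof -
    have "\<delta> / 2 * K x \<le> exp (\<delta> / 2 * K x)"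
      using exp_ge_add_one_self[of "\<delta> / 2 * K x"] by linarith
    then have "\<delta> / 2 * K x * exp (\<delta> / 2 * K x) \<le> exp (\<delta> / 2 * K x) * exp (\<delta> / 2 * K x)"
      by (intro mult_right_mono) auto
    also have "\<dots> = exp (\<delta> * K x)"
      by (simp flip: exp_add)
    finally show ?thesis
      using \<delta> by (simp add: field_simps)
  qed
  have kn_exp: "\<bar>kn n x\<bar> \<le> \<delta> / 2 * K x" if "n \<ge> N" for n x
    using bound[of n x] N[OF that] K[of x] by (meson less_imp_le mult_right_mono order_trans)
  have intn: "integrable M (\<lambda>x. F x * exp (kn n x))" if "n \<ge> N" for n
  proof (rule Bochner_Integration.integrable_bound[OF int])
    have "kn n x \<le> \<delta> * K x" for x
      using kn_exp[OF that, of x] K[of x] \<delta> by (smt (verit) mult_nonneg_nonneg field_sum_of_halves distrib_right)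
    then show "AE x in M. norm (F x * exp (kn n x)) \<le> norm (F x * exp (\<delta> * K x))"
      using F by (auto intro!: mult_left_mono simp: abs_mult)
  qed simp
  then show "eventually (\<lambda>n. integrable M (\<lambda>x. F x * exp (kn n x))) sequentially"
    unfolding eventually_sequentially by blast
  let ?q = "\<lambda>n x. F x * ((exp (kn n x) - 1) / \<epsilon> n)"
  let ?w = "\<lambda>x. F x * exp (\<delta> * K x) * (2 / \<delta>)"
  have w: "integrable M ?w"
    using int by simp
  have dom: "AE x in M. norm (?q (n + N) x) \<le> ?w x" for n
  proof (intro AE_I2)
    fix x
    let ?n = "n + N"
    have "\<bar>exp (kn ?n x) - 1\<bar> \<le> \<bar>kn ?n x\<bar> * exp \<bar>kn ?n x\<bar>"
      by (rule abs_exp_minus_one_le)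
    also have "\<dots> \<le> (\<epsilon> ?n * K x) * exp (\<delta> / 2 * K x)"
      using bound[of ?n x] kn_exp[of ?n x] by (intro mult_mono) auto
    also have "\<dots> \<le> \<epsilon> ?n * (2 / \<delta> * exp (\<delta> * K x))"
      unfolding mult.assoc[of "\<epsilon> ?n"] using \<epsilon>(1)[of ?n] by (intro mult_left_mono Kexp) simp
    finally have "\<bar>exp (kn ?n x) - 1\<bar> / \<epsilon> ?n \<le> 2 / \<delta> * exp (\<delta> * K x)"
      using \<epsilon>(1)[of ?n] by (simp add: pos_divide_le_eq mult.commute)
    then have "F x * (\<bar>exp (kn ?n x) - 1\<bar> / \<epsilon> ?n) \<le> F x * (2 / \<delta> * exp (\<delta> * K x))"
      by (rule mult_left_mono) (rule F)
    then show "norm (?q ?n x) \<le> ?w x"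
      using F[of x] \<epsilon>(1)[of ?n] by (simp add: abs_mult mult_ac)
  qed
  have ptw: "AE x in M. (\<lambda>n. ?q (n + N) x) \<longlonglongrightarrow> F x * k x"
    using lim
  proof eventually_elim
    fix x assume x: "(\<lambda>n. kn n x / \<epsilon> n) \<longlonglongrightarrow> k x"
    have "(\<lambda>n. kn n x / \<epsilon> n * \<epsilon> n) \<longlonglongrightarrow> k x * 0"
      by (intro tendsto_intros x \<epsilon>)
    then have kn0: "(\<lambda>n. kn n x) \<longlonglongrightarrow> 0"
      using \<epsilon>(1) by (simp add: less_imp_neq[symmetric])
    \<comment> \<open>The continuous extension of the quotient to 0 avoids separating the indices
      with \<open>kn n x = 0\<close>.\<close>
    define G where "G y = (if y = 0 then 1 else (exp y - 1) / y)" for y :: real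
    have "((\<lambda>y::real. (exp y - 1) / y) \<longlongrightarrow> 1) (at 0)"
      using DERIV_exp[of 0] by (simp add: DERIV_def)
    then have "isCont G 0"
      unfolding isCont_def G_def by (auto cong: filterlim_cong simp: eventually_at_filter intro: Lim_transform_eventually)
    then have "(\<lambda>n. G (kn n x)) \<longlonglongrightarrow> G 0"
      using kn0 by (rule isCont_tendsto_compose)
    then have "(\<lambda>n. F x * (G (kn n x) * (kn n x / \<epsilon> n))) \<longlonglongrightarrow> F x * (1 * k x)"
      by (intro tendsto_intros x) (simp add: G_def)
    moreover have "G (kn n x) * (kn n x / \<epsilon> n) = (exp (kn n x) - 1) / \<epsilon> n" for n
      by (simp add: G_def)
    ultimately have "(\<lambda>n. ?q n x) \<longlonglongrightarrow> F x * k x"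
      by (simp only: mult_1)
    then show "(\<lambda>n. ?q (n + N) x) \<longlonglongrightarrow> F x * k x"
      by (rule LIMSEQ_ignore_initial_segment)
  qed
  show "integrable M (\<lambda>x. F x * k x)"
    by (rule integrable_dominated_convergence[OF _ _ w ptw dom]) auto
  have "(\<lambda>n. \<integral>x. ?q (n + N) x \<partial>M) \<longlonglongrightarrow> (\<integral>x. F x * k x \<partial>M)"
    by (rule integral_dominated_convergence[OF _ _ w ptw dom]) auto
  moreover have "(\<integral>x. ?q (n + N) x \<partial>M)
      = ((\<integral>x. F x * exp (kn (n + N) x) \<partial>M) - (\<integral>x. F x \<partial>M)) / \<epsilon> (n + N)" for n
  proof -
    have "(\<integral>x. ?q (n + N) x \<partial>M) = (\<integral>x. (F x * exp (kn (n + N) x) - F x) / \<epsilon> (n + N) \<partial>M)"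
      by (intro Bochner_Integration.integral_cong) (auto simp: algebra_simps)
    then show ?thesis
      using intn[of "n + N"] intF by simp
  qed
  ultimately have "(\<lambda>n. ((\<integral>x. F x * exp (kn (n + N) x) \<partial>M) - (\<integral>x. F x \<partial>M)) / \<epsilon> (n + N))
      \<longlonglongrightarrow> (\<integral>x. F x * k x \<partial>M)"
    by (simp only:)
  then show "(\<lambda>n. ((\<integral>x. F x * exp (kn n x) \<partial>M) - (\<integral>x. F x \<partial>M)) / \<epsilon> n) \<longlonglongrightarrow> (\<integral>x. F x * k x \<partial>M)"
    by (rule LIMSEQ_offset)
qed

section \<open>Almost everywhere differentiability\<close>

text \<open>The second difference quotient of a convex function is nonnegative, and a translation moves its
  integral against a Gaussian onto the Gaussian, where it tends to zero.\<close>

lemma subgradients_in_ball_AE_symmetric_difference: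
  fixes f :: "'a::euclidean_space \<Rightarrow> real" and e :: 'a
  assumes f: "subgradients_in_ball R f"
  shows "AE w in lborel. \<forall>\<epsilon>>0. \<exists>s>0. f (w + s *\<^sub>R e) + f (w - s *\<^sub>R e) - 2 * f w \<le> \<epsilon> * s"
proof -
  note [measurable] = subgradients_in_ball_borel[OF f]
  define s where "s n = 1 / real (Suc n)" for n
  have s: "s n > 0" "s n \<le> 1" for n
    by (simp_all add: s_def)
  have s0: "s \<longlonglongrightarrow> 0"
    using LIMSEQ_inverse_real_of_nat by (simp add: s_def[abs_def] inverse_eq_divide)
  define \<rho> where "\<rho> w = exp (- (norm w)\<^sup>2)" for w :: 'a
  \<comment> \<open>One integrable function that dominates the Gaussian and all its translates by
    \<open>s n *\<^sub>R e\<close> with \<open>s n \<le> 1\<close>, since such a translation lowers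
    the squared norm by at most \<open>2 * norm e * norm w\<close>.\<close>
  define \<rho>' where "\<rho>' w = exp (2 * norm e * norm w - 1 * (norm w)\<^sup>2)" for w :: 'a
  have [measurable]: "\<rho> \<in> borel_measurable borel"
    unfolding \<rho>_def by measurable
  have \<rho>': "integrable lborel \<rho>'"
    unfolding \<rho>'_def by (rule integrable_exp_linear_minus_quadratic) simp
  have \<rho>_shift: "\<rho> (w + s n *\<^sub>R e) \<le> \<rho>' w" for n w
  proof -
    have "- 2 * inner w (s n *\<^sub>R e) \<le> 2 * (norm w * norm (s n *\<^sub>R e))"
      using norm_cauchy_schwarz[of "- w" "s n *\<^sub>R e"] by (simp add: mult_ac)
    also have "\<dots> \<le> 2 * (norm w * norm e)"
      using s[of n] mult_right_mono[of "s n" 1 "norm e"] by (intro mult_left_mono) auto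
    finally have "(norm w)\<^sup>2 - 2 * (norm w * norm e) \<le> (norm w)\<^sup>2 + 2 * inner w (s n *\<^sub>R e) + (norm (s n *\<^sub>R e))\<^sup>2"
      using zero_le_power2[of "norm (s n *\<^sub>R e)"] by linarith
    also have "\<dots> = (norm (w + s n *\<^sub>R e))\<^sup>2"
      by (simp add: power2_norm_eq_inner inner_simps inner_commute del: norm_scaleR)
    finally show ?thesis
      by (simp add: \<rho>_def \<rho>'_def algebra_simps)
  qed
  have \<rho>_le: "\<rho> w \<le> \<rho>' w" for w
    by (simp add: \<rho>_def \<rho>'_def)
  have \<rho>_pos: "\<rho> w > 0" for w
    by (simp add: \<rho>_def)
  have \<rho>: "integrable lborel \<rho>"
  proof (rule Bochner_Integration.integrable_bound[OF \<rho>'])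
    have "norm (\<rho> w) \<le> norm (\<rho>' w)" for w
      using \<rho>_le[of w] \<rho>_pos[of w] by simp
    then show "AE w in lborel. norm (\<rho> w) \<le> norm (\<rho>' w)"
      by simp
  qed simp
  define q where "q n w = (f (w + s n *\<^sub>R e) - f w) / s n" for n w
  define p where "p n w = (f w - f (w - s n *\<^sub>R e)) / s n" for n w
  have [measurable]: "q n \<in> borel_measurable borel" "p n \<in> borel_measurable borel" for n
    unfolding q_def p_def by measurable
  have q: "\<bar>q n w\<bar> \<le> R * norm e" and p: "\<bar>p n w\<bar> \<le> R * norm e" for n w
    using subgradients_in_ball_lipschitz[OF f, of "w + s n *\<^sub>R e" w]
      subgradients_in_ball_lipschitz[OF f, of w "w - s n *\<^sub>R e"] s(1)[of n]
    by (simp_all add: q_def p_def pos_divide_le_eq mult_ac)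
  have bounded_mult: "integrable lborel (\<lambda>w. u w * \<mu> w)"
    if [measurable]: "u \<in> borel_measurable borel" "\<mu> \<in> borel_measurable borel"
      and "\<And>w. \<bar>u w\<bar> \<le> R * norm e" "\<And>w. \<bar>\<mu> w\<bar> \<le> \<rho>' w" for u \<mu> :: "'a \<Rightarrow> real"
  proof (rule Bochner_Integration.integrable_bound)
    show "integrable lborel (\<lambda>w. R * norm e * \<rho>' w)"
      using \<rho>' by simp
    have "\<bar>u w * \<mu> w\<bar> \<le> R * norm e * \<rho>' w" for w
      unfolding abs_mult using that subgradients_in_ball_nonneg[OF f] by (intro mult_mono) auto
    then show "AE w in lborel. norm (u w * \<mu> w) \<le> norm (R * norm e * \<rho>' w)"
      by (intro AE_I2) (simp add: order_trans[OF _ abs_ge_self])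
  qed measurable
  have intq: "integrable lborel (\<lambda>w. q n w * \<rho> w)" and intp: "integrable lborel (\<lambda>w. p n w * \<rho> w)"
    and intq': "integrable lborel (\<lambda>w. q n w * \<rho> (w + s n *\<^sub>R e))" for n
  proof -
    have "\<bar>\<rho> w\<bar> \<le> \<rho>' w" "\<bar>\<rho> (w + s n *\<^sub>R e)\<bar> \<le> \<rho>' w" for w
      using \<rho>_le[of w] \<rho>_shift[of w n] \<rho>_pos[of w] \<rho>_pos[of "w + s n *\<^sub>R e"] by simp_all
    then show "integrable lborel (\<lambda>w. q n w * \<rho> w)" "integrable lborel (\<lambda>w. p n w * \<rho> w)"
      "integrable lborel (\<lambda>w. q n w * \<rho> (w + s n *\<^sub>R e))"
      by (intro bounded_mult q p; simp)+
  qed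
  define g where "g n w = (q n w - p n w) * \<rho> w" for n w
  have [measurable]: "g n \<in> borel_measurable borel" for n
    unfolding g_def by measurable
  have g_eq: "g n w = (f (w + s n *\<^sub>R e) + f (w - s n *\<^sub>R e) - 2 * f w) / s n * \<rho> w" for n w
    by (simp add: g_def q_def p_def diff_divide_distrib add_divide_distrib)
  have g_nonneg: "0 \<le> g n w" for n w
  proof -
    obtain v where "subgradient f w v"
      using f unfolding subgradients_in_ball_def by blast
    then have "f w + inner v (s n *\<^sub>R e) \<le> f (w + s n *\<^sub>R e)"
      "f w + inner v (- s n *\<^sub>R e) \<le> f (w - s n *\<^sub>R e)"
      unfolding subgradient_def by (auto dest: spec[of _ "w + s n *\<^sub>R e"] spec[of _ "w - s n *\<^sub>R e"])
    then show ?thesis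
      using \<rho>_pos[of w] s(1)[of n] by (simp add: g_eq)
  qed
  have intg: "integrable lborel (g n)" for n
    unfolding g_def left_diff_distrib by (intro Bochner_Integration.integrable_diff intq intp)
  have g_int: "(\<integral>w. g n w \<partial>lborel) = (\<integral>w. q n w * (\<rho> w - \<rho> (w + s n *\<^sub>R e)) \<partial>lborel)" for n
  proof -
    have "(\<integral>w. p n w * \<rho> w \<partial>lborel) = (\<integral>w. p n (s n *\<^sub>R e + 1 *\<^sub>R w) * \<rho> (s n *\<^sub>R e + 1 *\<^sub>R w) \<partial>lborel)"
      by (subst integrable_lborel_affine(2)[OF _ intp]) auto
    also have "\<dots> = (\<integral>w. q n w * \<rho> (w + s n *\<^sub>R e) \<partial>lborel)"
      by (simp add: p_def q_def add.commute)
    finally show ?thesis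
      using intq[of n] intp[of n] intq'[of n] by (simp add: g_def left_diff_distrib right_diff_distrib)
  qed
  have "(\<lambda>n. \<integral>w. q n w * (\<rho> w - \<rho> (w + s n *\<^sub>R e)) \<partial>lborel) \<longlonglongrightarrow> integral\<^sup>L lborel (\<lambda>_::'a. 0::real)"
  proof (rule integral_dominated_convergence[where w="\<lambda>w. R * norm e * (2 * \<rho>' w)"])
    show "integrable lborel (\<lambda>w. R * norm e * (2 * \<rho>' w))"
      using \<rho>' by simp
    have R_e: "0 \<le> R * norm e"
      using subgradients_in_ball_nonneg[OF f] by simp
    have bd: "\<bar>q n w * (\<rho> w - \<rho> (w + s n *\<^sub>R e))\<bar> \<le> R * norm e * \<bar>\<rho> w - \<rho> (w + s n *\<^sub>R e)\<bar>" for n w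
      unfolding abs_mult by (intro mult_right_mono q) auto
    have "\<bar>\<rho> w - \<rho> (w + s n *\<^sub>R e)\<bar> \<le> 2 * \<rho>' w" for n w
      using \<rho>_shift[where w=w and n=n] \<rho>_le[of w] \<rho>_pos[of w] \<rho>_pos[of "w + s n *\<^sub>R e"] by linarith
    then show "AE w in lborel. norm (q n w * (\<rho> w - \<rho> (w + s n *\<^sub>R e))) \<le> R * norm e * (2 * \<rho>' w)" for n
      using order_trans[OF bd mult_left_mono[OF _ R_e]] by (intro AE_I2) (simp only: real_norm_def)
    have "(\<lambda>n. q n w * (\<rho> w - \<rho> (w + s n *\<^sub>R e))) \<longlonglongrightarrow> 0" for w
    proof (rule Lim_null_comparison)
      show "\<forall>\<^sub>F n in sequentially. norm (q n w * (\<rho> w - \<rho> (w + s n *\<^sub>R e)))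
          \<le> R * norm e * \<bar>\<rho> w - \<rho> (w + s n *\<^sub>R e)\<bar>"
        unfolding real_norm_def by (intro always_eventually allI bd)
      have "(\<lambda>n. R * norm e * \<bar>\<rho> w - \<rho> (w + s n *\<^sub>R e)\<bar>) \<longlonglongrightarrow> R * norm e * \<bar>\<rho> w - \<rho> (w + 0 *\<^sub>R e)\<bar>"
        unfolding \<rho>_def by (intro tendsto_intros s0)
      then show "(\<lambda>n. R * norm e * \<bar>\<rho> w - \<rho> (w + s n *\<^sub>R e)\<bar>) \<longlonglongrightarrow> 0"
        by simp
    qed
    then show "AE w in lborel. (\<lambda>n. q n w * (\<rho> w - \<rho> (w + s n *\<^sub>R e))) \<longlonglongrightarrow> 0"
      by simp
  qed auto
  then have g0: "(\<lambda>n. \<integral>w. g n w \<partial>lborel) \<longlonglongrightarrow> 0"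
    by (simp add: g_int)
  have "(\<integral>\<^sup>+ w. (INF n. ennreal (g n w)) \<partial>lborel) \<le> ennreal (\<integral>w. g n w \<partial>lborel)" for n
    unfolding nn_integral_eq_integral[OF intg AE_I2[OF g_nonneg], symmetric]
    by (intro nn_integral_mono INF_lower) simp
  then have "(\<integral>\<^sup>+ w. (INF n. ennreal (g n w)) \<partial>lborel) \<le> ennreal 0"
    by (intro LIMSEQ_le_const[OF tendsto_ennrealI[OF g0]]) blast
  then have "(\<integral>\<^sup>+ w. (INF n. ennreal (g n w)) \<partial>lborel) = 0"
    by simp
  \<comment> \<open>The infimum over n suffices, because each \<epsilon> requires only one good step
    size. Hence convergence of the integrals to 0 is enough, without pointwise convergence.\<close>
  then have "AE w in lborel. (INF n. ennreal (g n w)) = 0"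
    by (subst (asm) nn_integral_0_iff_AE) auto
  then show ?thesis
  proof eventually_elim
    fix w assume w: "(INF n. ennreal (g n w)) = 0"
    show "\<forall>\<epsilon>>0. \<exists>s>0. f (w + s *\<^sub>R e) + f (w - s *\<^sub>R e) - 2 * f w \<le> \<epsilon> * s"
    proof (intro allI impI)
      fix \<epsilon> :: real assume "\<epsilon> > 0"
      then have "(INF n. ennreal (g n w)) < ennreal (\<epsilon> * \<rho> w)"
        using w \<rho>_pos[of w] by simp
      then obtain n where "ennreal (g n w) < ennreal (\<epsilon> * \<rho> w)"
        by (auto simp: INF_less_iff)
      then have "g n w < \<epsilon> * \<rho> w"
        using g_nonneg[of n w] by (simp add: ennreal_less_iff)
      then have "(f (w + s n *\<^sub>R e) + f (w - s n *\<^sub>R e) - 2 * f w) / s n < \<epsilon>"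
        unfolding g_eq using \<rho>_pos[of w] by (simp only: mult_less_cancel_right_pos)
      then show "\<exists>s>0. f (w + s *\<^sub>R e) + f (w - s *\<^sub>R e) - 2 * f w \<le> \<epsilon> * s"
        using s(1)[of n] by (intro exI[of _ "s n"]) (simp add: pos_divide_less_eq less_imp_le)
    qed
  qed
qed

text \<open>The subgradient bounds \<open>f\<close> from below at \<open>w - s *\<^sub>R u\<close>,
  so a small second difference bounds \<open>f\<close> from above at
  \<open>w + s *\<^sub>R u\<close>. Convexity carries that bound back along the segment to
  \<open>w\<close>.\<close>

lemma convex_on_segment_bound:
  fixes f :: "'a::real_inner \<Rightarrow> real"
  assumes f: "convex_on UNIV f" and v: "subgradient f w v"
    and gap: "f (w + s *\<^sub>R u) + f (w - s *\<^sub>R u) - 2 * f w \<le> \<epsilon> * s"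
    and t: "0 \<le> t" "t \<le> s" "0 < s"
  shows "f (w + t *\<^sub>R u) \<le> f w + t * inner v u + \<epsilon> * t"
proof -
  have "f w + inner v (- s *\<^sub>R u) \<le> f (w - s *\<^sub>R u)"
    using v unfolding subgradient_def by (auto dest: spec[of _ "w - s *\<^sub>R u"])
  then have end_bound: "f (w + s *\<^sub>R u) \<le> f w + s * inner v u + \<epsilon> * s"
    using gap by simp
  have "f ((1 - t / s) *\<^sub>R w + (t / s) *\<^sub>R (w + s *\<^sub>R u)) \<le> (1 - t / s) * f w + (t / s) * f (w + s *\<^sub>R u)"
    using t by (intro convex_onD[OF f]) auto
  also have "(1 - t / s) *\<^sub>R w + (t / s) *\<^sub>R (w + s *\<^sub>R u) = w + t *\<^sub>R u"
    using t by (simp add: algebra_simps)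
  also have "(1 - t / s) * f w + (t / s) * f (w + s *\<^sub>R u)
      \<le> (1 - t / s) * f w + (t / s) * (f w + s * inner v u + \<epsilon> * s)"
    using t end_bound by (intro add_left_mono mult_left_mono) auto
  also have "\<dots> = f w + t * inner v u + \<epsilon> * t"
    using t by (simp add: field_simps)
  finally show ?thesis .
qed

text \<open>The lower bound for \<open>f\<close> near \<open>w\<close> is the subgradient
  inequality. For the upper bound a point near \<open>w\<close> is written as an average of points
  on the coordinate axes through \<open>w\<close>, where the second differences control
  \<open>f\<close>.\<close>

lemma differentiable_at_if_partial_gaps_vanish:
  fixes f :: "'a::euclidean_space \<Rightarrow> real"
  assumes f: "convex_on UNIV f" and v: "subgradient f w v"
    and gap: "\<And>b \<epsilon>. b \<in> Basis \<Longrightarrow> \<epsilon> > 0 \<Longrightarrow>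
      \<exists>s>0. f (w + s *\<^sub>R b) + f (w - s *\<^sub>R b) - 2 * f w \<le> \<epsilon> * s"
  shows "(f has_derivative inner v) (at w)"
  unfolding has_derivative_at_alt
proof (intro conjI allI impI)
  fix e :: real assume e: "e > 0"
  define n where "n = real DIM('a)"
  have n: "n > 0"
    by (simp add: n_def)
  define \<epsilon> where "\<epsilon> = e / n"
  have \<epsilon>: "\<epsilon> > 0"
    using e n by (simp add: \<epsilon>_def)
  have "\<forall>b\<in>Basis. \<exists>s>0. f (w + s *\<^sub>R b) + f (w - s *\<^sub>R b) - 2 * f w \<le> \<epsilon> * s"
    using gap[OF _ \<epsilon>] by blast
  then obtain s where s: "\<And>b. b \<in> Basis \<Longrightarrow> s b > 0"
    "\<And>b. b \<in> Basis \<Longrightarrow> f (w + s b *\<^sub>R b) + f (w - s b *\<^sub>R b) - 2 * f w \<le> \<epsilon> * s b"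
    by metis
  \<comment> \<open>The axis points lie up to \<open>n\<close> times as far from \<open>w\<close> as
    the averaged point, so the radius shrinks by that factor; \<epsilon> = e / n compensates for
    summing \<open>n\<close> coordinate errors.\<close>
  define d where "d = Min (s ` Basis) / n"
  have d: "d > 0" "\<And>b. b \<in> Basis \<Longrightarrow> n * d \<le> s b"
    using s n by (auto simp: d_def)
  have line: "f (w + t *\<^sub>R b) \<le> f w + t * inner v b + \<epsilon> * \<bar>t\<bar>" if "b \<in> Basis" "\<bar>t\<bar> \<le> s b" for t b
  proof (cases "t \<ge> 0")
    case True
    then show ?thesis
      using convex_on_segment_bound[OF f v s(2)[OF that(1)], of t] s(1)[OF that(1)] that by simp
  next
    case False
    have "f (w + s b *\<^sub>R - b) + f (w - s b *\<^sub>R - b) - 2 * f w \<le> \<epsilon> * s b"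
      using s(2)[OF that(1)] by simp
    from convex_on_segment_bound[OF f v this, of "- t"] show ?thesis
      using False s(1)[OF that(1)] that by simp
  qed
  have "norm (f y - f w - inner v (y - w)) \<le> e * norm (y - w)" if y: "norm (y - w) < d" for y
  proof -
    define h where "h = y - w"
    have small: "\<bar>n * inner h b\<bar> \<le> s b" if "b \<in> Basis" for b
    proof -
      have "\<bar>n * inner h b\<bar> \<le> n * d"
        using Basis_le_norm[OF that, of h] y n by (simp add: abs_mult h_def)
      then show ?thesis
        using d(2)[OF that] by linarith
    qed
    have "w + h = (\<Sum>b\<in>Basis. (1 / n) *\<^sub>R (w + (n * inner h b) *\<^sub>R b))"
      using n by (simp add: scaleR_add_right sum.distrib euclidean_representation)
        (simp add: n_def scaleR_sum_left[symmetric] flip: scaleR_left.sum)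
    then have "f (w + h) \<le> (\<Sum>b\<in>Basis. (1 / n) * f (w + (n * inner h b) *\<^sub>R b))"
      using n convex_on_sum[OF finite_Basis _ f, of "\<lambda>_. 1 / n" "\<lambda>b. w + (n * inner h b) *\<^sub>R b"]
      by (simp add: n_def)
    also have "\<dots> \<le> (\<Sum>b\<in>Basis. (1 / n) * (f w + (n * inner h b) * inner v b + \<epsilon> * \<bar>n * inner h b\<bar>))"
      using n by (intro sum_mono mult_left_mono line small) auto
    also have "\<dots> = (\<Sum>b\<in>Basis. f w / n + inner v b * inner h b + \<epsilon> * \<bar>inner h b\<bar>)"
      using n by (intro sum.cong) (auto simp: abs_mult field_simps)
    also have "\<dots> = f w + inner v h + \<epsilon> * (\<Sum>b\<in>Basis. \<bar>inner h b\<bar>)"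
      using n by (simp add: sum.distrib euclidean_inner[of v h] sum_distrib_left n_def)
    also have "(\<Sum>b\<in>Basis. \<bar>inner h b\<bar>) \<le> n * norm h"
      using sum_bounded_above[of Basis "\<lambda>b. \<bar>inner h b\<bar>" "norm h"] Basis_le_norm[of _ h] by (simp add: n_def)
    also have "\<epsilon> * (n * norm h) = e * norm h"
      using n by (simp add: \<epsilon>_def)
    finally have "f y - f w - inner v (y - w) \<le> e * norm (y - w)"
      using \<epsilon> by (simp add: h_def mult_left_mono)
    moreover have "f w + inner v (y - w) \<le> f y"
      using v by (simp add: subgradient_def)
    ultimately show ?thesis
      by simp
  qed
  then show "\<exists>d>0. \<forall>y. norm (y - w) < d \<longrightarrow> norm (f y - f w - inner v (y - w)) \<le> e * norm (y - w)"
    using d(1) by blast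
qed (rule bounded_linear_inner_right)

lemma subgradients_in_ball_AE_differentiable:
  fixes f :: "'a::euclidean_space \<Rightarrow> real"
  assumes f: "subgradients_in_ball R f"
  shows "AE w in lborel. f differentiable (at w)"
proof -
  have "AE w in lborel. \<forall>b\<in>Basis. \<forall>\<epsilon>>0. \<exists>s>0. f (w + s *\<^sub>R b) + f (w - s *\<^sub>R b) - 2 * f w \<le> \<epsilon> * s"
    by (intro AE_finite_allI subgradients_in_ball_AE_symmetric_difference[OF f]) simp
  then show ?thesis
  proof eventually_elim
    fix w assume gap: "\<forall>b\<in>Basis. \<forall>\<epsilon>>0. \<exists>s>0. f (w + s *\<^sub>R b) + f (w - s *\<^sub>R b) - 2 * f w \<le> \<epsilon> * s"
    obtain v where "subgradient f w v"
      using f unfolding subgradients_in_ball_def by blast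
    from differentiable_at_if_partial_gaps_vanish[OF subgradients_in_ball_convex[OF f] this] gap
    show "f differentiable (at w)"
      unfolding differentiable_def by blast
  qed
qed

text \<open>Nothing is known about \<open>grad f\<close> where \<open>f\<close> is not
  differentiable, not even measurability. Coordinatewise limits of difference quotients along a
  fixed sequence give a Borel map that agrees with it almost everywhere, since \<open>lim\<close> of
  measurable functions is measurable even where no limit exists.\<close>

lemma subgradients_in_ball_borel_gradient:
  fixes f :: "'a::euclidean_space \<Rightarrow> real"
  assumes f: "subgradients_in_ball R f"
  obtains T where "T \<in> borel_measurable borel" "\<And>w. norm (T w) \<le> R"
    "AE w in lborel. f differentiable (at w) \<and> T w = grad f w"
proof -
  note [measurable] = subgradients_in_ball_borel[OF f]
  define s where "s n = 1 / real (Suc n)" for n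
  have s: "s n > 0" for n
    by (simp add: s_def)
  have s0: "s \<longlonglongrightarrow> 0"
    using LIMSEQ_inverse_real_of_nat by (simp add: s_def[abs_def] inverse_eq_divide)
  then have s_at: "filterlim s (at 0) sequentially"
    using s by (simp add: filterlim_at less_imp_neq[symmetric])
  define T where "T w = (\<Sum>b\<in>Basis. lim (\<lambda>n. (f (w + s n *\<^sub>R b) - f w) / s n) *\<^sub>R b)" for w
  have [measurable]: "T \<in> borel_measurable borel"
    unfolding T_def by measurable
  have T: "T w = grad f w" if "f differentiable (at w)" for w
  proof -
    let ?v = "grad f w"
    have D: "(f has_derivative inner ?v) (at w)"
      by (rule subgradient_grad[OF f that])
    have "(\<lambda>n. (f (w + s n *\<^sub>R b) - f w) / s n) \<longlonglongrightarrow> inner ?v b" for b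
    proof -
      have "((\<lambda>t. w + t *\<^sub>R b) has_derivative (\<lambda>t. t *\<^sub>R b)) (at (0::real))"
        by (auto intro!: derivative_eq_intros)
      then have "((\<lambda>t. f (w + t *\<^sub>R b)) has_derivative (\<lambda>t. inner ?v (t *\<^sub>R b))) (at 0)"
        using has_derivative_compose[of _ _ 0 UNIV f "inner ?v"] D by fastforce
      then have "((\<lambda>t. f (w + t *\<^sub>R b)) has_field_derivative inner ?v b) (at 0)"
        by (simp add: has_field_derivative_def mult.commute[of _ "inner ?v b"])
      then have "((\<lambda>t. (f (w + t *\<^sub>R b) - f w) / t) \<longlongrightarrow> inner ?v b) (at 0)"
        by (simp add: DERIV_def)
      then show ?thesis
        by (rule filterlim_compose[OF _ s_at])
    qed
    then have "T w = (\<Sum>b\<in>Basis. inner ?v b *\<^sub>R b)"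
      unfolding T_def by (intro sum.cong) (auto simp: limI)
    then show ?thesis
      by (simp add: euclidean_representation)
  qed
  \<comment> \<open>Off the set of differentiability \<open>lim\<close> may take any value; the
    cut-off makes the bound \<open>R\<close> hold at every point.\<close>
  define T' where "T' w = (if norm (T w) \<le> R then T w else 0)" for w
  show thesis
  proof
    show "T' \<in> borel_measurable borel"
      unfolding T'_def by measurable
    show "norm (T' w) \<le> R" for w
      using subgradients_in_ball_nonneg[OF f] by (simp add: T'_def)
    show "AE w in lborel. f differentiable (at w) \<and> T' w = grad f w"
      using subgradients_in_ball_AE_differentiable[OF f]
      by eventually_elim (use T subgradient_grad(2)[OF f] in \<open>auto simp: T'_def\<close>)
  qed
qed

section \<open>Legendre duality for functions with bounded subgradients\<close>

lemma legendre_subgradient: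
  assumes "subgradient f w v"
  shows "legendre (\<lambda>x. ereal (f x)) v = ereal (inner v w - f w)"
  unfolding legendre_def
proof (rule antisym)
  show "(SUP x. ereal (inner v x) - ereal (f x)) \<le> ereal (inner v w - f w)"
  proof (rule SUP_least)
    fix x
    have "inner v x - f x \<le> inner v w - f w"
      using assms unfolding subgradient_def by (auto simp: inner_diff_right dest: spec[of _ x])
    then show "ereal (inner v x) - ereal (f x) \<le> ereal (inner v w - f w)"
      by simp
  qed
  show "ereal (inner v w - f w) \<le> (SUP x. ereal (inner v x) - ereal (f x))"
    by (rule SUP_upper2[of w]) auto
qed

lemma legendre_ge: "ereal (inner v w - f w) \<le> legendre (\<lambda>x. ereal (f x)) v"
  unfolding legendre_def by (rule SUP_upper2[of w]) auto

text \<open>Along the ray through \<open>v\<close> the linear term grows at rate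
  \<open>norm v * norm v\<close>, but \<open>f\<close> at rate at most
  \<open>R * norm v\<close>.\<close>

lemma legendre_outside_ball:
  assumes f: "subgradients_in_ball R f" and v: "norm v > R"
  shows "legendre (\<lambda>x. ereal (f x)) v = \<infinity>"
proof (rule ereal_top)
  fix B :: real
  have R: "0 \<le> R"
    using subgradients_in_ball_nonneg[OF f] .
  define k where "k = norm v * (norm v - R)"
  have k: "k > 0"
    using R v unfolding k_def by (intro mult_pos_pos) auto
  define t where "t = \<bar>B + f 0\<bar> / k"
  have "f (t *\<^sub>R v) \<le> f 0 + R * (t * norm v)"
    using subgradients_in_ball_lipschitz[OF f, of "t *\<^sub>R v" 0] k by (auto simp: t_def)
  then have "t * k - f 0 \<le> inner v (t *\<^sub>R v) - f (t *\<^sub>R v)"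
    by (simp add: k_def power2_norm_eq_inner[symmetric] power2_eq_square algebra_simps)
  moreover have "B \<le> t * k - f 0"
    using k by (simp add: t_def)
  ultimately have "ereal B \<le> ereal (inner v (t *\<^sub>R v) - f (t *\<^sub>R v))"
    by simp
  also have "\<dots> \<le> legendre (\<lambda>x. ereal (f x)) v"
    by (rule legendre_ge)
  finally show "ereal B \<le> legendre (\<lambda>x. ereal (f x)) v" .
qed

text \<open>A supremum of continuous functions is lower semicontinuous: its strict superlevel sets
  are unions of open sets, so the uncountable index set does no harm.\<close>

lemma legendre_borel [measurable]:
  fixes f :: "'a::euclidean_space \<Rightarrow> ereal"
  shows "legendre f \<in> borel_measurable borel"
proof (rule borel_measurableI_greater)
  fix y :: ereal
  have "{v \<in> space borel. y < legendre f v} = (\<Union>x. {v. y < ereal (inner v x) - f x})"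
    by (auto simp: legendre_def less_SUP_iff)
  moreover have "open {v. y < ereal (inner v x) - f x}" for x
  proof (cases "f x")
    case (real r)
    have "open {v. y < ereal (inner v x - r)}"
      by (intro open_Collect_less continuous_intros)
    with real show ?thesis
      by simp
  qed auto
  ultimately show "{v \<in> space borel. y < legendre f v} \<in> sets borel"
    by (metis (no_types, lifting) borel_open open_UN)
qed

text \<open>Biduality is elementary here: \<open>f\<close> has a subgradient at each point, and the
  supremum in the second transform is attained there. The conjugate is convex because its epigraph
  is an intersection of half-spaces.\<close>

lemma dual_convex_pair_legendre:
  fixes f :: "'a::euclidean_space \<Rightarrow> real"
  assumes f: "subgradients_in_ball R f"
  shows "dual_convex_pair (legendre (\<lambda>x. ereal (f x))) (\<lambda>x. ereal (f x))"
proof -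
  let ?\<psi> = "\<lambda>x. ereal (f x)"
  let ?\<phi> = "legendre ?\<psi>"
  have sub: "\<exists>v. subgradient f w v" for w
    using f unfolding subgradients_in_ball_def by blast
  have "convex_fun ?\<psi>"
    unfolding convex_fun_def
    using subgradients_in_ball_convex[OF f] convex_epigraph[of UNIV f]
    by (simp add: epigraph_def case_prod_unfold)
  moreover have "convex_fun ?\<phi>"
    unfolding convex_fun_def
  proof (intro conjI allI)
    show "?\<phi> v \<noteq> - \<infinity>" for v
      using legendre_ge[of v 0 f] by auto
    show "\<exists>v. ?\<phi> v \<noteq> \<infinity>"
    proof -
      obtain v where "subgradient f 0 v"
        using sub by blast
      then show ?thesis
        by (intro exI[of _ v]) (simp add: legendre_subgradient)
    qed
    have "?\<phi> v \<le> ereal t \<longleftrightarrow> (\<forall>x. inner x v - t \<le> f x)" for v t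
      unfolding legendre_def SUP_le_iff by (simp add: inner_commute[of v] diff_le_eq add.commute)
    then have "{(v, t). ?\<phi> v \<le> ereal t} = (\<Inter>x. {p. inner x (fst p) - snd p \<le> f x})"
      by auto
    also have "convex \<dots>"
    proof (intro convex_INT)
      fix x
      have "{p. inner x (fst p) - snd p \<le> f x} = {p. inner (x, - 1 :: real) p \<le> f x}"
        by auto
      then show "convex {p. inner x (fst p) - snd p \<le> f x}"
        using convex_halfspace_le[of "(x, - 1 :: real)" "f x"] by simp
    qed
    finally show "convex {(v, t). ?\<phi> v \<le> ereal t}" .
  qed
  moreover have "?\<psi> = legendre ?\<phi>"
  proof
    fix w
    show "?\<psi> w = legendre ?\<phi> w"
    proof (rule antisym)
      obtain v where v: "subgradient f w v"
        using sub by blast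
      have "ereal (f w) = ereal (inner w v) - ?\<phi> v"
        by (simp add: legendre_subgradient[OF v] inner_commute)
      also have "\<dots> \<le> legendre ?\<phi> w"
        unfolding legendre_def[of ?\<phi>] by (rule SUP_upper) simp
      finally show "?\<psi> w \<le> legendre ?\<phi> w" .
      show "legendre ?\<phi> w \<le> ?\<psi> w"
        unfolding legendre_def[of ?\<phi>]
      proof (rule SUP_least)
        fix v
        have "ereal (inner w v) - ?\<phi> v \<le> ereal (inner w v) - ereal (inner v w - f w)"
          by (intro ereal_minus_mono legendre_ge order_refl)
        then show "ereal (inner w v) - ?\<phi> v \<le> ?\<psi> w"
          by (simp add: inner_commute)
      qed
    qed
  qed
  ultimately show ?thesis
    unfolding dual_convex_pair_def by (intro conjI refl)
qed

text \<open>Near-maximizers of \<open>inner w v - c v\<close> are approximate subgradients at \<open>w\<close>.\<close>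

lemma subgradients_in_ball_SUP:
  fixes f :: "'a::euclidean_space \<Rightarrow> real"
  assumes upper: "\<And>v w. v \<in> D \<Longrightarrow> inner w v - c v \<le> f w"
    and near: "\<And>w \<delta>. \<delta> > 0 \<Longrightarrow> \<exists>v\<in>D. f w - \<delta> \<le> inner w v - c v"
    and D: "D \<subseteq> cball 0 R"
  shows "subgradients_in_ball R f"
proof (rule subgradients_in_ball_limit[where g="\<lambda>_. f" and \<delta>="\<lambda>n. 1 / real (Suc n)"])
  show "(\<lambda>n. 1 / real (Suc n)) \<longlonglongrightarrow> 0"
    using LIMSEQ_inverse_real_of_nat by (simp add: inverse_eq_divide)
  fix n :: nat and w
  obtain v where v: "v \<in> D" "f w - 1 / real (Suc n) \<le> inner w v - c v"
    using near[of "1 / real (Suc n)" w] by auto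
  have "f w + inner v (x - w) - 1 / real (Suc n) \<le> f x" for x
    using upper[OF v(1), of x] v(2) by (simp add: inner_diff_right inner_commute)
  with v(1) D show "\<exists>v. norm v \<le> R \<and> (\<forall>x. f w + inner v (x - w) - 1 / real (Suc n) \<le> f x)"
    by (auto intro!: exI[of _ v])
qed simp

text \<open>\<psi> is a supremum of affine functions whose slopes range over the effective domain of
  \<phi>, and that domain lies in the ball.\<close>

lemma admissible_subgradients_in_ball:
  assumes "(a, b, \<phi>, \<psi>) \<in> admissible R"
  shows "subgradients_in_ball R (\<lambda>w. real_of_ereal (\<psi> w))"
proof -
  have phi: "convex_fun \<phi>" and psi: "\<psi> = legendre \<phi>" and out: "\<And>v. norm v > R \<Longrightarrow> \<phi> v = \<infinity>"
    using assms unfolding admissible_def dual_convex_pair_def by blast+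
  define f where "f w = real_of_ereal (\<psi> w)" for w
  have f: "\<psi> w = ereal (f w)" for w
    unfolding f_def by (rule admissible_psi_finite[OF assms])
  define D where "D = {v. \<phi> v \<noteq> \<infinity>}"
  have fin: "\<phi> v = ereal (real_of_ereal (\<phi> v))" if "v \<in> D" for v
    using phi that by (cases "\<phi> v") (auto simp: convex_fun_def D_def)
  have "subgradients_in_ball R f"
  proof (rule subgradients_in_ball_SUP[where c="\<lambda>v. real_of_ereal (\<phi> v)"])
    show "D \<subseteq> cball 0 R"
      using out by (force simp: D_def not_less[symmetric])
    fix w
    show "inner w v - real_of_ereal (\<phi> v) \<le> f w" if "v \<in> D" for v
    proof -
      have "ereal (inner w v) - \<phi> v \<le> ereal (f w)"
        unfolding f[symmetric] psi legendre_def by (rule SUP_upper) simp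
      with fin[OF that] show ?thesis
        by (metis ereal_less_eq(3) ereal_minus(1))
    qed
    fix \<delta> :: real assume "\<delta> > 0"
    then have "ereal (f w - \<delta>) < legendre \<phi> w"
      using f[of w] psi by simp
    then obtain v where v: "ereal (f w - \<delta>) < ereal (inner w v) - \<phi> v"
      unfolding legendre_def less_SUP_iff by blast
    then have "v \<in> D"
      by (auto simp: D_def)
    with v fin[OF this] show "\<exists>v\<in>D. f w - \<delta> \<le> inner w v - real_of_ereal (\<phi> v)"
      by (metis ereal_less_eq(3) ereal_minus(1) less_imp_le)
  qed
  then show ?thesis
    by (simp add: f_def[abs_def])
qed

lemma admissible_legendre:
  fixes f :: "real ^ 'n \<Rightarrow> real"
  assumes "subgradients_in_ball R f"
  shows "(a, b, legendre (\<lambda>x. ereal (f x)), \<lambda>x. ereal (f x)) \<in> admissible R"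
  unfolding admissible_def
  using dual_convex_pair_legendre[OF assms] legendre_outside_ball[OF assms] by auto

section \<open>Existence of a maximizer\<close>

text \<open>The linear term \<open>a\<close> is set to zero and \<open>c\<close> stands for \<open>- b\<close>.  Maximizing
  over the additive constant in \<open>f\<close> turns the exponential integral into its logarithm.  The target
  density enters only through its measure \<open>\<mu>\<close>.\<close>

locale entropic_dual = prob_space \<mu> for \<mu> :: "'a::euclidean_space measure" +
  fixes h R :: real
  assumes h_pos: "0 < h" and R_nonneg: "0 \<le> R"
    and sets_mu [measurable_cong]: "sets \<mu> = sets borel"
    and mu_ball: "AE v in \<mu>. norm v \<le> R"
begin

text \<open>\<open>excess f\<close> is the Legendre transform of \<open>f\<close> minus its minimum \<open>- f 0\<close>.  Truncation by \<open>ennreal\<close>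
  is harmless because \<open>w = 0\<close> contributes \<open>0\<close>.\<close>

definition excess :: "('a \<Rightarrow> real) \<Rightarrow> 'a \<Rightarrow> ennreal" where
  "excess f v = (SUP w. ennreal (inner v w - f w + f 0))"

definition cost :: "('a \<Rightarrow> real) \<Rightarrow> ennreal" where
  "cost f = (\<integral>\<^sup>+ v. excess f v \<partial>\<mu>)"

definition potential :: "real \<Rightarrow> ('a \<Rightarrow> real) \<Rightarrow> 'a \<Rightarrow> real" where
  "potential c f w = (f w - c * (norm w)\<^sup>2 / 2) / h - 1"

definition partition :: "real \<Rightarrow> ('a \<Rightarrow> real) \<Rightarrow> real" where
  "partition c f = (\<integral>w. exp (potential c f w) \<partial>lborel)"

text \<open>For finite \<open>cost f\<close>, the largest value of J with a = 0 and b = - c over the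
  shifts f + k is d - h - \<open>objective c f\<close>: maximizing k - h exp (k / h) Z with Z =
  \<open>partition c f\<close> gives k = - h ln Z. The functional is therefore to be minimized, and
  it ignores constants added to \<open>f\<close>.\<close>

definition objective :: "real \<Rightarrow> ('a \<Rightarrow> real) \<Rightarrow> real" where
  "objective c f = enn2real (cost f) - f 0 + real DIM('a) * c / 2 + h * ln (partition c f)"

lemma excess_borel [measurable]: "excess f \<in> borel_measurable borel"
proof (rule borel_measurableI_greater)
  fix y :: ennreal
  have "{v \<in> space borel. y < excess f v} = (\<Union>w. {v. y < ennreal (inner v w - f w + f 0)})"
    by (auto simp: excess_def less_SUP_iff)
  moreover have "open {v. y < ennreal (inner v w - f w + f 0)}" for w
    by (intro open_Collect_less continuous_intros continuous_on_ennreal)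
  ultimately show "{v \<in> space borel. y < excess f v} \<in> sets borel"
    by (metis (no_types, lifting) borel_open open_UN)
qed

lemma excess_ge: "ennreal (inner v w - f w + f 0) \<le> excess f v"
  unfolding excess_def by (rule SUP_upper) simp

lemma excess_add_const: "excess (\<lambda>w. f w + k) = excess f"
proof -
  have "inner v w - (f w + k) + (f 0 + k) = inner v w - f w + f 0" for v w
    by simp
  then show ?thesis
    by (simp only: excess_def fun_eq_iff simp_thms)
qed

lemma cost_add_const: "cost (\<lambda>w. f w + k) = cost f"
  by (simp add: cost_def excess_add_const)

lemma potential_borel [measurable]:
  assumes "subgradients_in_ball R f"
  shows "potential c f \<in> borel_measurable borel"
proof -
  note [measurable] = subgradients_in_ball_borel[OF assms]
  show ?thesis
    unfolding potential_def by measurable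
qed

text \<open>\<open>f\<close> grows at most linearly, so the quadratic term of the potential leaves
  room for a Gaussian weight. This room dominates the difference quotients of all later
  variations.\<close>

lemma integrable_exp_potential_weighted:
  assumes f: "subgradients_in_ball R f" and s: "s < c / (2 * h)"
  shows "integrable lborel (\<lambda>w. exp (potential c f w) * exp (s * (1 + (norm w)\<^sup>2)))"
proof (rule Bochner_Integration.integrable_bound)
  note [measurable] = potential_borel[OF f]
  let ?g = "\<lambda>w::'a. exp (f 0 / h - 1 + s) * exp (R / h * norm w - (c / (2 * h) - s) * (norm w)\<^sup>2)"
  show "integrable lborel ?g"
    using s by (intro integrable_mult_right integrable_exp_linear_minus_quadratic) simp
  show "(\<lambda>w. exp (potential c f w) * exp (s * (1 + (norm w)\<^sup>2))) \<in> borel_measurable lborel"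
    by measurable
  have "potential c f w + s * (1 + (norm w)\<^sup>2)
      \<le> (f 0 / h - 1 + s) + (R / h * norm w - (c / (2 * h) - s) * (norm w)\<^sup>2)" for w
  proof -
    have "f w \<le> f 0 + R * norm w"
      using subgradients_in_ball_lipschitz[OF f, of w 0] by simp
    then have "f w / h \<le> (f 0 + R * norm w) / h"
      using h_pos by (intro divide_right_mono) auto
    then show ?thesis
      by (simp add: potential_def add_divide_distrib diff_divide_distrib algebra_simps)
  qed
  then have "exp (potential c f w) * exp (s * (1 + (norm w)\<^sup>2)) \<le> ?g w" for w
    unfolding exp_add[symmetric] by simp
  then show "AE w in lborel. norm (exp (potential c f w) * exp (s * (1 + (norm w)\<^sup>2))) \<le> norm (?g w)"
    by simp
qed

lemma integrable_exp_potential: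
  assumes f: "subgradients_in_ball R f" and c: "c > 0"
  shows "integrable lborel (\<lambda>w. exp (potential c f w))"
  using integrable_exp_potential_weighted[OF f, of 0 c] c h_pos by simp

lemma partition_pos:
  assumes "subgradients_in_ball R f" "c > 0"
  shows "partition c f > 0"
  unfolding partition_def using integrable_exp_potential[OF assms] by (rule integral_lborel_pos) simp

lemma partition_add_const: "partition c (\<lambda>w. f w + k) = exp (k / h) * partition c f"
proof -
  have "exp (potential c (\<lambda>w. f w + k) w) = exp (k / h) * exp (potential c f w)" for w
    by (simp add: potential_def add_divide_distrib diff_divide_distrib flip: exp_add)
  then show ?thesis
    by (simp add: partition_def)
qed

lemma objective_add_const:
  assumes "subgradients_in_ball R f" "c > 0"
  shows "objective c (\<lambda>w. f w + k) = objective c f"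
  using partition_pos[OF assms] h_pos
  by (simp add: objective_def cost_add_const partition_add_const ln_mult distrib_left)

text \<open>The supporting line at 0 may tilt the integrand, but pairing \<open>w\<close> with
  \<open>- w\<close> cancels the slope: f w + f (- w) \<ge> 0, and exp x \<ge> 1 + x yields a sum of
  at least 2. Rescaling by \<open>sqrt c\<close> extracts the power c^(-d/2) and leaves a constant
  independent of \<open>c\<close> and \<open>f\<close>.\<close>

lemma ln_partition_ge:
  obtains G where "\<And>c f. c > 0 \<Longrightarrow> subgradients_in_ball R f \<Longrightarrow> f 0 = 0 \<Longrightarrow>
    G - real DIM('a) / 2 * ln c \<le> ln (partition c f)"
proof -
  let ?q = "\<lambda>w::'a. exp (0 * norm w - 1 / (2 * h) * (norm w)\<^sup>2)"
  define G where "G = (\<integral>w. ?q w \<partial>lborel)"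
  have q: "integrable lborel ?q"
    using h_pos by (intro integrable_exp_linear_minus_quadratic) simp
  have G: "G > 0"
    unfolding G_def by (rule integral_lborel_pos[OF q]) simp
  have "(ln G - 1) - real DIM('a) / 2 * ln c \<le> ln (partition c f)"
    if c: "c > 0" and f: "subgradients_in_ball R f" and f0: "f 0 = 0" for c f
  proof -
    let ?E = "\<lambda>w. exp (potential c f w)"
    have E: "integrable lborel ?E"
      by (rule integrable_exp_potential[OF f c])
    note reflect = integrable_lborel_affine[of "-1" ?E 0, OF _ E, simplified]
    note scale = integrable_lborel_affine[of "sqrt c" ?q 0, OF _ q]
    have gauss: "2 * exp (- 1) * ?q (0 + sqrt c *\<^sub>R w) \<le> ?E w + ?E (- w)" for w
    proof -
      obtain v where "subgradient f 0 v"
        using f unfolding subgradients_in_ball_def by blast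
      then have "inner v w \<le> f w" "inner v (- w) \<le> f (- w)"
        using f0 unfolding subgradient_def by (metis add_0 diff_zero)+
      then have "0 \<le> f w / h + f (- w) / h"
        using h_pos by (simp flip: add_divide_distrib)
      moreover have "f w / h + 1 \<le> exp (f w / h)" "f (- w) / h + 1 \<le> exp (f (- w) / h)"
        unfolding add.commute[of _ 1] by (rule exp_ge_add_one_self)+
      ultimately have two: "2 \<le> exp (f w / h) + exp (f (- w) / h)"
        by linarith
      define g where "g = exp (- 1) * ?q (0 + sqrt c *\<^sub>R w)"
      have g: "g = exp (- (c * (norm w)\<^sup>2 / 2 / h) - 1)"
        using c by (simp add: g_def power_mult_distrib flip: exp_add)
      have "?E w + ?E (- w) = (exp (f w / h) + exp (f (- w) / h)) * g"
        unfolding g potential_def by (simp add: diff_divide_distrib distrib_right add_diff_eq flip: exp_add)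
      moreover have "2 * g \<le> (exp (f w / h) + exp (f (- w) / h)) * g"
        using two by (intro mult_right_mono) (auto simp: g_def)
      ultimately show ?thesis
        by (simp add: g_def)
    qed
    have "(\<integral>w. 2 * exp (- 1) * ?q (0 + sqrt c *\<^sub>R w) \<partial>lborel) \<le> (\<integral>w. ?E w + ?E (- w) \<partial>lborel)"
      using scale(1) E reflect(1) c gauss
      by (intro integral_mono integrable_mult_right Bochner_Integration.integrable_add) auto
    also have "\<dots> = 2 * partition c f"
      using E reflect by (simp add: partition_def)
    also have "(\<integral>w. 2 * exp (- 1) * ?q (0 + sqrt c *\<^sub>R w) \<partial>lborel) = 2 * exp (- 1) * (G / \<bar>sqrt c\<bar> ^ DIM('a))"
      unfolding G_def by (subst scale(2)[symmetric]) (use c in auto)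
    finally have "exp (- 1) * (G / sqrt c ^ DIM('a)) \<le> partition c f"
      using c by simp
    moreover have "0 < exp (- 1) * (G / sqrt c ^ DIM('a))"
      using G c by simp
    ultimately have "ln (exp (- 1) * (G / sqrt c ^ DIM('a))) \<le> ln (partition c f)"
      by (simp add: ln_mono)
    moreover have "ln (exp (- 1) * (G / sqrt c ^ DIM('a))) = (ln G - 1) - real DIM('a) / 2 * ln c"
      using G c by (simp add: ln_mult ln_div ln_realpow ln_sqrt)
    ultimately show ?thesis
      by simp
  qed
  then show thesis
    by (rule that)
qed

text \<open>For fixed \<open>w\<close> the expression inside \<open>excess\<close> passes to the
  limit, so \<open>excess\<close> is lower semicontinuous under pointwise convergence; Fatou's lemma
  does the rest.\<close>

lemma cost_le_limit:
  assumes lim: "\<And>w. (\<lambda>n. g n w) \<longlonglongrightarrow> f w" and cost: "(\<lambda>n. cost (g n)) \<longlonglongrightarrow> A"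
  shows "cost f \<le> A"
proof -
  have "excess f v \<le> liminf (\<lambda>n. excess (g n) v)" for v
    unfolding excess_def[of f]
  proof (rule SUP_least)
    fix w
    have "(\<lambda>n. ennreal (inner v w - g n w + g n 0)) \<longlonglongrightarrow> ennreal (inner v w - f w + f 0)"
      by (intro tendsto_intros lim)
    then have "ennreal (inner v w - f w + f 0) = liminf (\<lambda>n. ennreal (inner v w - g n w + g n 0))"
      by (intro lim_imp_Liminf[symmetric]) auto
    also have "\<dots> \<le> liminf (\<lambda>n. excess (g n) v)"
      by (intro Liminf_mono always_eventually allI excess_ge)
    finally show "ennreal (inner v w - f w + f 0) \<le> liminf (\<lambda>n. excess (g n) v)" .
  qed
  then have "cost f \<le> (\<integral>\<^sup>+ v. liminf (\<lambda>n. excess (g n) v) \<partial>\<mu>)"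
    unfolding cost_def by (intro nn_integral_mono)
  also have "\<dots> \<le> liminf (\<lambda>n. cost (g n))"
    unfolding cost_def by (rule nn_integral_liminf) measurable
  also have "\<dots> = A"
    by (intro lim_imp_Liminf cost) simp
  finally show ?thesis .
qed

lemma partition_le_limit:
  assumes g: "\<And>n. subgradients_in_ball R (g n)" and f: "subgradients_in_ball R f"
    and pos: "\<And>n. c n > 0" "c' > 0"
    and lim: "\<And>w. (\<lambda>n. g n w) \<longlonglongrightarrow> f w" "c \<longlonglongrightarrow> c'" and B: "(\<lambda>n. partition (c n) (g n)) \<longlonglongrightarrow> B"
  shows "partition c' f \<le> B"
proof -
  note [measurable] = potential_borel[OF g] potential_borel[OF f]
  have nn: "(\<integral>\<^sup>+ w. ennreal (exp (potential c f w)) \<partial>lborel) = ennreal (partition c f)"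
    if "subgradients_in_ball R f" "c > 0" for c f
    unfolding partition_def using integrable_exp_potential[OF that] by (intro nn_integral_eq_integral) auto
  have "ennreal (partition c' f) = (\<integral>\<^sup>+ w. liminf (\<lambda>n. ennreal (exp (potential (c n) (g n) w))) \<partial>lborel)"
    unfolding nn[OF f pos(2), symmetric]
  proof (intro nn_integral_cong)
    fix w
    have "(\<lambda>n. ennreal (exp (potential (c n) (g n) w))) \<longlonglongrightarrow> ennreal (exp (potential c' f w))"
      unfolding potential_def using h_pos by (intro tendsto_intros lim) auto
    then show "ennreal (exp (potential c' f w)) = liminf (\<lambda>n. ennreal (exp (potential (c n) (g n) w)))"
      by (intro lim_imp_Liminf[symmetric]) auto
  qed
  also have "\<dots> \<le> liminf (\<lambda>n. \<integral>\<^sup>+ w. ennreal (exp (potential (c n) (g n) w)) \<partial>lborel)"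
    by (rule nn_integral_liminf) measurable
  also have "\<dots> = liminf (\<lambda>n. ennreal (partition (c n) (g n)))"
    by (simp add: nn[OF g pos(1)])
  also have "\<dots> = ennreal B"
    by (intro lim_imp_Liminf tendsto_ennrealI B) simp
  finally show ?thesis
    using LIMSEQ_le_const[OF B, of 0] partition_pos[OF g pos(1)]
    by (subst (asm) ennreal_le_iff) (auto intro: less_imp_le)
qed

text \<open>The support function of the ball, whose conjugate vanishes on the ball. It is the
  competitor of cost 0 showing that the infimum is taken over a nonempty set.\<close>

lemma subgradients_in_ball_cone: "subgradients_in_ball R (\<lambda>w::'a. R * norm w)"
  unfolding subgradients_in_ball_def subgradient_def
proof
  fix w :: 'a
  \<comment> \<open>At \<open>w = 0\<close> division by zero returns 0, and 0 is indeed a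
    subgradient there.\<close>
  define v where "v = (R / norm w) *\<^sub>R w"
  have v: "norm v \<le> R"
    using R_nonneg by (simp add: v_def)
  have "R * norm w + inner v (x - w) \<le> R * norm x" for x
  proof -
    have "inner v w = R * norm w"
      by (simp add: v_def power2_norm_eq_inner[symmetric] power2_eq_square)
    moreover have "inner v x \<le> R * norm x"
      using norm_cauchy_schwarz[of v x] mult_right_mono[OF v norm_ge_zero[of x]] by linarith
    ultimately show ?thesis
      by (simp add: inner_diff_right)
  qed
  with v show "\<exists>v. norm v \<le> R \<and> (\<forall>x. R * norm w + inner v (x - w) \<le> R * norm x)"
    by blast
qed

lemma cost_cone: "cost (\<lambda>w. R * norm w) = 0"
proof -
  have "AE v in \<mu>. excess (\<lambda>w. R * norm w) v = 0"
    using mu_ball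
  proof eventually_elim
    fix v :: 'a assume v: "norm v \<le> R"
    have "inner v w \<le> R * norm w" for w
      using norm_cauchy_schwarz[of v w] mult_right_mono[OF v norm_ge_zero[of w]] by linarith
    then show "excess (\<lambda>w. R * norm w) v = 0"
      by (simp add: excess_def ennreal_neg)
  qed
  then show ?thesis
    unfolding cost_def by (subst nn_integral_0_iff_AE) measurable
qed

lemma exists_minimizer:
  obtains c0 f0 where "c0 > 0" "subgradients_in_ball R f0" "cost f0 < \<infinity>"
    "\<And>c f. c > 0 \<Longrightarrow> subgradients_in_ball R f \<Longrightarrow> cost f < \<infinity> \<Longrightarrow> objective c0 f0 \<le> objective c f"
proof -
  define S where "S = {(c :: real, f). c > 0 \<and> subgradients_in_ball R f \<and> f 0 = 0 \<and> cost f < \<infinity>}"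
  define e where "e = h * real DIM('a) / 2"
  have e: "e > 0"
    using h_pos by (simp add: e_def)
  obtain G where G: "\<And>c f. c > 0 \<Longrightarrow> subgradients_in_ball R f \<Longrightarrow> f 0 = 0 \<Longrightarrow>
    G - real DIM('a) / 2 * ln c \<le> ln (partition c f)"
    using ln_partition_ge by blast
  \<comment> \<open>In the variable t = c / h the terms d c / 2 and - (h d / 2) ln c combine to e (t
    - ln t) - e ln h; the last term joins \<open>h * G\<close>.\<close>
  define L where "L = h * G - e * ln h"
  have coercive: "enn2real (cost f) + e * (c / h - ln (c / h)) + L \<le> objective c f"
    if "(c, f) \<in> S" for c f
  proof -
    have c: "c > 0" and f: "subgradients_in_ball R f" "f 0 = 0"
      using that by (auto simp: S_def)
    have "h * (G - real DIM('a) / 2 * ln c) \<le> h * ln (partition c f)"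
      using G[OF c f] h_pos by (intro mult_left_mono) auto
    then show ?thesis
      using h_pos c f(2) by (simp add: objective_def e_def L_def ln_div algebra_simps add_divide_distrib diff_divide_distrib)
  qed
  have t_ge: "1 \<le> c / h - ln (c / h)" if "c > 0" for c :: real
    using ln_le_minus_one[of "c / h"] that h_pos by simp
  have bounded: "e + L \<le> objective c f" if "(c, f) \<in> S" for c f
  proof -
    have "e * 1 \<le> e * (c / h - ln (c / h))"
      using t_ge[of c] that e by (intro mult_left_mono) (auto simp: S_def)
    then show ?thesis
      using coercive[OF that] enn2real_nonneg[of "cost f"] by linarith
  qed
  define Q where "Q = (\<lambda>(c, f). objective c f) ` S"
  define I where "I = Inf Q"
  have bdd: "bdd_below Q"
    unfolding Q_def by (rule bdd_belowI[of _ "e + L"]) (use bounded in auto)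
  have "(1, \<lambda>w. R * norm w) \<in> S"
    using subgradients_in_ball_cone by (simp add: S_def cost_cone)
  then have ne: "Q \<noteq> {}"
    unfolding Q_def by blast
  have I_le: "I \<le> objective c f" if "(c, f) \<in> S" for c f
    unfolding I_def Q_def using that bdd by (intro cInf_lower) (force simp: Q_def)+
  have "\<exists>x\<in>S. (case x of (c, f) \<Rightarrow> objective c f) < I + 1 / real (Suc n)" for n
  proof -
    have "Inf Q < I + 1 / real (Suc n)"
      by (simp add: I_def)
    then show ?thesis
      using cInf_lessD[OF ne] unfolding Q_def by blast
  qed
  then obtain x where x: "\<And>n. x n \<in> S" "\<And>n. (case x n of (c, f) \<Rightarrow> objective c f) < I + 1 / real (Suc n)"
    by metis
  define c where "c n = fst (x n)" for n
  define g where "g n = snd (x n)" for n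
  define A where "A n = enn2real (cost (g n))" for n
  define B where "B n = partition (c n) (g n)" for n
  have S: "(c n, g n) \<in> S" and near: "objective (c n) (g n) < I + 1 / real (Suc n)" for n
    using x(1)[of n] x(2)[of n] by (simp_all add: c_def g_def case_prod_beta)
  have c: "c n > 0" and g: "subgradients_in_ball R (g n)" "g n 0 = 0" and cost: "cost (g n) = ennreal (A n)"
    and A: "0 \<le> A n" for n
    using S[of n] by (auto simp: S_def A_def)
  have near1: "objective (c n) (g n) \<le> I + 1" for n
    using near[of n] by (smt (verit) divide_le_eq_1 of_nat_0_less_iff of_nat_Suc of_nat_0_le_iff zero_less_Suc)
  have obj: "objective (c n) (g n) = A n + real DIM('a) * c n / 2 + h * ln (B n)" for n
    by (simp add: objective_def A_def B_def g)
  define M where "M = (I + 1 - L) / e"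
  have c_bounds: "h * exp (- M) \<le> c n" "c n \<le> h * (2 * M)" and A_bound: "A n \<le> I + 1 - L" for n
  proof -
    have *: "A n + e * (c n / h - ln (c n / h)) + L \<le> I + 1"
      using coercive[OF S[of n]] near1[of n] by (simp add: A_def)
    then have "e * (c n / h - ln (c n / h)) \<le> I + 1 - L"
      using A[of n] by linarith
    then have "c n / h - ln (c n / h) \<le> M"
      using e by (simp add: M_def pos_le_divide_eq mult.commute)
    from diff_ln_le_imp_bounds[OF _ this] show "h * exp (- M) \<le> c n" "c n \<le> h * (2 * M)"
      using c[of n] h_pos by (simp_all add: pos_le_divide_eq pos_divide_le_eq mult.commute)
    have "0 \<le> e * (c n / h - ln (c n / h))"
      using e t_ge[OF c[of n]] by (intro mult_nonneg_nonneg) auto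
    with * show "A n \<le> I + 1 - L"
      by linarith
  qed
  have B: "0 < B n" for n
    unfolding B_def by (rule partition_pos[OF g(1) c])
  have B_bound: "B n \<le> exp ((I + 1) / h)" for n
  proof -
    have "0 \<le> real DIM('a) * c n / 2"
      using c[of n] by simp
    then have "h * ln (B n) \<le> I + 1"
      using near1[of n] A[of n] obj[of n] by linarith
    then have "ln (B n) \<le> (I + 1) / h"
      using h_pos by (simp add: pos_le_divide_eq mult.commute)
    then show ?thesis
      using B[of n] by (metis exp_le_cancel_iff exp_ln)
  qed
  obtain f r where r: "strict_mono r" and f: "subgradients_in_ball R f" and lim_f: "\<And>w. (\<lambda>n. g (r n) w) \<longlonglongrightarrow> f w"
    using subgradients_in_ball_seq_compact[of R g] g by metis
  \<comment> \<open>\<open>cost\<close> and \<open>partition\<close> need not converge to their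
    values at the limit function. Compactness makes the numbers themselves converge, and Fatou's
    lemma bounds the values at \<open>f\<close> by these limits.\<close>
  let ?K = "{h * exp (- M)..h * (2 * M)} \<times> {0..I + 1 - L} \<times> {0..exp ((I + 1) / h)}"
  have "compact ?K"
    by (intro compact_Times compact_Icc)
  moreover have "\<forall>n. (c (r n), A (r n), B (r n)) \<in> ?K"
    using c_bounds A_bound B_bound A B by (simp add: less_imp_le)
  ultimately obtain l s where l: "l \<in> ?K" and s: "strict_mono s"
    and lim_l: "((\<lambda>n. (c (r n), A (r n), B (r n))) \<circ> s) \<longlonglongrightarrow> l"
    unfolding compact_def by meson
  obtain c' A' B' where l_eq: "l = (c', A', B')"
    by (cases l)
  define q where "q n = r (s n)" for n
  have lims: "(\<lambda>n. c (q n)) \<longlonglongrightarrow> c'" "(\<lambda>n. A (q n)) \<longlonglongrightarrow> A'" "(\<lambda>n. B (q n)) \<longlonglongrightarrow> B'"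
    using tendsto_fst[OF lim_l] tendsto_fst[OF tendsto_snd[OF lim_l]] tendsto_snd[OF tendsto_snd[OF lim_l]]
    by (simp_all add: l_eq o_def q_def)
  have lim_q: "(\<lambda>n. g (q n) w) \<longlonglongrightarrow> f w" for w
    using LIMSEQ_subseq_LIMSEQ[OF lim_f s] by (simp add: o_def q_def)
  have q: "strict_mono q"
    using strict_mono_o[OF r s] by (simp add: o_def q_def[abs_def])
  have "h * exp (- M) \<le> c'"
    using l by (simp add: l_eq)
  then have c': "c' > 0"
    using h_pos by (smt (verit) exp_gt_zero mult_pos_pos)
  have f0: "f 0 = 0"
    using lim_q[of 0] g(2) by (simp add: LIMSEQ_const_iff)
  have cost_f: "cost f \<le> ennreal A'"
    by (rule cost_le_limit[OF lim_q]) (simp add: cost tendsto_ennrealI lims)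
  have part_f: "partition c' f \<le> B'"
    using lims(3) unfolding B_def by (rule partition_le_limit[OF g(1) f c c' lim_q lims(1)])
  have B': "B' > 0"
    using partition_pos[OF f c'] part_f by linarith
  have "(\<lambda>n. objective (c (q n)) (g (q n))) \<longlonglongrightarrow> A' + real DIM('a) * c' / 2 + h * ln B'"
    unfolding obj using B' by (intro tendsto_intros lims) auto
  moreover have "(\<lambda>n. objective (c (q n)) (g (q n))) \<longlonglongrightarrow> I"
  proof (rule LIMSEQ_subseq_LIMSEQ[OF _ q, unfolded o_def])
    have "(\<lambda>n. I + 1 / real (Suc n)) \<longlonglongrightarrow> I + 0"
      using LIMSEQ_inverse_real_of_nat by (intro tendsto_intros) (simp add: inverse_eq_divide)
    then have upper: "(\<lambda>n. I + 1 / real (Suc n)) \<longlonglongrightarrow> I"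
      by simp
    show "(\<lambda>n. objective (c n) (g n)) \<longlonglongrightarrow> I"
    proof (rule real_tendsto_sandwich[OF _ _ tendsto_const upper])
      show "\<forall>\<^sub>F n in sequentially. I \<le> objective (c n) (g n)"
        using I_le[OF S] by simp
      show "\<forall>\<^sub>F n in sequentially. objective (c n) (g n) \<le> I + 1 / real (Suc n)"
        using less_imp_le[OF near] by simp
    qed
  qed
  ultimately have I_eq: "I = A' + real DIM('a) * c' / 2 + h * ln B'"
    using LIMSEQ_unique by blast
  have "0 \<le> A'"
    using l by (simp add: l_eq)
  then have "enn2real (cost f) \<le> A'"
    using enn2real_mono[OF cost_f] by simp
  moreover have "h * ln (partition c' f) \<le> h * ln B'"
    using part_f partition_pos[OF f c'] h_pos by (intro mult_left_mono ln_mono) auto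
  ultimately have obj_f: "objective c' f \<le> I"
    by (simp add: objective_def f0 I_eq)
  have fin: "cost f < \<infinity>"
    using cost_f by (simp add: le_less_trans[OF _ ennreal_less_top])
  have "objective c' f \<le> objective c2 f2"
    if c2: "c2 > 0" and f2: "subgradients_in_ball R f2" and cost2: "cost f2 < \<infinity>" for c2 f2
  proof -
    \<comment> \<open>Shifting an arbitrary competitor to vanish at 0 leaves its objective
      unchanged.\<close>
    have "(c2, \<lambda>w. f2 w + - f2 0) \<in> S"
      using c2 f2 cost2 subgradients_in_ball_add_const[of R f2 "- f2 0"] cost_add_const[of f2 "- f2 0"]
      by (simp add: S_def)
    from I_le[OF this] show ?thesis
      using obj_f objective_add_const[OF f2 c2, of "- f2 0"] by simp
  qed
  with c' f fin show thesis
    by (rule that)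
qed

end

section \<open>Euler--Lagrange equations\<close>

text \<open>Returns from the logarithm to the integral itself: ln Z \<le> Z - 1 with equality at Z =
  1. The minimizer normalized to Z = 1 thus also minimizes the functional in which the integral
  enters linearly, and this form is the one varied below.\<close>

lemma (in entropic_dual) exists_normalized_minimizer:
  obtains c0 f0 where "c0 > 0" "subgradients_in_ball R f0" "cost f0 < \<infinity>" "partition c0 f0 = 1"
    "\<And>c f. c > 0 \<Longrightarrow> subgradients_in_ball R f \<Longrightarrow> cost f < \<infinity> \<Longrightarrow>
      enn2real (cost f0) - f0 0 + real DIM('a) * c0 / 2
        \<le> enn2real (cost f) - f 0 + real DIM('a) * c / 2 + h * (partition c f - 1)"
proof -
  obtain c0 f1 where c0: "c0 > 0" and f1: "subgradients_in_ball R f1" "cost f1 < \<infinity>"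
    and opt: "\<And>c f. c > 0 \<Longrightarrow> subgradients_in_ball R f \<Longrightarrow> cost f < \<infinity> \<Longrightarrow> objective c0 f1 \<le> objective c f"
    using exists_minimizer by blast
  define k where "k = - (h * ln (partition c0 f1))"
  define f0 where "f0 = (\<lambda>w. f1 w + k)"
  have Z: "partition c0 f0 = 1"
    unfolding f0_def partition_add_const k_def using partition_pos[OF f1(1) c0] h_pos by (simp add: exp_minus)
  have f0: "subgradients_in_ball R f0" "cost f0 < \<infinity>"
    using f1 by (simp_all add: f0_def subgradients_in_ball_add_const cost_add_const)
  have "enn2real (cost f0) - f0 0 + real DIM('a) * c0 / 2
        \<le> enn2real (cost f) - f 0 + real DIM('a) * c / 2 + h * (partition c f - 1)"
    if c: "c > 0" and f: "subgradients_in_ball R f" "cost f < \<infinity>" for c f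
  proof -
    have "enn2real (cost f0) - f0 0 + real DIM('a) * c0 / 2 = objective c0 f0"
      by (simp add: objective_def Z)
    also have "\<dots> = objective c0 f1"
      unfolding f0_def by (rule objective_add_const[OF f1(1) c0])
    also have "\<dots> \<le> objective c f"
      by (rule opt[OF c f])
    also have "h * ln (partition c f) \<le> h * (partition c f - 1)"
      using h_pos ln_le_minus_one[OF partition_pos[OF f(1) c]] by (intro mult_left_mono) auto
    then have "objective c f \<le> enn2real (cost f) - f 0 + real DIM('a) * c / 2 + h * (partition c f - 1)"
      by (simp add: objective_def)
    finally show ?thesis .
  qed
  with c0 f0 Z show thesis
    by (rule that)
qed

text \<open>\<open>T\<close> is a fixed Borel version of \<open>grad f0\<close>, bounded everywhere.
  Integrals are computed with it, and the gradient itself replaces it only in the final push-forward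
  statement.\<close>

locale entropic_dual_optimizer = entropic_dual \<mu> h R
  for \<mu> :: "'a::euclidean_space measure" and h R :: real +
  fixes c0 :: real and f0 :: "'a \<Rightarrow> real" and T :: "'a \<Rightarrow> 'a"
  assumes c0: "c0 > 0" and f0: "subgradients_in_ball R f0" and cost_f0: "cost f0 < \<infinity>"
    and partition_f0: "partition c0 f0 = 1"
    and optimal: "\<And>c f. c > 0 \<Longrightarrow> subgradients_in_ball R f \<Longrightarrow> cost f < \<infinity> \<Longrightarrow>
      enn2real (cost f0) - f0 0 + real DIM('a) * c0 / 2
        \<le> enn2real (cost f) - f 0 + real DIM('a) * c / 2 + h * (partition c f - 1)"
    and T_borel [measurable]: "T \<in> borel_measurable borel" and norm_T: "\<And>w. norm (T w) \<le> R"
    and T_grad: "AE w in lborel. f0 differentiable (at w) \<and> T w = grad f0 w"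
begin

definition F1 :: "'a \<Rightarrow> real" where
  "F1 w = exp (potential c0 f0 w)"

lemma F1_pos: "F1 w > 0"
  by (simp add: F1_def)

lemma F1_borel [measurable]: "F1 \<in> borel_measurable borel"
proof -
  note [measurable] = potential_borel[OF f0]
  show ?thesis
    unfolding F1_def by measurable
qed

lemma f0_borel [measurable]: "f0 \<in> borel_measurable borel"
  by (rule subgradients_in_ball_borel[OF f0])

lemma F1_integrable: "integrable lborel F1" and F1_integral: "(\<integral>w. F1 w \<partial>lborel) = 1"
  using integrable_exp_potential[OF f0 c0] partition_f0
  by (simp_all add: F1_def[abs_def] partition_def)

lemma integral_F1_exp:
  assumes C: "C > 0"
    and [measurable]: "k \<in> borel_measurable borel" "\<And>n. kn n \<in> borel_measurable borel"
    and \<epsilon>: "\<And>n. \<epsilon> n > 0" "\<epsilon> \<longlonglongrightarrow> 0"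
    and bound: "\<And>n x. \<bar>kn n x\<bar> \<le> \<epsilon> n * (C * (1 + (norm x)\<^sup>2))"
    and lim: "AE x in lborel. (\<lambda>n. kn n x / \<epsilon> n) \<longlonglongrightarrow> k x"
  shows "(\<lambda>n. ((\<integral>x. F1 x * exp (kn n x) \<partial>lborel) - 1) / \<epsilon> n) \<longlonglongrightarrow> (\<integral>x. F1 x * k x \<partial>lborel)"
proof -
  \<comment> \<open>\<delta> C is half of c0 / (2 h), the threshold below which the Gaussian weight
    is integrable.\<close>
  define \<delta> where "\<delta> = c0 / (4 * h * C)"
  have "\<delta> * C < c0 / (2 * h)"
    using C c0 h_pos by (simp add: \<delta>_def field_simps)
  from integrable_exp_potential_weighted[OF f0 this]
  have "integrable lborel (\<lambda>x. F1 x * exp (\<delta> * (C * (1 + (norm x)\<^sup>2))))"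
    by (simp add: F1_def mult.assoc)
  from integral_exp_perturbation(2)[OF _ _ _ _ _ _ this \<epsilon> bound lim] show ?thesis
    using C c0 h_pos F1_pos by (simp add: \<delta>_def less_imp_le F1_integral)
qed

text \<open>Quadratic growth is absorbed by the weight exp (s (1 + |x|^2)), for which
  \<open>F1\<close> leaves room, because s t \<le> exp (s t).\<close>

lemma integrable_F1_mult:
  assumes [measurable]: "u \<in> borel_measurable borel" and u: "\<And>x. \<bar>u x\<bar> \<le> C * (1 + (norm x)\<^sup>2)"
  shows "integrable lborel (\<lambda>x. F1 x * u x)"
proof -
  define s where "s = c0 / (4 * h)"
  have s: "s > 0" "s < c0 / (2 * h)"
    using c0 h_pos by (simp_all add: s_def field_simps)
  have C: "C \<ge> 0"
    using u[of 0] abs_ge_zero[of "u 0"] by simp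
  show ?thesis
  proof (rule Bochner_Integration.integrable_bound)
    show "integrable lborel (\<lambda>x. C / s * (F1 x * exp (s * (1 + (norm x)\<^sup>2))))"
      using integrable_exp_potential_weighted[OF f0 s(2)] by (simp add: F1_def)
    have "norm (F1 x * u x) \<le> norm (C / s * (F1 x * exp (s * (1 + (norm x)\<^sup>2))))" for x
    proof -
      have "s * (1 + (norm x)\<^sup>2) \<le> exp (s * (1 + (norm x)\<^sup>2))"
        using exp_ge_add_one_self[of "s * (1 + (norm x)\<^sup>2)"] by linarith
      then have "C / s * (s * (1 + (norm x)\<^sup>2)) \<le> C / s * exp (s * (1 + (norm x)\<^sup>2))"
        using C s by (intro mult_left_mono) auto
      then have "\<bar>u x\<bar> \<le> C / s * exp (s * (1 + (norm x)\<^sup>2))"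
        using u[of x] s by simp
      then have "F1 x * \<bar>u x\<bar> \<le> F1 x * (C / s * exp (s * (1 + (norm x)\<^sup>2)))"
        using F1_pos[of x] by (intro mult_left_mono) auto
      then show ?thesis
        using F1_pos[of x] C s by (simp add: abs_mult mult_ac)
    qed
    then show "AE x in lborel. norm (F1 x * u x) \<le> norm (C / s * (F1 x * exp (s * (1 + (norm x)\<^sup>2))))"
      by simp
  qed measurable
qed

lemma integrable_F1_norm_sq: "integrable lborel (\<lambda>x. F1 x * (norm x)\<^sup>2)"
  by (rule integrable_F1_mult[where C=1]) auto

lemma integrable_F1_inner: "integrable lborel (\<lambda>x. F1 x * inner x e)"
proof (rule integrable_F1_mult[where C="norm e"])
  fix x
  have "\<bar>inner x e\<bar> \<le> norm e * norm x"
    using Cauchy_Schwarz_ineq2[of x e] by (simp add: mult.commute)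
  also have "\<dots> \<le> norm e * (1 + (norm x)\<^sup>2)"
    by (intro mult_left_mono norm_le_one_plus_norm_sq) auto
  finally show "\<bar>inner x e\<bar> \<le> norm e * (1 + (norm x)\<^sup>2)" .
qed measurable

lemma integrable_F1_inner_T: "integrable lborel (\<lambda>x. F1 x * inner (T x) e)"
proof (rule integrable_F1_mult[where C="R * norm e"])
  fix x
  have "\<bar>inner (T x) e\<bar> \<le> norm (T x) * norm e"
    by (rule Cauchy_Schwarz_ineq2)
  also have "\<dots> \<le> R * norm e"
    by (intro mult_right_mono norm_T) auto
  also have "\<dots> \<le> R * norm e * (1 + (norm x)\<^sup>2)"
    using R_nonneg by (simp add: distrib_left)
  finally show "\<bar>inner (T x) e\<bar> \<le> R * norm e * (1 + (norm x)\<^sup>2)" .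
qed measurable

lemma integrable_F1_inner_T_self: "integrable lborel (\<lambda>x. F1 x * inner (T x) x)"
proof (rule integrable_F1_mult[where C=R])
  fix x
  have "\<bar>inner (T x) x\<bar> \<le> norm (T x) * norm x"
    by (rule Cauchy_Schwarz_ineq2)
  also have "\<dots> \<le> R * (1 + (norm x)\<^sup>2)"
    using R_nonneg by (intro mult_mono norm_T norm_le_one_plus_norm_sq) auto
  finally show "\<bar>inner (T x) x\<bar> \<le> R * (1 + (norm x)\<^sup>2)" .
qed measurable

section \<open>Variations by translation, dilation and temperature\<close>

definition step :: "nat \<Rightarrow> real" where
  "step n = 1 / real (Suc n)"

lemma step: "step n > 0" "step n \<le> 1" "step \<longlonglongrightarrow> 0"
  using LIMSEQ_inverse_real_of_nat by (simp_all add: step_def[abs_def] inverse_eq_divide)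

text \<open>Since the potential is ln \<open>F1\<close>, this is the gradient formula of the theorem
  up to identifying \<open>c0\<close> with an expression in the Wasserstein distance.\<close>

lemma has_derivative_potential:
  assumes "f0 differentiable (at w)"
  shows "(potential c0 f0 has_derivative (\<lambda>y. inner (grad f0 w - c0 *\<^sub>R w) y / h)) (at w)"
proof -
  have "(f0 has_derivative inner (grad f0 w)) (at w)"
    by (rule subgradient_grad(3)[OF f0 assms])
  moreover have "((\<lambda>w::'a. (norm w)\<^sup>2) has_derivative (\<lambda>y. 2 * inner w y)) (at w)"
    unfolding power2_norm_eq_inner by (auto intro!: derivative_eq_intros simp: inner_commute)
  ultimately show ?thesis
    unfolding potential_def using h_pos
    by (auto intro!: derivative_eq_intros simp: inner_diff_left inner_simps fun_eq_iff)
qed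

lemma potential_difference_quotient:
  assumes "f0 differentiable (at w)" "T w = grad f0 w"
  shows "(\<lambda>n. (potential c0 f0 (w + step n *\<^sub>R e) - potential c0 f0 w) / step n)
    \<longlonglongrightarrow> inner (T w - c0 *\<^sub>R w) e / h"
proof -
  let ?D = "\<lambda>y. inner (T w - c0 *\<^sub>R w) y / h"
  have "((\<lambda>t. w + t *\<^sub>R e) has_derivative (\<lambda>t. t *\<^sub>R e)) (at (0::real))"
    by (auto intro!: derivative_eq_intros)
  then have "((\<lambda>t. potential c0 f0 (w + t *\<^sub>R e)) has_derivative (\<lambda>t. ?D (t *\<^sub>R e))) (at 0)"
    using has_derivative_compose[of _ _ 0 UNIV "potential c0 f0" ?D] has_derivative_potential[OF assms(1)]
      assms(2)
    by fastforce
  moreover have "(\<lambda>t. ?D (t *\<^sub>R e)) = (*) (?D e)"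
    by (simp add: fun_eq_iff)
  ultimately have "((\<lambda>t. potential c0 f0 (w + t *\<^sub>R e)) has_field_derivative ?D e) (at 0)"
    by (simp only: has_field_derivative_def)
  then have "((\<lambda>t. (potential c0 f0 (w + t *\<^sub>R e) - potential c0 f0 w) / t) \<longlongrightarrow> ?D e) (at 0)"
    by (simp add: DERIV_def)
  moreover have "filterlim step (at 0) sequentially"
    unfolding filterlim_at using step by (auto simp: less_imp_neq[symmetric])
  ultimately show ?thesis
    by (rule filterlim_compose)
qed

text \<open>The growth condition on \<open>y\<close> covers translations and dilations at once. The
  factor 3 collects 2 inner w y + |y|^2, and (1 + |w|)^2 \<le> 2 (1 + |w|^2) gives the final 2; the
  constants are not sharp.\<close>

lemma potential_diff_le:
  assumes "norm y \<le> r * (1 + norm w)" "0 \<le> r" "r \<le> 1"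
  shows "\<bar>potential c0 f0 (w + y) - potential c0 f0 w\<bar> \<le> r * ((2 * R + 6 * c0) / h * (1 + (norm w)\<^sup>2))"
proof -
  define m where "m = 1 + norm w"
  have m: "1 \<le> m" "norm w \<le> m" "norm y \<le> r * m" "m\<^sup>2 \<le> 2 * (1 + (norm w)\<^sup>2)"
    using assms(1) zero_le_power2[of "norm w - 1"] by (simp_all add: m_def power2_eq_square algebra_simps)
  have rm: "norm y \<le> m"
    using m assms by (meson mult_left_le_one_le norm_ge_zero order_trans)
  have "\<bar>f0 (w + y) - f0 w\<bar> \<le> R * norm y"
    using subgradients_in_ball_lipschitz[OF f0, of "w + y" w] by simp
  also have "\<dots> \<le> R * (r * m\<^sup>2)"
    using R_nonneg m assms(2) by (intro mult_left_mono order_trans[OF m(3)]) (auto simp: power2_eq_square mult_le_cancel_left1)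
  finally have 1: "\<bar>f0 (w + y) - f0 w\<bar> \<le> R * (r * m\<^sup>2)" .
  have m_sq: "m * (r * m) = r * m\<^sup>2" "0 \<le> r * m\<^sup>2"
    using assms(2) by (simp_all add: power2_eq_square)
  have "(norm (w + y))\<^sup>2 - (norm w)\<^sup>2 = 2 * inner w y + (norm y)\<^sup>2"
    by (simp add: power2_norm_eq_inner inner_simps inner_commute)
  moreover have "\<bar>inner w y\<bar> \<le> m * (r * m)"
    using Cauchy_Schwarz_ineq2[of w y] m(1,2,3) mult_mono[OF m(2,3)] by fastforce
  moreover have "(norm y)\<^sup>2 \<le> m * (r * m)"
    unfolding power2_eq_square using rm m by (intro mult_mono) auto
  ultimately have 2: "\<bar>(norm (w + y))\<^sup>2 - (norm w)\<^sup>2\<bar> \<le> 3 * (r * m\<^sup>2)"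
    using m_sq zero_le_power2[of "norm y"] by linarith
  have "\<bar>potential c0 f0 (w + y) - potential c0 f0 w\<bar> * h
      = \<bar>(f0 (w + y) - f0 w) - c0 / 2 * ((norm (w + y))\<^sup>2 - (norm w)\<^sup>2)\<bar>"
  proof -
    have "(potential c0 f0 (w + y) - potential c0 f0 w) * h
      = (f0 (w + y) - f0 w) - c0 / 2 * ((norm (w + y))\<^sup>2 - (norm w)\<^sup>2)"
      using h_pos by (simp add: potential_def field_simps)
    from arg_cong[OF this, of abs] show ?thesis
      unfolding abs_mult[of _ h] using h_pos by simp
  qed
  also have "\<dots> \<le> R * (r * m\<^sup>2) + c0 / 2 * (3 * (r * m\<^sup>2))"
  proof (rule order_trans[OF abs_triangle_ineq4 add_mono[OF 1]])
    show "\<bar>c0 / 2 * ((norm (w + y))\<^sup>2 - (norm w)\<^sup>2)\<bar> \<le> c0 / 2 * (3 * (r * m\<^sup>2))"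
      unfolding abs_mult using 2 c0 by (intro mult_mono) auto
  qed
  also have "\<dots> = r * (R + 3 * c0 / 2) * m\<^sup>2"
    by (simp add: algebra_simps)
  also have "\<dots> \<le> r * (R + 3 * c0) * (2 * (1 + (norm w)\<^sup>2))"
    using R_nonneg c0 assms(2) m(4) by (intro mult_mono) auto
  finally have "\<bar>potential c0 f0 (w + y) - potential c0 f0 w\<bar> \<le> r * (R + 3 * c0) * (2 * (1 + (norm w)\<^sup>2)) / h"
    using h_pos by (simp add: pos_le_divide_eq)
  also have "\<dots> = r * ((2 * R + 6 * c0) / h * (1 + (norm w)\<^sup>2))"
    by (simp add: field_simps)
  finally show ?thesis .
qed

lemma potential_bound_pos: "(2 * R + 6 * c0) / h > 0"
  using R_nonneg c0 h_pos by simp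

text \<open>Differentiate \<open>\<integral> F1 (w + t e) dw = 1\<close> at \<open>t = 0\<close>.\<close>

lemma integral_F1_inner_T: "(\<integral>w. F1 w * inner (T w) e \<partial>lborel) = c0 * (\<integral>w. F1 w * inner w e \<partial>lborel)"
proof -
  note [measurable] = potential_borel[OF f0]
  have *: "(\<integral>w. F1 w * inner (T w) e \<partial>lborel) = c0 * (\<integral>w. F1 w * inner w e \<partial>lborel)"
    if e: "norm e \<le> 1" for e
  proof -
    let ?kn = "\<lambda>n w. potential c0 f0 (w + step n *\<^sub>R e) - potential c0 f0 w"
    let ?k = "\<lambda>w. inner (T w - c0 *\<^sub>R w) e / h"
    have bd: "\<bar>?kn n w\<bar> \<le> step n * ((2 * R + 6 * c0) / h * (1 + (norm w)\<^sup>2))" for n w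
    proof (rule potential_diff_le)
      have "norm (step n *\<^sub>R e) = step n * norm e"
        using step(1)[of n] by simp
      also have "\<dots> \<le> step n * (1 + norm w)"
        using e step(1)[of n] by (intro mult_left_mono) (auto intro: add_increasing2)
      finally show "norm (step n *\<^sub>R e) \<le> step n * (1 + norm w)" .
    qed (use step in \<open>auto simp: less_imp_le\<close>)
    have "AE w in lborel. (\<lambda>n. ?kn n w / step n) \<longlonglongrightarrow> ?k w"
      using T_grad by eventually_elim (rule potential_difference_quotient, auto)
    then have "(\<lambda>n. ((\<integral>w. F1 w * exp (?kn n w) \<partial>lborel) - 1) / step n) \<longlonglongrightarrow> (\<integral>w. F1 w * ?k w \<partial>lborel)"
      using bd by (intro integral_F1_exp[OF potential_bound_pos]) (use step in \<open>auto simp: less_imp_le\<close>)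
    moreover have "(\<integral>w. F1 w * exp (?kn n w) \<partial>lborel) = 1" for n
    proof -
      have "(\<integral>w. F1 w * exp (?kn n w) \<partial>lborel) = (\<integral>w. F1 (step n *\<^sub>R e + 1 *\<^sub>R w) \<partial>lborel)"
        by (simp add: F1_def add.commute flip: exp_add)
      also have "\<dots> = 1"
        by (subst integrable_lborel_affine(2)[OF _ F1_integrable]) (auto simp: F1_integral)
      finally show ?thesis .
    qed
    ultimately have "(\<integral>w. F1 w * ?k w \<partial>lborel) = 0"
      by (simp add: LIMSEQ_const_iff)
    moreover have "(\<integral>w. F1 w * ?k w \<partial>lborel)
        = ((\<integral>w. F1 w * inner (T w) e \<partial>lborel) - c0 * (\<integral>w. F1 w * inner w e \<partial>lborel)) / h"
    proof -
      have "(\<integral>w. F1 w * ?k w \<partial>lborel)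
          = (\<integral>w. (F1 w * inner (T w) e - c0 * (F1 w * inner w e)) / h \<partial>lborel)"
        by (intro Bochner_Integration.integral_cong) (auto simp: inner_diff_left algebra_simps)
      then show ?thesis
        using integrable_F1_inner[of e] integrable_F1_inner_T[of e] by simp
    qed
    ultimately show ?thesis
      using h_pos by simp
  qed
  show ?thesis
  \<comment> \<open>Both sides are linear in \<open>e\<close>, so unit vectors suffice; the bound on
    \<open>norm e\<close> only served the domination estimate.\<close>
  proof (cases "e = 0")
    case False
    then show ?thesis
      using *[of "e /\<^sub>R norm e"] by (simp add: mult.left_commute[of _ "inverse (norm e)"])
  qed simp
qed

text \<open>Differentiate \<open>\<integral> F1 ((1 + t) w) dw = (1 + t)^(- d)\<close> at \<open>t = 0\<close>.\<close>

lemma integral_F1_inner_T_self: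
  "(\<integral>w. F1 w * inner (T w) w \<partial>lborel) = c0 * (\<integral>w. F1 w * (norm w)\<^sup>2 \<partial>lborel) - h * real DIM('a)"
proof -
  note [measurable] = potential_borel[OF f0]
  let ?kn = "\<lambda>n w. potential c0 f0 (w + step n *\<^sub>R w) - potential c0 f0 w"
  let ?k = "\<lambda>w. inner (T w - c0 *\<^sub>R w) w / h"
  have bd: "\<bar>?kn n w\<bar> \<le> step n * ((2 * R + 6 * c0) / h * (1 + (norm w)\<^sup>2))" for n w
  proof (rule potential_diff_le)
    have "norm (step n *\<^sub>R w) = step n * norm w"
      using step(1)[of n] by simp
    also have "\<dots> \<le> step n * (1 + norm w)"
      using step(1)[of n] by (intro mult_left_mono) auto
    finally show "norm (step n *\<^sub>R w) \<le> step n * (1 + norm w)" .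
  qed (use step in \<open>auto simp: less_imp_le\<close>)
  have "AE w in lborel. (\<lambda>n. ?kn n w / step n) \<longlonglongrightarrow> ?k w"
    using T_grad by eventually_elim (rule potential_difference_quotient, auto)
  then have "(\<lambda>n. ((\<integral>w. F1 w * exp (?kn n w) \<partial>lborel) - 1) / step n) \<longlonglongrightarrow> (\<integral>w. F1 w * ?k w \<partial>lborel)"
    using bd by (intro integral_F1_exp[OF potential_bound_pos]) (use step in \<open>auto simp: less_imp_le\<close>)
  moreover have "(\<integral>w. F1 w * exp (?kn n w) \<partial>lborel) = 1 / (1 + step n) ^ DIM('a)" for n
  proof -
    have "(\<integral>w. F1 w * exp (?kn n w) \<partial>lborel) = (\<integral>w. F1 (0 + (1 + step n) *\<^sub>R w) \<partial>lborel)"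
      by (simp add: F1_def scaleR_add_left flip: exp_add)
    also have "\<dots> = 1 / \<bar>1 + step n\<bar> ^ DIM('a)"
      using step(1)[of n]
      by (subst integrable_lborel_affine(2)[OF _ F1_integrable]) (auto simp: F1_integral)
    finally show ?thesis
      using step(1)[of n] by simp
  qed
  ultimately have lim: "(\<lambda>n. (1 / (1 + step n) ^ DIM('a) - 1) / step n) \<longlonglongrightarrow> (\<integral>w. F1 w * ?k w \<partial>lborel)"
    by simp
  have "((\<lambda>t::real. 1 / (1 + t) ^ DIM('a)) has_real_derivative - real DIM('a)) (at 0)"
    by (auto intro!: derivative_eq_intros)
  then have "((\<lambda>t::real. (1 / (1 + t) ^ DIM('a) - 1) / t) \<longlongrightarrow> - real DIM('a)) (at 0)"
    by (simp add: DERIV_def)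
  moreover have "filterlim step (at 0) sequentially"
    unfolding filterlim_at using step by (auto simp: less_imp_neq[symmetric])
  ultimately have "(\<lambda>n. (1 / (1 + step n) ^ DIM('a) - 1) / step n) \<longlonglongrightarrow> - real DIM('a)"
    by (rule filterlim_compose)
  with lim have "(\<integral>w. F1 w * ?k w \<partial>lborel) = - real DIM('a)"
    by (rule LIMSEQ_unique)
  moreover have "(\<integral>w. F1 w * ?k w \<partial>lborel)
      = ((\<integral>w. F1 w * inner (T w) w \<partial>lborel) - c0 * (\<integral>w. F1 w * (norm w)\<^sup>2 \<partial>lborel)) / h"
  proof -
    have "(\<integral>w. F1 w * ?k w \<partial>lborel)
        = (\<integral>w. (F1 w * inner (T w) w - c0 * (F1 w * (norm w)\<^sup>2)) / h \<partial>lborel)"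
      by (intro Bochner_Integration.integral_cong) (auto simp: inner_diff_left power2_norm_eq_inner algebra_simps)
    then show ?thesis
      using integrable_F1_norm_sq integrable_F1_inner_T_self by simp
  qed
  ultimately show ?thesis
    using h_pos by (simp add: field_simps)
qed

text \<open>Stationarity of the dual functional in \<open>c\<close>.\<close>

lemma integral_F1_norm_sq: "(\<integral>w. F1 w * (norm w)\<^sup>2 \<partial>lborel) = real DIM('a)"
proof -
  \<comment> \<open>Steps are positive, so the two signs of \<sigma> supply the two one-sided
    derivatives in \<open>c\<close>. For small steps c0 + \<sigma> \<open>step n\<close> stays
    positive and is an admissible competitor.\<close>
  have one_sided: "0 \<le> \<sigma> * (real DIM('a) - (\<integral>w. F1 w * (norm w)\<^sup>2 \<partial>lborel))" if \<sigma>: "\<bar>\<sigma>\<bar> = 1" for \<sigma> :: real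
  proof -
    let ?kn = "\<lambda>n w::'a. - \<sigma> * step n * (norm w)\<^sup>2 / (2 * h)"
    let ?k = "\<lambda>w::'a. - \<sigma> * (norm w)\<^sup>2 / (2 * h)"
    have "\<bar>?kn n w\<bar> \<le> step n * (1 / (2 * h) * (1 + (norm w)\<^sup>2))" for n w
    proof -
      have "\<bar>?kn n w\<bar> = step n * (1 / (2 * h) * (norm w)\<^sup>2)"
        using \<sigma> h_pos step(1)[of n] by (simp add: abs_mult)
      also have "\<dots> \<le> step n * (1 / (2 * h) * (1 + (norm w)\<^sup>2))"
        using h_pos step(1)[of n] by (intro mult_left_mono) auto
      finally show ?thesis .
    qed
    moreover have "(\<lambda>n. ?kn n w / step n) \<longlonglongrightarrow> ?k w" for w
    proof -
      have "?kn n w / step n = ?k w" for n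
        using step(1)[of n] by simp
      then show ?thesis
        by (simp only: tendsto_const)
    qed
    ultimately have lim: "(\<lambda>n. ((\<integral>w. F1 w * exp (?kn n w) \<partial>lborel) - 1) / step n) \<longlonglongrightarrow> (\<integral>w. F1 w * ?k w \<partial>lborel)"
      using h_pos by (intro integral_F1_exp[where C="1 / (2 * h)"] AE_I2) (use step in \<open>auto simp: less_imp_le\<close>)
    have F1_shift: "(\<integral>w. F1 w * exp (?kn n w) \<partial>lborel) = partition (c0 + \<sigma> * step n) f0" for n
      unfolding partition_def F1_def exp_add[symmetric] using h_pos
      by (intro Bochner_Integration.integral_cong refl arg_cong[where f=exp])
        (simp add: potential_def field_simps)
    have "eventually (\<lambda>n. step n < c0) sequentially"
      using order_tendstoD(2)[OF step(3)] c0 by simp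
    then have "eventually (\<lambda>n. 0 \<le> \<sigma> * real DIM('a) / 2
        + h * (((\<integral>w. F1 w * exp (?kn n w) \<partial>lborel) - 1) / step n)) sequentially"
    proof eventually_elim
      case (elim n)
      have "- (step n) \<le> \<sigma> * step n"
        using \<sigma> step(1)[of n] by (auto simp: abs_if split: if_splits)
      then have "c0 + \<sigma> * step n > 0"
        using elim by linarith
      from optimal[OF this f0 cost_f0]
      have "0 \<le> real DIM('a) * (\<sigma> * step n) / 2 + h * ((\<integral>w. F1 w * exp (?kn n w) \<partial>lborel) - 1)"
        unfolding F1_shift by (simp add: distrib_left add_divide_distrib)
      then have "0 \<le> (real DIM('a) * (\<sigma> * step n) / 2 + h * ((\<integral>w. F1 w * exp (?kn n w) \<partial>lborel) - 1)) / step n"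
        using step(1)[of n] by (intro divide_nonneg_pos)
      also have "\<dots> = \<sigma> * real DIM('a) / 2 + h * (((\<integral>w. F1 w * exp (?kn n w) \<partial>lborel) - 1) / step n)"
        using step(1)[of n] by (simp add: add_divide_distrib)
      finally show ?case .
    qed
    moreover have "(\<lambda>n. \<sigma> * real DIM('a) / 2 + h * (((\<integral>w. F1 w * exp (?kn n w) \<partial>lborel) - 1) / step n))
        \<longlonglongrightarrow> \<sigma> * real DIM('a) / 2 + h * (\<integral>w. F1 w * ?k w \<partial>lborel)"
      by (intro tendsto_intros lim)
    ultimately have "0 \<le> \<sigma> * real DIM('a) / 2 + h * (\<integral>w. F1 w * ?k w \<partial>lborel)"
      by (intro tendsto_lowerbound) auto
    also have "(\<integral>w. F1 w * ?k w \<partial>lborel) = (\<integral>w. (- \<sigma> / (2 * h)) * (F1 w * (norm w)\<^sup>2) \<partial>lborel)"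
      by (intro Bochner_Integration.integral_cong) auto
    also have "\<dots> = (- \<sigma> / (2 * h)) * (\<integral>w. F1 w * (norm w)\<^sup>2 \<partial>lborel)"
      by simp
    finally show ?thesis
      using h_pos by (simp add: field_simps)
  qed
  show ?thesis
    using one_sided[of 1] one_sided[of "- 1"] by simp
qed

section \<open>The conjugate of the optimal potential and its perturbation by test functions\<close>

definition phi :: "'a \<Rightarrow> real" where
  "phi v = enn2real (excess f0 v) - f0 0"

lemma phi_borel [measurable]: "phi \<in> borel_measurable borel"
  unfolding phi_def by measurable

text \<open>Young's inequality. Where \<open>excess\<close> is infinite, \<open>enn2real\<close>
  returns 0 and \<open>phi\<close> has the meaningless value - f0 0, hence the finiteness condition
  here.\<close>

lemma phi_ge:
  assumes "excess f0 v < \<infinity>"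
  shows "inner v w - f0 w \<le> phi v"
proof -
  have "ennreal (inner v w - f0 w + f0 0) \<le> ennreal (enn2real (excess f0 v))"
    using excess_ge[of v w f0] assms by simp
  then show ?thesis
    by (simp add: phi_def)
qed

lemma phi_subgradient:
  assumes v: "subgradient f0 w v"
  shows "excess f0 v < \<infinity>" "phi v = inner v w - f0 w"
proof -
  have le: "inner v x - f0 x \<le> inner v w - f0 w" for x
    using v unfolding subgradient_def by (auto simp: inner_diff_right dest: spec[of _ x])
  have "excess f0 v = ennreal (inner v w - f0 w + f0 0)"
  proof (rule antisym)
    show "excess f0 v \<le> ennreal (inner v w - f0 w + f0 0)"
      unfolding excess_def using le by (intro SUP_least ennreal_leI) simp
  qed (rule excess_ge)
  moreover have "0 \<le> inner v w - f0 w + f0 0"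
    using le[of 0] by simp
  ultimately show "excess f0 v < \<infinity>" "phi v = inner v w - f0 w"
    by (simp_all add: phi_def)
qed

lemma AE_phi_T: "AE w in lborel. excess f0 (T w) < \<infinity> \<and> phi (T w) = inner (T w) w - f0 w"
  using T_grad
proof eventually_elim
  case (elim w)
  then have "subgradient f0 w (T w)"
    using subgradient_grad(1)[OF f0] by simp
  then show ?case
    using phi_subgradient by blast
qed

lemma AE_excess_finite: "AE v in \<mu>. excess f0 v < \<infinity>"
proof -
  have "AE v in \<mu>. excess f0 v \<noteq> \<infinity>"
    using cost_f0 unfolding cost_def by (intro nn_integral_PInf_AE) auto
  then show ?thesis
    by (simp add: less_top)
qed

lemma phi_integrable: "integrable \<mu> phi" and phi_integral: "(\<integral>v. phi v \<partial>\<mu>) = enn2real (cost f0) - f0 0"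
proof -
  have "(\<integral>\<^sup>+ v. ennreal (enn2real (excess f0 v)) \<partial>\<mu>) = cost f0"
    unfolding cost_def using AE_excess_finite by (intro nn_integral_cong_AE) (auto elim: eventually_mono)
  then have eq: "(\<integral>\<^sup>+ v. ennreal (enn2real (excess f0 v)) \<partial>\<mu>) = ennreal (enn2real (cost f0))"
    using cost_f0 by simp
  have int: "integrable \<mu> (\<lambda>v. enn2real (excess f0 v))"
    by (rule integrableI_nn_integral_finite[OF _ _ eq]) auto
  show "integrable \<mu> phi"
    unfolding phi_def by (intro Bochner_Integration.integrable_diff int) simp
  have "(\<integral>v. enn2real (excess f0 v) \<partial>\<mu>) = enn2real (cost f0)"
    using integral_eq_nn_integral[of "\<lambda>v. enn2real (excess f0 v)" \<mu>] eq by simp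
  then show "(\<integral>v. phi v \<partial>\<mu>) = enn2real (cost f0) - f0 0"
    unfolding phi_def using int by (simp add: prob_space)
qed

text \<open>Adding \<open>\<epsilon> g\<close> to the conjugate changes \<open>f0\<close> by \<open>- \<epsilon> g (grad f0)\<close> to first order.  At a
  point of differentiability the function \<open>inner w v - phi v\<close> decreases at a linear rate away from
  the ball of radius \<open>2 * \<delta>\<close> around \<open>grad f0 w\<close>, so perturbed maximizers stay in that ball.\<close>

definition perturbed :: "('a \<Rightarrow> real) \<Rightarrow> real \<Rightarrow> 'a \<Rightarrow> real" where
  "perturbed g \<epsilon> w = (SUP v\<in>{v. norm v \<le> R \<and> excess f0 v < \<infinity>}. inner w v - (phi v + \<epsilon> * g v))"

context
  fixes g :: "'a \<Rightarrow> real" and M :: real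
  assumes g_cont: "continuous_on UNIV g" and g_bound: "\<And>v. \<bar>g v\<bar> \<le> M"
begin

lemma perturbed_upper:
  assumes "\<And>v. norm v \<le> R \<Longrightarrow> excess f0 v < \<infinity> \<Longrightarrow> inner w v - (phi v + \<epsilon> * g v) \<le> x"
  shows "perturbed g \<epsilon> w \<le> x"
proof -
  obtain v where "norm v \<le> R" "subgradient f0 0 v"
    using f0 unfolding subgradients_in_ball_def by blast
  then have "{v. norm v \<le> R \<and> excess f0 v < \<infinity>} \<noteq> {}"
    using phi_subgradient(1) by blast
  then show ?thesis
    unfolding perturbed_def using assms by (intro cSUP_least) auto
qed

lemma eps_g_bound: "\<bar>\<epsilon> * g v\<bar> \<le> \<bar>\<epsilon>\<bar> * M"
  unfolding abs_mult by (intro mult_left_mono g_bound) simp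

lemma inner_le_f0_perturbed:
  assumes "excess f0 v < \<infinity>"
  shows "inner w v - (phi v + \<epsilon> * g v) \<le> f0 w + \<bar>\<epsilon>\<bar> * M"
  using phi_ge[OF assms, of w] eps_g_bound[of \<epsilon> v] by (simp add: inner_commute abs_le_iff)

lemma perturbed_ge:
  assumes "norm v \<le> R" "excess f0 v < \<infinity>"
  shows "inner w v - (phi v + \<epsilon> * g v) \<le> perturbed g \<epsilon> w"
  unfolding perturbed_def
proof (rule cSUP_upper)
  show "bdd_above ((\<lambda>v. inner w v - (phi v + \<epsilon> * g v)) ` {v. norm v \<le> R \<and> excess f0 v < \<infinity>})"
    by (rule bdd_aboveI[of _ "f0 w + \<bar>\<epsilon>\<bar> * M"]) (use inner_le_f0_perturbed in auto)
qed (use assms in auto)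

text \<open>The Legendre transform is nonexpansive in the uniform norm. The lower bound tests the
  supremum with a subgradient at \<open>w\<close>, where Young's inequality is an equality.\<close>

lemma perturbed_diff_le: "\<bar>perturbed g \<epsilon> w - f0 w\<bar> \<le> \<bar>\<epsilon>\<bar> * M"
proof -
  obtain v where v: "norm v \<le> R" "subgradient f0 w v"
    using f0 unfolding subgradients_in_ball_def by blast
  have "f0 w - \<epsilon> * g v \<le> perturbed g \<epsilon> w"
    using perturbed_ge[OF v(1) phi_subgradient(1)[OF v(2)], of w \<epsilon>] phi_subgradient(2)[OF v(2)]
    by (simp add: inner_commute)
  moreover have "perturbed g \<epsilon> w \<le> f0 w + \<bar>\<epsilon>\<bar> * M"
    by (rule perturbed_upper) (rule inner_le_f0_perturbed)
  ultimately show ?thesis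
    using eps_g_bound[of \<epsilon> v] by (simp add: abs_le_iff)
qed

lemma perturbed_subgradients_in_ball: "subgradients_in_ball R (perturbed g \<epsilon>)"
proof (rule subgradients_in_ball_SUP[where c="\<lambda>v. phi v + \<epsilon> * g v"])
  let ?D = "{v. norm v \<le> R \<and> excess f0 v < \<infinity>}"
  show "?D \<subseteq> cball 0 R"
    by auto
  show "inner w v - (phi v + \<epsilon> * g v) \<le> perturbed g \<epsilon> w" if "v \<in> ?D" for v w
    using perturbed_ge that by auto
  show "\<exists>v\<in>?D. perturbed g \<epsilon> w - \<delta> \<le> inner w v - (phi v + \<epsilon> * g v)" if "\<delta> > 0" for w \<delta>
  proof (rule ccontr)
    assume "\<not> ?thesis"
    then have "perturbed g \<epsilon> w \<le> perturbed g \<epsilon> w - \<delta>"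
      by (intro perturbed_upper) (auto simp: not_le intro: less_imp_le)
    with that show False
      by simp
  qed
qed

lemma g_borel [measurable]: "g \<in> borel_measurable borel"
  using g_cont by (rule borel_measurable_continuous_onI)

lemma g_integrable: "integrable \<mu> g"
  by (rule integrable_const_bound[where B=M]) (use g_bound in auto)

text \<open>By construction the conjugate of \<open>perturbed g \<epsilon>\<close> lies below phi +
  \<epsilon> g wherever phi is meaningful in the ball. Equality would require convexity of phi +
  \<epsilon> g, but only this inequality is needed against optimality.\<close>

lemma cost_perturbed:
  "cost (perturbed g \<epsilon>) < \<infinity>"
  "enn2real (cost (perturbed g \<epsilon>)) - perturbed g \<epsilon> 0 \<le> (\<integral>v. phi v \<partial>\<mu>) + \<epsilon> * (\<integral>v. g v \<partial>\<mu>)"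
proof -
  let ?u = "\<lambda>v. perturbed g \<epsilon> 0 + phi v + \<epsilon> * g v"
  have u: "integrable \<mu> ?u" "(\<integral>v. ?u v \<partial>\<mu>) = perturbed g \<epsilon> 0 + (\<integral>v. phi v \<partial>\<mu>) + \<epsilon> * (\<integral>v. g v \<partial>\<mu>)"
    using phi_integrable g_integrable by (simp_all add: prob_space)
  have AE_u: "AE v in \<mu>. 0 \<le> ?u v \<and> excess (perturbed g \<epsilon>) v \<le> ennreal (?u v)"
    using mu_ball AE_excess_finite
  proof eventually_elim
    case (elim v)
    have "inner v w - perturbed g \<epsilon> w + perturbed g \<epsilon> 0 \<le> ?u v" for w
      using perturbed_ge[OF elim, of w \<epsilon>] by (simp add: inner_commute)
    moreover have "0 \<le> ?u v"
      using perturbed_ge[OF elim, of 0 \<epsilon>] by simp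
    ultimately show ?case
      unfolding excess_def by (auto intro!: SUP_least ennreal_leI)
  qed
  have "cost (perturbed g \<epsilon>) \<le> (\<integral>\<^sup>+ v. ennreal (?u v) \<partial>\<mu>)"
    unfolding cost_def using AE_u by (intro nn_integral_mono_AE) (auto elim: eventually_mono)
  also have "\<dots> = ennreal (\<integral>v. ?u v \<partial>\<mu>)"
    using AE_u by (intro nn_integral_eq_integral u(1)) (auto elim: eventually_mono)
  finally have le: "cost (perturbed g \<epsilon>) \<le> ennreal (\<integral>v. ?u v \<partial>\<mu>)" .
  then show "cost (perturbed g \<epsilon>) < \<infinity>"
    by (simp add: le_less_trans[OF _ ennreal_less_top])
  have "0 \<le> (\<integral>v. ?u v \<partial>\<mu>)"
    using AE_u by (intro integral_nonneg_AE) (auto elim: eventually_mono)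
  then have "enn2real (cost (perturbed g \<epsilon>)) \<le> (\<integral>v. ?u v \<partial>\<mu>)"
    using enn2real_mono[OF le] by simp
  then show "enn2real (cost (perturbed g \<epsilon>)) - perturbed g \<epsilon> 0 \<le> (\<integral>v. phi v \<partial>\<mu>) + \<epsilon> * (\<integral>v. g v \<partial>\<mu>)"
    unfolding u(2) by simp
qed

lemma perturbed_near_maximizer:
  assumes w: "f0 differentiable (at w)" "T w = grad f0 w" and \<eta>: "\<eta> > 0"
  shows "\<exists>\<epsilon>0>0. \<forall>\<epsilon>. 0 < \<epsilon> \<and> \<epsilon> \<le> \<epsilon>0 \<longrightarrow> perturbed g \<epsilon> w \<le> f0 w - \<epsilon> * g (T w) + \<epsilon> * \<eta>"
proof -
  define v0 where "v0 = T w"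
  have "isCont g v0"
    using g_cont by (simp add: continuous_on_eq_continuous_at)
  then obtain d where d: "d > 0" "\<And>v. norm (v - v0) < d \<Longrightarrow> \<bar>g v - g v0\<bar> < \<eta>"
    using \<eta> unfolding continuous_at_eps_delta by (auto simp: dist_norm)
  define \<delta> where "\<delta> = d / 2"
  have \<delta>: "\<delta> > 0"
    using d by (simp add: \<delta>_def)
  have "(f0 has_derivative inner v0) (at w)"
    using subgradient_grad(3)[OF f0 w(1)] w(2) by (simp add: v0_def)
  then obtain s where s: "s > 0"
    "\<And>y. norm (y - w) < s \<Longrightarrow> \<bar>f0 y - f0 w - inner v0 (y - w)\<bar> \<le> \<delta> * norm (y - w)"
    using \<delta> unfolding has_derivative_at_alt by auto
  define r where "r = s / 2"
  have r: "r > 0" "r < s"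
    using s by (simp_all add: r_def)
  have M: "0 \<le> M"
    using g_bound[of 0] by (meson abs_ge_zero order_trans)
  have far: "inner w v - phi v \<le> f0 w - \<delta> * r"
    if v: "excess f0 v < \<infinity>" "\<not> norm (v - v0) < d" for v
  proof -
    \<comment> \<open>Young's inequality is tested at \<open>w + y\<close>, a step of length
      \<open>r\<close> in the direction of \<open>v - v0\<close>. It gains at least 2 \<delta> r, of
      which \<delta> r is lost to the differentiability error.\<close>
    define y where "y = (r / norm (v - v0)) *\<^sub>R (v - v0)"
    have nz: "norm (v - v0) > 0"
      using v(2) d(1) by linarith
    have y: "norm y = r" "inner (v - v0) y = r * norm (v - v0)"
      using nz r by (simp_all add: y_def power2_norm_eq_inner[symmetric] power2_eq_square)
    have "inner v (w + y) - f0 (w + y) \<le> phi v"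
      by (rule phi_ge[OF v(1)])
    moreover have "f0 (w + y) \<le> f0 w + inner v0 y + \<delta> * r"
      using s(2)[of "w + y"] y(1) r by (auto simp: abs_le_iff)
    ultimately have "inner w v - phi v \<le> f0 w - inner (v - v0) y + \<delta> * r"
      by (simp add: inner_add_right inner_diff_left inner_commute[of w v])
    moreover have "r * (2 * \<delta>) \<le> inner (v - v0) y"
      unfolding y(2) using v(2) r by (intro mult_left_mono) (auto simp: \<delta>_def)
    ultimately show ?thesis
      by (simp add: algebra_simps)
  qed
  \<comment> \<open>For such \<epsilon> the deficit \<delta> r exceeds the largest possible gain 2 M
    \<epsilon> from the oscillation of \<open>g\<close>; the summand 1 keeps the denominator
    positive.\<close>
  define \<epsilon>0 where "\<epsilon>0 = \<delta> * r / (2 * M + 1)"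
  have "perturbed g \<epsilon> w \<le> f0 w - \<epsilon> * g v0 + \<epsilon> * \<eta>" if \<epsilon>: "0 < \<epsilon>" "\<epsilon> \<le> \<epsilon>0" for \<epsilon>
  proof (rule perturbed_upper)
    fix v assume v: "excess f0 v < \<infinity>"
    show "inner w v - (phi v + \<epsilon> * g v) \<le> f0 w - \<epsilon> * g v0 + \<epsilon> * \<eta>"
    proof (cases "norm (v - v0) < d")
      case True
      have "\<epsilon> * (g v0 - g v) \<le> \<epsilon> * \<eta>"
        using d(2)[OF True] \<epsilon> by (intro mult_left_mono) auto
      then show ?thesis
        using phi_ge[OF v, of w] by (simp add: inner_commute right_diff_distrib)
    next
      case False
      have "\<epsilon> * (g v0 - g v) \<le> \<epsilon> * (2 * M + 1)"
        using g_bound[of v] g_bound[of v0] \<epsilon> by (intro mult_left_mono) (auto simp: abs_le_iff)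
      also have "\<dots> \<le> \<delta> * r"
        using \<epsilon>(2) M by (simp add: \<epsilon>0_def pos_le_divide_eq)
      finally have "\<epsilon> * g v0 - \<epsilon> * g v \<le> \<delta> * r"
        by (simp add: right_diff_distrib)
      moreover have "0 \<le> \<epsilon> * \<eta>"
        using \<epsilon> \<eta> by simp
      ultimately show ?thesis
        using far[OF v False] by linarith
    qed
  qed
  moreover have "\<epsilon>0 > 0"
    using \<delta> r M by (simp add: \<epsilon>0_def)
  ultimately show ?thesis
    unfolding v0_def by blast
qed

text \<open>An envelope theorem: the derivative of the supremum in \<epsilon> is that of its
  integrand at the maximizer \<open>T w\<close>, unique because \<open>f0\<close> is differentiable
  at \<open>w\<close>. Testing with \<open>T w\<close> gives one bound, near-maximality the
  other.\<close>

lemma perturbed_difference_quotient: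
  assumes w: "f0 differentiable (at w)" "T w = grad f0 w"
  shows "(\<lambda>n. (perturbed g (step n) w - f0 w) / step n) \<longlonglongrightarrow> - g (T w)"
proof (rule LIMSEQ_I)
  fix \<eta> :: real assume \<eta>: "\<eta> > 0"
  obtain \<epsilon>0 where \<epsilon>0: "\<epsilon>0 > 0" "\<And>\<epsilon>. 0 < \<epsilon> \<Longrightarrow> \<epsilon> \<le> \<epsilon>0 \<Longrightarrow> perturbed g \<epsilon> w \<le> f0 w - \<epsilon> * g (T w) + \<epsilon> * (\<eta> / 2)"
    using perturbed_near_maximizer[OF w, of "\<eta> / 2"] \<eta> by auto
  obtain N where N: "\<And>n. n \<ge> N \<Longrightarrow> step n < \<epsilon>0"
    using order_tendstoD(2)[OF step(3) \<epsilon>0(1)] unfolding eventually_sequentially by blast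
  have sub: "subgradient f0 w (T w)"
    using subgradient_grad(1)[OF f0 w(1)] w(2) by simp
  show "\<exists>N. \<forall>n\<ge>N. norm ((perturbed g (step n) w - f0 w) / step n - - g (T w)) < \<eta>"
  proof (intro exI[of _ N] allI impI)
    fix n assume n: "n \<ge> N"
    have s: "step n > 0"
      by (rule step)
    have "f0 w - step n * g (T w) \<le> perturbed g (step n) w"
      using perturbed_ge[OF norm_T phi_subgradient(1)[OF sub], of w "step n"] phi_subgradient(2)[OF sub]
      by (simp add: inner_commute)
    then have "- g (T w) \<le> (perturbed g (step n) w - f0 w) / step n"
      using s by (simp add: pos_le_divide_eq algebra_simps)
    moreover have "perturbed g (step n) w - f0 w \<le> (\<eta> / 2 - g (T w)) * step n"
      using \<epsilon>0(2)[OF s less_imp_le[OF N[OF n]]] by (simp add: algebra_simps)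
    then have "(perturbed g (step n) w - f0 w) / step n \<le> \<eta> / 2 - g (T w)"
      using s by (simp add: pos_divide_le_eq)
    ultimately show "norm ((perturbed g (step n) w - f0 w) / step n - - g (T w)) < \<eta>"
      using \<eta> by (simp add: abs_less_iff)
  qed
qed

lemma integral_test_function_le: "(\<integral>w. F1 w * g (T w) \<partial>lborel) \<le> (\<integral>v. g v \<partial>\<mu>)"
proof -
  note [measurable] = subgradients_in_ball_borel[OF perturbed_subgradients_in_ball]
  let ?kn = "\<lambda>n w. (perturbed g (step n) w - f0 w) / h"
  let ?k = "\<lambda>w. - g (T w) / h"
  have M: "0 \<le> M"
    using g_bound[of 0] by (meson abs_ge_zero order_trans)
  \<comment> \<open>The domination constant must be strictly positive although \<open>M\<close> may
    be 0, hence M + 1.\<close>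
  have "\<bar>?kn n w\<bar> \<le> step n * ((M + 1) / h * (1 + (norm w)\<^sup>2))" for n w
  proof -
    have "\<bar>?kn n w\<bar> \<le> step n * M / h"
      using perturbed_diff_le[of "step n" w] step(1)[of n] h_pos by (simp add: divide_right_mono)
    also have "\<dots> \<le> step n * ((M + 1) / h * (1 + (norm w)\<^sup>2))"
    proof -
      have "M * 1 \<le> (M + 1) * (1 + (norm w)\<^sup>2)"
        using M by (intro mult_mono) auto
      then have "step n * (M / h) \<le> step n * ((M + 1) * (1 + (norm w)\<^sup>2) / h)"
        using step(1)[of n] h_pos by (intro mult_left_mono divide_right_mono) auto
      then show ?thesis
        by simp
    qed
    finally show ?thesis .
  qed
  moreover have "AE w in lborel. (\<lambda>n. ?kn n w / step n) \<longlonglongrightarrow> ?k w"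
    using T_grad
  proof eventually_elim
    case (elim w)
    have "(\<lambda>n. (perturbed g (step n) w - f0 w) / step n / h) \<longlonglongrightarrow> - g (T w) / h"
      using elim h_pos by (intro tendsto_divide perturbed_difference_quotient tendsto_const) auto
    then show ?case
      by (simp add: mult.commute)
  qed
  moreover have "?k \<in> borel_measurable borel" "\<And>n. ?kn n \<in> borel_measurable borel"
    by measurable
  ultimately have lim: "(\<lambda>n. ((\<integral>w. F1 w * exp (?kn n w) \<partial>lborel) - 1) / step n) \<longlonglongrightarrow> (\<integral>w. F1 w * ?k w \<partial>lborel)"
    using M h_pos step by (intro integral_F1_exp[where C="(M + 1) / h"]) auto
  have "0 \<le> (\<integral>v. g v \<partial>\<mu>) + h * (((\<integral>w. F1 w * exp (?kn n w) \<partial>lborel) - 1) / step n)" for n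
  proof -
    have "potential c0 f0 w + ?kn n w = potential c0 (perturbed g (step n)) w" for w
      by (simp add: potential_def diff_divide_distrib)
    then have Z: "(\<integral>w. F1 w * exp (?kn n w) \<partial>lborel) = partition c0 (perturbed g (step n))"
      unfolding partition_def F1_def exp_add[symmetric] by simp
    have "0 \<le> step n * (\<integral>v. g v \<partial>\<mu>) + h * ((\<integral>w. F1 w * exp (?kn n w) \<partial>lborel) - 1)"
      using optimal[OF c0 perturbed_subgradients_in_ball cost_perturbed(1), of "step n"]
        cost_perturbed(2)[of "step n"] unfolding Z phi_integral by linarith
    then have "0 \<le> (step n * (\<integral>v. g v \<partial>\<mu>) + h * ((\<integral>w. F1 w * exp (?kn n w) \<partial>lborel) - 1)) / step n"
      using step(1)[of n] by (intro divide_nonneg_pos)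
    then show ?thesis
      using step(1)[of n] by (simp add: add_divide_distrib)
  qed
  then have "0 \<le> (\<integral>v. g v \<partial>\<mu>) + h * (\<integral>w. F1 w * ?k w \<partial>lborel)"
    by (intro LIMSEQ_le_const[OF tendsto_add[OF tendsto_const tendsto_mult[OF tendsto_const lim]]]) auto
  moreover have "(\<integral>w. F1 w * ?k w \<partial>lborel) = - (\<integral>w. F1 w * g (T w) \<partial>lborel) / h"
  proof -
    have "(\<integral>w. F1 w * ?k w \<partial>lborel) = (\<integral>w. - (F1 w * g (T w)) / h \<partial>lborel)"
      by simp
    then show ?thesis
      by (simp only: integral_divide_zero integral_minus)
  qed
  ultimately show ?thesis
    using h_pos by simp
qed

end

text \<open>Perturbing with positive \<epsilon> gives one inequality; applying it to - g gives the
  other.\<close>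

lemma integral_test_function:
  assumes "continuous_on UNIV g" "\<And>v. \<bar>g v\<bar> \<le> M"
  shows "(\<integral>w. F1 w * g (T w) \<partial>lborel) = (\<integral>v. g v \<partial>\<mu>)"
proof (rule antisym)
  show "(\<integral>w. F1 w * g (T w) \<partial>lborel) \<le> (\<integral>v. g v \<partial>\<mu>)"
    by (rule integral_test_function_le[OF assms])
  have "(\<integral>w. F1 w * - g (T w) \<partial>lborel) \<le> (\<integral>v. - g v \<partial>\<mu>)"
    by (rule integral_test_function_le[of "\<lambda>v. - g v" M]) (use assms in \<open>auto intro: continuous_intros\<close>)
  then show "(\<integral>v. g v \<partial>\<mu>) \<le> (\<integral>w. F1 w * g (T w) \<partial>lborel)"
    by simp
qed

end

text \<open>The indicator of a nonempty closed set is the pointwise limit of continuous functions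
  max 0 (1 - n dist) with values in [0, 1], and closed sets form an intersection-stable generator of
  the Borel sets.\<close>

lemma measure_eqI_continuous_bounded:
  fixes M N :: "'a::metric_space measure"
  assumes fin: "finite_measure M" "finite_measure N"
    and sets: "sets M = sets borel" "sets N = sets borel"
    and eq: "\<And>g :: 'a \<Rightarrow> real. continuous_on UNIV g \<Longrightarrow> (\<And>x. \<bar>g x\<bar> \<le> 1) \<Longrightarrow>
      (\<integral>x. g x \<partial>M) = (\<integral>x. g x \<partial>N)"
  shows "M = N"
proof -
  interpret M: finite_measure M by fact
  interpret N: finite_measure N by fact
  have closed_eq: "emeasure M C = emeasure N C" if C: "closed C" for C
  proof (cases "C = {}")
    case False
    define g where "g n x = max 0 (1 - real n * infdist x C)" for n :: nat and x
    have g_cont: "continuous_on UNIV (g n)" for n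
      unfolding g_def by (intro continuous_intros)
    have g_bound: "\<bar>g n x\<bar> \<le> 1" for n x
      using infdist_nonneg[of x C] by (simp add: g_def)
    have lim: "(\<lambda>n. g n x) \<longlonglongrightarrow> indicator C x" for x
    proof (cases "x \<in> C")
      case True
      then show ?thesis
        by (simp add: g_def)
    next
      case out: False
      then have d: "infdist x C > 0"
        using C False by (simp add: infdist_pos_not_in_closed)
      obtain N where N: "1 / infdist x C < real N"
        using reals_Archimedean2 by blast
      have "g n x = 0" if "n \<ge> N" for n
      proof -
        have "1 / infdist x C \<le> real n"
          using N that by linarith
        then show ?thesis
          using d by (simp add: g_def pos_divide_le_eq)
      qed
      then have "\<forall>\<^sub>F n in sequentially. g n x = indicator C x"
        using out unfolding eventually_sequentially by auto
      then show ?thesis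
        by (rule tendsto_eventually)
    qed
    have conv: "(\<lambda>n. \<integral>x. g n x \<partial>L) \<longlonglongrightarrow> measure L C"
      if L: "finite_measure L" "sets L = sets borel" for L
    proof -
      interpret finite_measure L by fact
      note [measurable_cong] = L(2)
      have [measurable]: "g n \<in> borel_measurable borel" for n
        by (rule borel_measurable_continuous_onI[OF g_cont])
      have [measurable]: "C \<in> sets borel"
        using C by simp
      have "(\<lambda>n. \<integral>x. g n x \<partial>L) \<longlonglongrightarrow> (\<integral>x. indicator C x \<partial>L)"
        by (rule integral_dominated_convergence[where w="\<lambda>_. 1"]) (use lim g_bound in auto)
      moreover have "(\<integral>x. indicator C x \<partial>L) = measure L C"
        using sets_eq_imp_space_eq[OF L(2)] by simp
      ultimately show ?thesis
        by simp
    qed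
    have "measure M C = measure N C"
      using conv[OF fin(1) sets(1)] conv[OF fin(2) sets(2)] eq[OF g_cont g_bound]
      by (simp add: LIMSEQ_unique)
    then show ?thesis
      by (simp add: M.emeasure_eq_measure N.emeasure_eq_measure)
  qed simp
  show ?thesis
  proof (rule measure_eqI_generator_eq[where E="Collect closed" and \<Omega>=UNIV and A="\<lambda>_. UNIV"])
    show "Int_stable (Collect closed :: 'a set set)"
      by (auto simp: Int_stable_def)
    show "sets M = sigma_sets UNIV (Collect closed)" "sets N = sigma_sets UNIV (Collect closed)"
      using sets by (simp_all add: borel_eq_closed)
    show "emeasure M UNIV \<noteq> \<infinity>"
      using M.emeasure_finite by simp
  qed (use closed_eq in auto)
qed

section \<open>Push-forward of the optimal density and transfer of integrals\<close>

context entropic_dual_optimizer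
begin

lemma F1_prob_space: "prob_space (density lborel (\<lambda>w. ennreal (F1 w)))"
proof (rule prob_spaceI)
  have "(\<integral>\<^sup>+ w. ennreal (F1 w) \<partial>lborel) = 1"
    using nn_integral_eq_integral[OF F1_integrable] F1_pos F1_integral by (simp add: less_imp_le)
  then show "emeasure (density lborel (\<lambda>w. ennreal (F1 w))) (space (density lborel (\<lambda>w. ennreal (F1 w)))) = 1"
    by (simp add: emeasure_density)
qed

lemma distr_T: "distr (density lborel (\<lambda>w. ennreal (F1 w))) borel T = \<mu>"
proof (rule measure_eqI_continuous_bounded)
  interpret F1: prob_space "density lborel (\<lambda>w. ennreal (F1 w))"
    by (rule F1_prob_space)
  have "prob_space (distr (density lborel (\<lambda>w. ennreal (F1 w))) borel T)"
    by (rule F1.prob_space_distr) simp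
  then show "finite_measure (distr (density lborel (\<lambda>w. ennreal (F1 w))) borel T)"
    by (rule prob_space.finite_measure)
  show "finite_measure \<mu>"
    by unfold_locales
  show "sets \<mu> = sets borel"
    by (rule sets_mu)
  fix g :: "'a \<Rightarrow> real" assume g: "continuous_on UNIV g" "\<And>x. \<bar>g x\<bar> \<le> 1"
  have [measurable]: "g \<in> borel_measurable borel"
    using g(1) by (rule borel_measurable_continuous_onI)
  have "(\<integral>x. g x \<partial>distr (density lborel (\<lambda>w. ennreal (F1 w))) borel T) = (\<integral>w. F1 w * g (T w) \<partial>lborel)"
    using F1_pos by (simp add: integral_distr integral_density less_imp_le)
  also have "\<dots> = (\<integral>v. g v \<partial>\<mu>)"
    by (rule integral_test_function[OF g])
  finally show "(\<integral>x. g x \<partial>distr (density lborel (\<lambda>w. ennreal (F1 w))) borel T) = (\<integral>x. g x \<partial>\<mu>)" .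
qed simp

lemma integrable_T_iff:
  fixes g :: "'a \<Rightarrow> real"
  assumes [measurable]: "g \<in> borel_measurable borel"
  shows "integrable \<mu> g \<longleftrightarrow> integrable lborel (\<lambda>w. F1 w * g (T w))"
  unfolding distr_T[symmetric] using F1_pos by (simp add: integrable_distr_eq integrable_density less_imp_le)

lemma integral_T:
  fixes g :: "'a \<Rightarrow> real"
  assumes [measurable]: "g \<in> borel_measurable borel"
  shows "(\<integral>v. g v \<partial>\<mu>) = (\<integral>w. F1 w * g (T w) \<partial>lborel)"
  unfolding distr_T[symmetric] using F1_pos by (simp add: integral_distr integral_density less_imp_le)

text \<open>\<open>F1\<close> is positive everywhere, so the null sets of its density measure are
  Lebesgue null.\<close>

lemma AE_T:
  assumes "{v. P v} \<in> sets borel" "AE v in \<mu>. P v"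
  shows "AE w in lborel. P (T w)"
proof -
  have "AE w in density lborel (\<lambda>w. ennreal (F1 w)). P (T w)"
    using assms unfolding distr_T[symmetric] by (subst (asm) AE_distr_iff) auto
  then show ?thesis
    using F1_pos by (simp add: AE_density)
qed

end

section \<open>Extended-valued integrals of convex functions\<close>

text \<open>Moves the density into the measure. Where it vanishes, the product \<infinity> * 0 = 0
  agrees with the set having no mass.\<close>

lemma ereal_integral_density:
  assumes [measurable]: "f \<in> borel_measurable M" "F \<in> borel_measurable M" and F: "\<And>x. 0 \<le> F x"
  shows "ereal_integral M (\<lambda>x. f x * ereal (F x)) = ereal_integral (density M (\<lambda>x. ennreal (F x))) f"
proof -
  have mult: "e2ennreal (y * ereal (F x)) = ennreal (F x) * e2ennreal y" for x y
  proof (cases "F x = 0")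
    case False
    then have "F x > 0"
      using F[of x] by (simp add: less_le)
    show ?thesis
    proof (cases y)
      case (real r)
      have "e2ennreal (y * ereal (F x)) = ennreal (F x * r)"
        by (simp add: real mult.commute)
      also have "\<dots> = ennreal (F x) * e2ennreal y"
        using F[of x] by (simp add: real ennreal_mult')
      finally show ?thesis .
    qed (use \<open>F x > 0\<close> in \<open>simp_all add: e2ennreal_neg\<close>)
  qed (simp add: e2ennreal_neg flip: zero_ereal_def)
  have "e2ennreal (- (f x * ereal (F x))) = ennreal (F x) * e2ennreal (- f x)" for x
    using mult[of "- f x" x] by simp
  then show ?thesis
    unfolding ereal_integral_def mult by (simp add: nn_integral_density)
qed

text \<open>A lower bound on a probability space makes the negative part integrable, so no
  difference \<infinity> - \<infinity> occurs: the integral is infinite or an ordinary Bochner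
  integral.\<close>

lemma ereal_integral_cases:
  assumes "prob_space M" and [measurable]: "f \<in> borel_measurable M" and B: "\<And>x. ereal B \<le> f x"
  obtains "ereal_integral M f = \<infinity>"
  | "integrable M (\<lambda>x. real_of_ereal (f x))" "AE x in M. f x \<noteq> \<infinity>"
    "ereal_integral M f = ereal (\<integral>x. real_of_ereal (f x) \<partial>M)"
proof (cases "(\<integral>\<^sup>+ x. e2ennreal (f x) \<partial>M) = \<infinity>")
  interpret prob_space M by fact
  have "(\<integral>\<^sup>+ x. e2ennreal (- f x) \<partial>M) \<le> (\<integral>\<^sup>+ x. ennreal \<bar>B\<bar> \<partial>M)"
  proof (intro nn_integral_mono)
    fix x
    have "- f x \<le> ereal \<bar>B\<bar>"
      using B[of x] by (cases "f x") auto
    then show "e2ennreal (- f x) \<le> ennreal \<bar>B\<bar>"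
      by (metis e2ennreal_ereal e2ennreal_mono)
  qed
  also have "\<dots> < \<infinity>"
    by (simp add: emeasure_space_1)
  finally have neg: "(\<integral>\<^sup>+ x. e2ennreal (- f x) \<partial>M) < \<infinity>" .
  {
    case True
    then have "ereal_integral M f = \<infinity>"
      using neg unfolding ereal_integral_def by (cases "\<integral>\<^sup>+ x. e2ennreal (- f x) \<partial>M") auto
    then show thesis
      by (rule that(1))
  next
    case False
    have "AE x in M. e2ennreal (f x) \<noteq> \<infinity>"
      using False by (intro nn_integral_PInf_AE) auto
    then have fin: "AE x in M. f x \<noteq> \<infinity>"
      by eventually_elim auto
    have real: "f x = ereal (real_of_ereal (f x))" if "f x \<noteq> \<infinity>" for x
      using B[of x] that by (cases "f x") auto
    have pos_eq: "(\<integral>\<^sup>+ x. ennreal (real_of_ereal (f x)) \<partial>M) = (\<integral>\<^sup>+ x. e2ennreal (f x) \<partial>M)"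
      using fin by (intro nn_integral_cong_AE, elim eventually_mono) (metis e2ennreal_ereal real)
    have neg_eq: "(\<integral>\<^sup>+ x. ennreal (- real_of_ereal (f x)) \<partial>M) = (\<integral>\<^sup>+ x. e2ennreal (- f x) \<partial>M)"
      using fin by (intro nn_integral_cong_AE, elim eventually_mono)
        (metis e2ennreal_ereal real uminus_ereal.simps(1))
    have int: "integrable M (\<lambda>x. real_of_ereal (f x))"
      unfolding real_integrable_def pos_eq neg_eq using False neg by auto
    have "ereal_integral M f = ereal (\<integral>x. real_of_ereal (f x) \<partial>M)"
      unfolding real_lebesgue_integral_def[OF int] pos_eq neg_eq ereal_integral_def
      using False neg
      by (cases "\<integral>\<^sup>+ x. e2ennreal (f x) \<partial>M"; cases "\<integral>\<^sup>+ x. e2ennreal (- f x) \<partial>M") auto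
    with int fin show thesis
      by (rule that(2))
  }
qed

lemma legendre_eq_excess:
  fixes f :: "'a::euclidean_space \<Rightarrow> real"
  shows "legendre (\<lambda>x. ereal (f x)) v = enn2ereal (SUP w. ennreal (inner v w - f w + f 0)) - ereal (f 0)"
proof (rule antisym)
  let ?e = "SUP w. ennreal (inner v w - f w + f 0)"
  show "legendre (\<lambda>x. ereal (f x)) v \<le> enn2ereal ?e - ereal (f 0)"
    unfolding legendre_def
  proof (rule SUP_least)
    fix w
    have le: "ennreal (inner v w - f w + f 0) \<le> ?e"
      by (rule SUP_upper) simp
    show "ereal (inner v w) - ereal (f w) \<le> enn2ereal ?e - ereal (f 0)"
    proof (cases ?e)
      case (real r)
      with le have "inner v w - f w + f 0 \<le> r"
        by (simp only: ennreal_le_iff)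
      then show ?thesis
        unfolding real(2) using real(1) by simp
    next
      case top
      then show ?thesis
        by (simp only: enn2ereal_top) simp
    qed
  qed
  show "enn2ereal ?e - ereal (f 0) \<le> legendre (\<lambda>x. ereal (f x)) v"
  proof (cases "legendre (\<lambda>x. ereal (f x)) v")
    case (real l)
    have le: "inner v w - f w \<le> l" for w
      using legendre_ge[of v w f] real by simp
    have "?e \<le> ennreal (l + f 0)"
      using le by (intro SUP_least ennreal_leI) simp
    then have "enn2ereal ?e \<le> enn2ereal (ennreal (l + f 0))"
      by (simp add: less_eq_ennreal.rep_eq)
    also have "\<dots> = ereal (l + f 0)"
      using le[of 0] by (simp add: enn2ereal_ennreal)
    finally show ?thesis
      unfolding real by (simp add: ereal_minus_le)
  next
    case MInf
    then show ?thesis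
      using legendre_ge[of v 0 f] by simp
  qed simp
qed

section \<open>Optimality and the Wasserstein distance\<close>

context entropic_dual_optimizer
begin

lemma legendre_f0:
  "legendre (\<lambda>x. ereal (f0 x)) v = enn2ereal (excess f0 v) - ereal (f0 0)"
  by (simp add: legendre_eq_excess excess_def)

lemma AE_legendre_f0: "AE v in \<mu>. legendre (\<lambda>x. ereal (f0 x)) v = ereal (phi v)"
  using AE_excess_finite
proof eventually_elim
  case (elim v)
  then show ?case
    by (cases "excess f0 v") (auto simp: legendre_f0 phi_def enn2ereal_ennreal)
qed

lemma ereal_integral_legendre_f0:
  "ereal_integral \<mu> (legendre (\<lambda>x. ereal (f0 x))) = ereal (\<integral>v. phi v \<partial>\<mu>)"
proof -
  have bound: "ereal (- f0 0) \<le> legendre (\<lambda>x. ereal (f0 x)) v" for v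
    using legendre_ge[of v 0 f0] by simp
  have eq: "(\<integral>\<^sup>+ v. e2ennreal (legendre (\<lambda>x. ereal (f0 x)) v) \<partial>\<mu>) = (\<integral>\<^sup>+ v. ennreal (phi v) \<partial>\<mu>)"
    using AE_legendre_f0 by (intro nn_integral_cong_AE) (auto elim: eventually_mono)
  have "(\<integral>\<^sup>+ v. ennreal (phi v) \<partial>\<mu>) \<noteq> \<infinity>"
    using phi_integrable unfolding real_integrable_def by simp
  then have ne: "ereal_integral \<mu> (legendre (\<lambda>x. ereal (f0 x))) \<noteq> \<infinity>"
    unfolding ereal_integral_def eq by (cases "\<integral>\<^sup>+ v. ennreal (phi v) \<partial>\<mu>") (auto simp: enn2ereal_ennreal ereal_minus_eq_PInfty_iff)
  have "ereal_integral \<mu> (legendre (\<lambda>x. ereal (f0 x)))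
      = ereal (\<integral>v. real_of_ereal (legendre (\<lambda>x. ereal (f0 x)) v) \<partial>\<mu>)"
    by (rule ereal_integral_cases[OF prob_space_axioms _ bound]) (use ne in auto)
  also have "(\<integral>v. real_of_ereal (legendre (\<lambda>x. ereal (f0 x)) v) \<partial>\<mu>) = (\<integral>v. phi v \<partial>\<mu>)"
    using AE_legendre_f0 by (intro integral_cong_AE) (auto elim: eventually_mono)
  finally show ?thesis .
qed

lemma integrable_F1_f0: "integrable lborel (\<lambda>w. F1 w * f0 w)"
proof (rule integrable_F1_mult[where C="\<bar>f0 0\<bar> + R"])
  fix x
  have "\<bar>f0 x\<bar> \<le> \<bar>f0 0\<bar> + R * norm x"
    using subgradients_in_ball_lipschitz[OF f0, of x 0] by simp
  also have "\<dots> \<le> \<bar>f0 0\<bar> * (1 + (norm x)\<^sup>2) + R * (1 + (norm x)\<^sup>2)"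
    using R_nonneg norm_le_one_plus_norm_sq[of x]
    by (intro add_mono mult_left_mono) (auto simp: mult_le_cancel_left1)
  finally show "\<bar>f0 x\<bar> \<le> (\<bar>f0 0\<bar> + R) * (1 + (norm x)\<^sup>2)"
    by (simp add: distrib_right)
qed measurable

text \<open>Equality in Young's inequality along the graph of \<open>T\<close>, integrated against
  \<open>F1\<close>; it is what makes the duality gap vanish.\<close>

lemma integral_F1_phi_T:
  "(\<integral>v. phi v \<partial>\<mu>) = (\<integral>w. F1 w * inner (T w) w \<partial>lborel) - (\<integral>w. F1 w * f0 w \<partial>lborel)"
proof -
  have "(\<integral>v. phi v \<partial>\<mu>) = (\<integral>w. F1 w * phi (T w) \<partial>lborel)"
    by (rule integral_T) simp
  also have "\<dots> = (\<integral>w. F1 w * inner (T w) w - F1 w * f0 w \<partial>lborel)"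
  proof (rule integral_cong_AE)
    show "AE w in lborel. F1 w * phi (T w) = F1 w * inner (T w) w - F1 w * f0 w"
      using AE_phi_T by eventually_elim (simp add: right_diff_distrib)
  qed measurable
  also have "\<dots> = (\<integral>w. F1 w * inner (T w) w \<partial>lborel) - (\<integral>w. F1 w * f0 w \<partial>lborel)"
    using integrable_F1_inner_T_self integrable_F1_f0 by simp
  finally show ?thesis .
qed

text \<open>The tangent line of the exponential at the optimal potential reduces global optimality to
  \<open>inner (T w) w \<le> f w + f* (T w)\<close>, with equality for \<open>f0\<close>.\<close>

lemma dual_bound:
  fixes a :: 'a and b :: real and f :: "'a \<Rightarrow> real"
  assumes f: "subgradients_in_ball R f"
    and int: "integrable \<mu> (\<lambda>v. real_of_ereal (legendre (\<lambda>x. ereal (f x)) v))"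
    and fin: "AE v in \<mu>. legendre (\<lambda>x. ereal (f x)) v \<noteq> \<infinity>"
    and Z: "integrable lborel (\<lambda>w. exp ((inner a w + b * (norm w)\<^sup>2 / 2 + f w) / h - 1))"
    and mean: "\<And>e. (\<integral>w. F1 w * inner w e \<partial>lborel) = 0"
  shows "h + (b + c0) / 2 * real DIM('a) + (\<integral>v. phi v \<partial>\<mu>)
    \<le> h * (\<integral>w. exp ((inner a w + b * (norm w)\<^sup>2 / 2 + f w) / h - 1) \<partial>lborel)
      + (\<integral>v. real_of_ereal (legendre (\<lambda>x. ereal (f x)) v) \<partial>\<mu>)"
proof -
  let ?\<phi> = "\<lambda>v. real_of_ereal (legendre (\<lambda>x. ereal (f x)) v)"
  let ?s = "\<lambda>w. inner a w + b * (norm w)\<^sup>2 / 2 + f w"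
  \<comment> \<open>In the tangent-line bound, \<open>f w\<close> is replaced by the smaller
    \<open>inner (T w) w - ?\<phi> (T w)\<close> and \<open>f0 w\<close> by the equal
    \<open>inner (T w) w - phi (T w)\<close>. The inner products cancel, leaving terms that are
    moments of \<open>F1\<close> or integrals over \<mu>.\<close>
  let ?lower = "\<lambda>w. F1 w * inner w a + (b + c0) / 2 * (F1 w * (norm w)\<^sup>2) + F1 w * phi (T w)
    - F1 w * ?\<phi> (T w) + h * F1 w"
  have \<phi>_T: "integrable lborel (\<lambda>w. F1 w * ?\<phi> (T w))"
    "(\<integral>w. F1 w * ?\<phi> (T w) \<partial>lborel) = (\<integral>v. ?\<phi> v \<partial>\<mu>)"
    using int by (simp_all add: integrable_T_iff integral_T)
  have phi_T: "integrable lborel (\<lambda>w. F1 w * phi (T w))"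
    "(\<integral>w. F1 w * phi (T w) \<partial>lborel) = (\<integral>v. phi v \<partial>\<mu>)"
    using phi_integrable by (simp_all add: integrable_T_iff integral_T)
  have lower: "integrable lborel ?lower"
    "(\<integral>w. ?lower w \<partial>lborel) = (b + c0) / 2 * real DIM('a) + (\<integral>v. phi v \<partial>\<mu>) - (\<integral>v. ?\<phi> v \<partial>\<mu>) + h"
    using \<phi>_T phi_T integrable_F1_inner[of a] integrable_F1_norm_sq F1_integrable mean[of a]
      integral_F1_norm_sq F1_integral by simp_all
  have "AE w in lborel. legendre (\<lambda>x. ereal (f x)) (T w) \<noteq> \<infinity>"
    by (rule AE_T[OF _ fin]) simp
  with AE_phi_T have "AE w in lborel. ?lower w \<le> h * exp (?s w / h - 1)"
  proof eventually_elim
    case (elim w)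
    have young: "inner (T w) w - ?\<phi> (T w) \<le> f w"
    proof (cases "legendre (\<lambda>x. ereal (f x)) (T w)")
      case (real r)
      then show ?thesis
        using legendre_ge[of "T w" w f] by simp
    qed (use elim legendre_ge[of "T w" 0 f] in auto)
    have "F1 w * (?s w / h - potential c0 f0 w) \<le> F1 w * exp (?s w / h - 1 - potential c0 f0 w)"
      using exp_ge_add_one_self[of "?s w / h - 1 - potential c0 f0 w"] F1_pos[of w]
      by (intro mult_left_mono) auto
    also have "\<dots> = exp (?s w / h - 1)"
      by (simp add: F1_def flip: exp_add)
    finally have "h * (F1 w * (?s w / h - potential c0 f0 w)) \<le> h * exp (?s w / h - 1)"
      using h_pos by (intro mult_left_mono) auto
    moreover have "h * (F1 w * (?s w / h - potential c0 f0 w))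
        = F1 w * (?s w - f0 w + c0 * (norm w)\<^sup>2 / 2 + h)"
      using h_pos by (simp add: potential_def field_simps)
    moreover have "F1 w * (inner w a + (b + c0) / 2 * (norm w)\<^sup>2 + phi (T w) - ?\<phi> (T w) + h)
        \<le> F1 w * (?s w - f0 w + c0 * (norm w)\<^sup>2 / 2 + h)"
      using F1_pos[of w] young elim
      by (intro mult_left_mono) (auto simp: inner_commute[of w a] add_divide_distrib distrib_right)
    ultimately show ?case
      by (simp add: algebra_simps)
  qed
  then have "(\<integral>w. ?lower w \<partial>lborel) \<le> (\<integral>w. h * exp (?s w / h - 1) \<partial>lborel)"
    using lower(1) Z by (intro integral_mono_AE) auto
  then show ?thesis
    unfolding lower(2) by simp
qed

lemma wasserstein2_sq_eq:
  fixes F0 :: "'a \<Rightarrow> real"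
  assumes mu: "\<mu> = density lborel (\<lambda>v. ennreal (F0 v))"
    and second: "integrable \<mu> (\<lambda>v. (norm v)\<^sup>2)" "(\<integral>v. (norm v)\<^sup>2 \<partial>\<mu>) = real DIM('a)"
  shows "0 \<le> real DIM('a) - (\<integral>w. F1 w * inner (T w) w \<partial>lborel)"
    and "wasserstein2_sq F0 F1 = ennreal (real DIM('a) - (\<integral>w. F1 w * inner (T w) w \<partial>lborel))"
proof -
  let ?\<nu> = "density lborel (\<lambda>w. ennreal (F1 w))"
  let ?W = "real DIM('a) - (\<integral>w. F1 w * inner (T w) w \<partial>lborel)"
  let ?c = "\<lambda>p :: 'a \<times> 'a. (norm (fst p - snd p))\<^sup>2 / 2"
  have T_sq: "integrable lborel (\<lambda>w. F1 w * (norm (T w))\<^sup>2)" "(\<integral>w. F1 w * (norm (T w))\<^sup>2 \<partial>lborel) = real DIM('a)"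
    using second by (simp_all add: integrable_T_iff[of "\<lambda>v. (norm v)\<^sup>2"] integral_T[of "\<lambda>v. (norm v)\<^sup>2"])
  have sq: "(norm (v - w))\<^sup>2 / 2 = (norm v)\<^sup>2 / 2 + (norm w)\<^sup>2 / 2 - inner v w" for v w :: 'a
    by (simp add: power2_norm_eq_inner inner_simps inner_commute[of w v] field_simps)
  have T_cost: "integrable lborel (\<lambda>w. F1 w * ((norm (T w - w))\<^sup>2 / 2))"
    "(\<integral>w. F1 w * ((norm (T w - w))\<^sup>2 / 2) \<partial>lborel) = ?W"
  proof -
    have eq: "F1 w * ((norm (T w - w))\<^sup>2 / 2)
        = F1 w * (norm (T w))\<^sup>2 / 2 + F1 w * (norm w)\<^sup>2 / 2 - F1 w * inner (T w) w" for w
      unfolding sq by (simp add: algebra_simps)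
    show "integrable lborel (\<lambda>w. F1 w * ((norm (T w - w))\<^sup>2 / 2))"
      unfolding eq using T_sq integrable_F1_norm_sq integrable_F1_inner_T_self by simp
    show "(\<integral>w. F1 w * ((norm (T w - w))\<^sup>2 / 2) \<partial>lborel) = ?W"
      unfolding eq using T_sq integrable_F1_norm_sq integrable_F1_inner_T_self integral_F1_norm_sq by simp
  qed
  show W: "0 \<le> ?W"
    unfolding T_cost(2)[symmetric] using F1_pos by (intro Bochner_Integration.integral_nonneg) (simp add: less_imp_le)
  show "wasserstein2_sq F0 F1 = ennreal ?W"
    unfolding wasserstein2_sq_def
  proof (rule antisym)
    define \<gamma> where "\<gamma> = distr ?\<nu> (borel \<Otimes>\<^sub>M borel) (\<lambda>w. (T w, w))"
    have "distr \<gamma> borel fst = \<mu>"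
      unfolding \<gamma>_def by (subst distr_distr) (auto simp: comp_def distr_T)
    moreover have "distr \<gamma> borel snd = ?\<nu>"
      unfolding \<gamma>_def by (subst distr_distr) (auto simp: comp_def intro!: distr_id2)
    ultimately have "\<gamma> \<in> couplings F0 F1"
      by (simp add: couplings_def mu) (simp add: \<gamma>_def)
    then have "(INF \<gamma>\<in>couplings F0 F1. \<integral>\<^sup>+ p. ennreal (?c p) \<partial>\<gamma>) \<le> (\<integral>\<^sup>+ p. ennreal (?c p) \<partial>\<gamma>)"
      by (rule INF_lower)
    also have "\<dots> = (\<integral>\<^sup>+ w. ennreal (F1 w * ((norm (T w - w))\<^sup>2 / 2)) \<partial>lborel)"
      unfolding \<gamma>_def using F1_pos
      by (simp add: nn_integral_distr nn_integral_density less_imp_le flip: ennreal_mult)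
    also have "\<dots> = ennreal ?W"
      unfolding T_cost(2)[symmetric] using F1_pos T_cost(1)
      by (intro nn_integral_eq_integral) (simp_all add: less_imp_le)
    finally show "(INF \<gamma>\<in>couplings F0 F1. \<integral>\<^sup>+ p. ennreal (?c p) \<partial>\<gamma>) \<le> ennreal ?W" .
  next
    show "ennreal ?W \<le> (INF \<gamma>\<in>couplings F0 F1. \<integral>\<^sup>+ p. ennreal (?c p) \<partial>\<gamma>)"
    proof (rule INF_greatest)
      fix \<gamma> assume "\<gamma> \<in> couplings F0 F1"
      then have \<gamma>: "sets \<gamma> = sets (borel \<Otimes>\<^sub>M borel)" "distr \<gamma> borel fst = \<mu>" "distr \<gamma> borel snd = ?\<nu>"
        by (auto simp: couplings_def mu)
      note [measurable_cong] = \<gamma>(1)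
      have fst_int: "integrable \<gamma> (\<lambda>p. g (fst p))" "(\<integral>p. g (fst p) \<partial>\<gamma>) = (\<integral>v. g v \<partial>\<mu>)"
        if [measurable]: "g \<in> borel_measurable borel" and "integrable \<mu> g" for g :: "'a \<Rightarrow> real"
        using that(2) unfolding \<gamma>(2)[symmetric] by (simp_all add: integrable_distr_eq integral_distr)
      have snd_int: "integrable \<gamma> (\<lambda>p. g (snd p))" "(\<integral>p. g (snd p) \<partial>\<gamma>) = (\<integral>w. F1 w * g w \<partial>lborel)"
        if [measurable]: "g \<in> borel_measurable borel" and g: "integrable lborel (\<lambda>w. F1 w * g w)" for g :: "'a \<Rightarrow> real"
      proof -
        have "integrable ?\<nu> g" "(\<integral>w. g w \<partial>?\<nu>) = (\<integral>w. F1 w * g w \<partial>lborel)"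
          using g F1_pos by (simp_all add: integrable_density integral_density less_imp_le)
        then show "integrable \<gamma> (\<lambda>p. g (snd p))" "(\<integral>p. g (snd p) \<partial>\<gamma>) = (\<integral>w. F1 w * g w \<partial>lborel)"
          unfolding \<gamma>(3)[symmetric] by (simp_all add: integrable_distr_eq integral_distr)
      qed
      \<comment> \<open>Kantorovich potentials |v|^2 / 2 - phi v and |w|^2 / 2 - f0 w. Young's
        inequality says that their sum is at most the cost, and its integral depends on the coupling
        only through the marginals.\<close>
      let ?Y = "\<lambda>p. (norm (fst p))\<^sup>2 / 2 - phi (fst p) + ((norm (snd p))\<^sup>2 / 2 - f0 (snd p))"
      have parts: "integrable \<gamma> (\<lambda>p. (norm (fst p))\<^sup>2)" "(\<integral>p. (norm (fst p))\<^sup>2 \<partial>\<gamma>) = real DIM('a)"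
        "integrable \<gamma> (\<lambda>p. phi (fst p))" "(\<integral>p. phi (fst p) \<partial>\<gamma>) = (\<integral>v. phi v \<partial>\<mu>)"
        "integrable \<gamma> (\<lambda>p. (norm (snd p))\<^sup>2)" "(\<integral>p. (norm (snd p))\<^sup>2 \<partial>\<gamma>) = real DIM('a)"
        "integrable \<gamma> (\<lambda>p. f0 (snd p))" "(\<integral>p. f0 (snd p) \<partial>\<gamma>) = (\<integral>w. F1 w * f0 w \<partial>lborel)"
        using fst_int[of "\<lambda>v. (norm v)\<^sup>2"] fst_int[of phi] snd_int[of "\<lambda>v. (norm v)\<^sup>2"] snd_int[of f0]
          second phi_integrable integrable_F1_norm_sq integral_F1_norm_sq integrable_F1_f0 by simp_all
      have Y: "integrable \<gamma> ?Y" "(\<integral>p. ?Y p \<partial>\<gamma>) = ?W"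
        using parts by (simp_all add: integral_F1_phi_T)
      have "AE p in \<gamma>. excess f0 (fst p) < \<infinity>"
        using AE_excess_finite unfolding \<gamma>(2)[symmetric] by (subst (asm) AE_distr_iff) auto
      then have Y_le: "AE p in \<gamma>. ?Y p \<le> ?c p"
      proof eventually_elim
        case (elim p)
        then show ?case
          using phi_ge[OF elim, of "snd p"] unfolding sq by simp
      qed
      show "ennreal ?W \<le> (\<integral>\<^sup>+ p. ennreal (?c p) \<partial>\<gamma>)"
      proof (cases "(\<integral>\<^sup>+ p. ennreal (?c p) \<partial>\<gamma>) = \<infinity>")
        case False
        then have c: "integrable \<gamma> ?c"
          by (intro integrableI_bounded) (auto simp: less_top)
        have "?W \<le> (\<integral>p. ?c p \<partial>\<gamma>)"
          unfolding Y(2)[symmetric] by (rule integral_mono_AE[OF Y(1) c Y_le])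
        then have "ennreal ?W \<le> ennreal (\<integral>p. ?c p \<partial>\<gamma>)"
          by (rule ennreal_leI)
        also have "\<dots> = (\<integral>\<^sup>+ p. ennreal (?c p) \<partial>\<gamma>)"
          using c by (intro nn_integral_eq_integral[symmetric]) auto
        finally show ?thesis .
      qed simp
    qed
  qed
qed

end

text \<open>Transfers the push-forward from the Borel map \<open>T\<close> to the gradient.
  Agreement almost everywhere gives measurability only for the completed \<sigma>-algebra, so the
  two image measures are compared through indicators of preimages.\<close>

lemma pushes_forward_AE_eq:
  fixes T S :: "'a::euclidean_space \<Rightarrow> 'b::euclidean_space"
  assumes [measurable]: "T \<in> borel_measurable borel" "F \<in> borel_measurable borel"
    and eq: "AE w in lborel. T w = S w"
    and distr: "distr (density lborel (\<lambda>w. ennreal (F w))) borel T = density lborel (\<lambda>w. ennreal (G w))"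
  shows "pushes_forward S F G"
proof -
  have T: "T \<in> borel_measurable lebesgue" and F [measurable]: "F \<in> borel_measurable lebesgue"
    by (simp_all add: measurable_completion)
  have eq': "AE w in lebesgue. T w = S w"
    using eq by (rule AE_completion)
  have S [measurable]: "S \<in> borel_measurable lebesgue"
    by (rule borel_measurable_AE[OF T eq'])
  have "distr (density lebesgue (\<lambda>w. ennreal (F w))) borel S = distr (density lborel (\<lambda>w. ennreal (F w))) borel T"
  proof (rule measure_eqI)
    fix A assume "A \<in> sets (distr (density lebesgue (\<lambda>w. ennreal (F w))) borel S)"
    then have [measurable]: "A \<in> sets borel"
      by simp
    have SA: "S -` A \<in> sets lebesgue"
      using measurable_sets[OF S, of A] by simp
    have TA [measurable]: "T -` A \<in> sets borel"
      using measurable_sets[OF assms(1), of A] by simp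
    have "emeasure (distr (density lebesgue (\<lambda>w. ennreal (F w))) borel S) A
        = (\<integral>\<^sup>+ w. ennreal (F w) * indicator (S -` A) w \<partial>lebesgue)"
      using SA by (simp add: emeasure_distr emeasure_density)
    also have "\<dots> = (\<integral>\<^sup>+ w. ennreal (F w) * indicator (T -` A) w \<partial>lebesgue)"
    proof (rule nn_integral_cong_AE)
      show "AE w in lebesgue. ennreal (F w) * indicator (S -` A) w = ennreal (F w) * indicator (T -` A) w"
        using eq' by eventually_elim (simp add: indicator_def)
    qed
    also have "\<dots> = (\<integral>\<^sup>+ w. ennreal (F w) * indicator (T -` A) w \<partial>lborel)"
      by (rule nn_integral_completion) measurable
    also have "\<dots> = emeasure (distr (density lborel (\<lambda>w. ennreal (F w))) borel T) A"
      using TA by (simp add: emeasure_distr emeasure_density)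
    finally show "emeasure (distr (density lebesgue (\<lambda>w. ennreal (F w))) borel S) A
        = emeasure (distr (density lborel (\<lambda>w. ennreal (F w))) borel T) A" .
  qed simp
  then show ?thesis
    using S distr by (simp add: pushes_forward_def)
qed

lemma deriv_eta_star: "deriv eta_star s = exp (s - 1)"
proof -
  have "((\<lambda>s. exp (s - 1)) has_real_derivative exp (s - 1)) (at s)"
    by (auto intro!: derivative_eq_intros)
  then show ?thesis
    unfolding eta_star_eq[abs_def] by (rule DERIV_imp_deriv)
qed

lemma centered_densities_moments:
  fixes F :: "real ^ 'n \<Rightarrow> real"
  assumes F: "F \<in> centered_densities"
  defines "\<mu> \<equiv> density lborel (\<lambda>v. ennreal (F v))"
  shows "prob_space \<mu>" "integrable \<mu> (\<lambda>v. (norm v)\<^sup>2)" "(\<integral>v. (norm v)\<^sup>2 \<partial>\<mu>) = real CARD('n)"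
    "(\<integral>v. inner v e \<partial>\<mu>) = 0"
proof -
  have [measurable]: "F \<in> borel_measurable borel" and nonneg: "\<And>v. 0 \<le> F v"
    and total: "has_bochner_integral lborel F 1"
    and mean: "has_bochner_integral lborel (\<lambda>v. F v *\<^sub>R v) 0"
    and second: "has_bochner_integral lborel (\<lambda>v. (norm v)\<^sup>2 * F v) (real CARD('n))"
    using F by (auto simp: centered_densities_def)
  have "(\<integral>\<^sup>+ v. ennreal (F v) \<partial>lborel) = 1"
    using total nonneg by (subst nn_integral_eq_integral) (auto simp: has_bochner_integral_iff)
  then show "prob_space \<mu>"
    by (intro prob_spaceI) (simp add: \<mu>_def emeasure_density)
  show "integrable \<mu> (\<lambda>v. (norm v)\<^sup>2)" "(\<integral>v. (norm v)\<^sup>2 \<partial>\<mu>) = real CARD('n)"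
    using second nonneg
    by (simp_all add: \<mu>_def integrable_density integral_density has_bochner_integral_iff mult.commute)
  have "(\<integral>v. inner v e \<partial>\<mu>) = (\<integral>v. inner (F v *\<^sub>R v) e \<partial>lborel)"
    using nonneg by (simp add: \<mu>_def integral_density)
  also have "\<dots> = inner (\<integral>v. F v *\<^sub>R v \<partial>lborel) e"
    using mean by (intro integral_inner_left) (auto simp: has_bochner_integral_iff)
  finally show "(\<integral>v. inner v e \<partial>\<mu>) = 0"
    using mean by (simp add: has_bochner_integral_iff)
qed

theorem theorem5p1:
  fixes h R :: real and F0 :: "real ^ 'n \<Rightarrow> real"
  assumes "h > 0" and "R > 0"
    and "F0 \<in> centered_densities"
    and "AE v in lborel. v \<notin> cball 0 R \<longrightarrow> F0 v = 0"
    and "\<exists>c>0. AE v in lborel. v \<in> cball 0 R \<longrightarrow> c \<le> F0 v"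
  shows "\<exists>a0 b0 \<phi>0 \<psi>0.
    (a0, b0, \<phi>0, \<psi>0) \<in> admissible R \<and>
    (\<forall>(a, b, \<phi>, \<psi>) \<in> admissible R. dual_J h F0 (a0, b0, \<phi>0, \<psi>0) \<ge> dual_J h F0 (a, b, \<phi>, \<psi>)) \<and>
    (let psi = (\<lambda>w. real_of_ereal (\<psi>0 w));
         F1 = (\<lambda>w. deriv eta_star ((inner a0 w + b0 * (norm w)\<^sup>2 / 2 + psi w) / h))
     in F1 \<in> centered_densities \<and>
        pushes_forward (grad psi) F1 F0 \<and>
        (AE w in lborel. psi differentiable (at w)) \<and>
        (\<forall>w. psi differentiable (at w) \<longrightarrow>
           (\<lambda>x. ln (F1 x)) differentiable (at w) \<and>
           grad psi w = w + h *\<^sub>R grad (\<lambda>x. ln (F1 x)) w + h *\<^sub>R w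
             - (enn2real (wasserstein2_sq F0 F1) / real CARD('n)) *\<^sub>R w))"
proof -
  define \<mu> where "\<mu> = density lborel (\<lambda>v. ennreal (F0 v))"
  note moments = centered_densities_moments[OF assms(3), folded \<mu>_def]
  have [measurable]: "F0 \<in> borel_measurable borel" and F0_nonneg: "\<And>v. 0 \<le> F0 v"
    using assms(3) by (auto simp: centered_densities_def)
  have ball: "AE v in \<mu>. norm v \<le> R"
    unfolding \<mu>_def using assms(4) by (subst AE_density) (auto elim!: eventually_mono)
  interpret D: entropic_dual \<mu> h R
    using moments(1) assms(1,2) ball
    by (simp add: entropic_dual_def entropic_dual_axioms_def) (simp add: \<mu>_def)
  obtain c0 f0 where min: "c0 > 0" "subgradients_in_ball R f0" "D.cost f0 < \<infinity>" "D.partition c0 f0 = 1"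
    "\<And>c f. c > 0 \<Longrightarrow> subgradients_in_ball R f \<Longrightarrow> D.cost f < \<infinity> \<Longrightarrow>
      enn2real (D.cost f0) - f0 0 + real DIM(real ^ 'n) * c0 / 2
        \<le> enn2real (D.cost f) - f 0 + real DIM(real ^ 'n) * c / 2 + h * (D.partition c f - 1)"
    using D.exists_normalized_minimizer by blast
  obtain T where T: "T \<in> borel_measurable borel" "\<And>w. norm (T w) \<le> R"
    "AE w in lborel. f0 differentiable (at w) \<and> T w = grad f0 w"
    using subgradients_in_ball_borel_gradient[OF min(2)] by blast
  interpret E: entropic_dual_optimizer \<mu> h R c0 f0 T
    by unfold_locales (fact min T)+
  have mean: "(\<integral>w. E.F1 w * inner w e \<partial>lborel) = 0" for e
  proof -
    have "c0 * (\<integral>w. E.F1 w * inner w e \<partial>lborel) = (\<integral>v. inner v e \<partial>\<mu>)"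
      unfolding E.integral_F1_inner_T[symmetric] by (rule E.integral_T[symmetric]) simp
    then show ?thesis
      using moments(4)[of e] min(1) by simp
  qed
  define \<psi>0 where "\<psi>0 = (\<lambda>x. ereal (f0 x))"
  define \<phi>0 where "\<phi>0 = legendre \<psi>0"
  have J: "dual_J h F0 (a, b, \<phi>, \<psi>) = ereal (real CARD('n)) - ereal_integral \<mu> \<phi> + ereal (real CARD('n) / 2 * b)
      - ereal h * enn2ereal (\<integral>\<^sup>+ w. ennreal (exp ((inner a w + b * (norm w)\<^sup>2 / 2 + real_of_ereal (\<psi> w)) / h - 1)) \<partial>lborel)"
    if [measurable]: "\<phi> \<in> borel_measurable borel" for a b \<phi> \<psi>
    using F0_nonneg by (simp add: dual_J_def eta_star_eq \<mu>_def ereal_integral_density)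
  have F1_eq: "E.F1 w = exp ((inner 0 w + - c0 * (norm w)\<^sup>2 / 2 + f0 w) / h - 1)" for w
    by (simp add: E.F1_def D.potential_def)
  \<comment> \<open>The value of J at a = 0 and b = - c0, where the exponential integral equals
    1.\<close>
  define J0 where "J0 = real CARD('n) - (\<integral>v. E.phi v \<partial>\<mu>) - real CARD('n) / 2 * c0 - h"
  have J_opt: "dual_J h F0 (0, - c0, \<phi>0, \<psi>0) = ereal J0"
  proof -
    have "(\<integral>\<^sup>+ w. ennreal (E.F1 w) \<partial>lborel) = ennreal 1"
      using nn_integral_eq_integral[OF E.F1_integrable] E.F1_pos E.F1_integral by (simp add: less_imp_le)
    then show ?thesis
      using E.ereal_integral_legendre_f0
      by (simp add: J \<phi>0_def \<psi>0_def F1_eq J0_def flip: ennreal_1)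
  qed
  have J_le: "dual_J h F0 (a, b, \<phi>, \<psi>) \<le> ereal J0" if adm: "(a, b, \<phi>, \<psi>) \<in> admissible R" for a b \<phi> \<psi>
  proof -
    define f where "f w = real_of_ereal (\<psi> w)" for w
    have f: "subgradients_in_ball R f"
      unfolding f_def[abs_def] by (rule admissible_subgradients_in_ball[OF adm])
    have \<psi>: "\<psi> = (\<lambda>w. ereal (f w))"
      unfolding f_def using admissible_psi_finite[OF adm] by blast
    have \<phi>: "\<phi> = legendre (\<lambda>w. ereal (f w))"
      using adm unfolding \<psi>[symmetric] admissible_def dual_convex_pair_def by blast
    have [measurable]: "f \<in> borel_measurable borel"
      by (rule subgradients_in_ball_borel[OF f])
    let ?e = "\<lambda>w. exp ((inner a w + b * (norm w)\<^sup>2 / 2 + f w) / h - 1)"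
    have J': "dual_J h F0 (a, b, \<phi>, \<psi>) = ereal (real CARD('n)) - ereal_integral \<mu> \<phi> + ereal (real CARD('n) / 2 * b)
      - ereal h * enn2ereal (\<integral>\<^sup>+ w. ennreal (?e w) \<partial>lborel)"
      by (simp add: J \<phi> \<psi>)
    have bound: "ereal (- f 0) \<le> \<phi> v" for v
      using legendre_ge[of v 0 f] by (simp add: \<phi>)
    have [measurable]: "\<phi> \<in> borel_measurable \<mu>"
      unfolding \<phi> \<mu>_def by simp
    show ?thesis
    proof (rule ereal_integral_cases[OF moments(1) _ bound])
      show "\<phi> \<in> borel_measurable \<mu>"
        by measurable
      assume inf: "ereal_integral \<mu> \<phi> = \<infinity>"
      show ?thesis
        unfolding J' inf using assms(1)
        by (cases "\<integral>\<^sup>+ w. ennreal (?e w) \<partial>lborel") simp_all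
    next
      assume \<phi>_int: "integrable \<mu> (\<lambda>v. real_of_ereal (\<phi> v))" "AE v in \<mu>. \<phi> v \<noteq> \<infinity>"
        "ereal_integral \<mu> \<phi> = ereal (\<integral>v. real_of_ereal (\<phi> v) \<partial>\<mu>)"
      show ?thesis
      \<comment> \<open>If either integral is infinite, J is -\<infinity> and there is nothing to
        compare; \<open>dual_bound\<close> handles the case in which both are finite.\<close>
      proof (cases "(\<integral>\<^sup>+ w. ennreal (?e w) \<partial>lborel) = \<infinity>")
        case True
        then show ?thesis
          unfolding J' \<phi>_int(3) using assms(1) by simp
      next
        case False
        then have Z: "integrable lborel ?e"
          by (intro integrableI_bounded) (auto simp: less_top)
        then have "(\<integral>\<^sup>+ w. ennreal (?e w) \<partial>lborel) = ennreal (\<integral>w. ?e w \<partial>lborel)"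
          by (intro nn_integral_eq_integral) auto
        moreover have "0 \<le> (\<integral>w. ?e w \<partial>lborel)"
          by (intro Bochner_Integration.integral_nonneg) simp
        ultimately have "dual_J h F0 (a, b, \<phi>, \<psi>) = ereal (real CARD('n) - (\<integral>v. real_of_ereal (\<phi> v) \<partial>\<mu>)
            + real CARD('n) / 2 * b - h * (\<integral>w. ?e w \<partial>lborel))"
          unfolding J' \<phi>_int(3) by simp
        moreover have "h + (b + c0) / 2 * real CARD('n) + (\<integral>v. E.phi v \<partial>\<mu>)
            \<le> h * (\<integral>w. ?e w \<partial>lborel) + (\<integral>v. real_of_ereal (\<phi> v) \<partial>\<mu>)"
          using E.dual_bound[OF f _ _ Z mean] \<phi>_int(1,2) by (simp add: \<phi>)
        ultimately show ?thesis
          by (simp add: J0_def field_simps)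
      qed
    qed
  qed
  have F1_centered: "E.F1 \<in> centered_densities"
  proof -
    have "integrable lborel (\<lambda>w. E.F1 w *\<^sub>R w)"
    proof (rule Bochner_Integration.integrable_bound)
      show "integrable lborel (\<lambda>w. E.F1 w * norm w)"
        by (rule E.integrable_F1_mult[where C=1]) (use norm_le_one_plus_norm_sq in auto)
    qed (auto simp: E.F1_pos less_imp_le)
    moreover from this have "inner (\<integral>w. E.F1 w *\<^sub>R w \<partial>lborel) e = 0" for e
      using mean[of e] by (subst integral_inner_left[symmetric]) auto
    then have "(\<integral>w. E.F1 w *\<^sub>R w \<partial>lborel) = 0"
      using inner_eq_zero_iff by blast
    ultimately show ?thesis
      using E.F1_integrable E.F1_integral E.integrable_F1_norm_sq E.integral_F1_norm_sq E.F1_pos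
      by (auto simp: centered_densities_def has_bochner_integral_iff less_imp_le mult.commute)
  qed
  have push: "pushes_forward (grad f0) E.F1 F0"
    by (rule pushes_forward_AE_eq[OF T(1) E.F1_borel])
      (use T(3) E.distr_T in \<open>auto simp: \<mu>_def elim: eventually_mono\<close>)
  \<comment> \<open>Both second moments equal d, so the squared distance is d minus the correlation
    of \<open>T w\<close> and \<open>w\<close>; the dilation identity evaluates the latter as d (c0
    - h).\<close>
  have W: "enn2real (wasserstein2_sq F0 E.F1) = real CARD('n) * (1 - c0 + h)"
  proof -
    have "(\<integral>w. E.F1 w * inner (T w) w \<partial>lborel) = real CARD('n) * (c0 - h)"
      unfolding E.integral_F1_inner_T_self E.integral_F1_norm_sq by (simp add: algebra_simps)
    note E.wasserstein2_sq_eq[OF \<mu>_def moments(2), unfolded this]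
    then show ?thesis
      using moments(3) by (simp add: algebra_simps)
  qed
  have euler: "(\<lambda>x. ln (E.F1 x)) differentiable (at w) \<and>
      grad f0 w = w + h *\<^sub>R grad (\<lambda>x. ln (E.F1 x)) w + h *\<^sub>R w
        - (enn2real (wasserstein2_sq F0 E.F1) / real CARD('n)) *\<^sub>R w"
    if w: "f0 differentiable (at w)" for w
  proof -
    have deriv: "((\<lambda>x. ln (E.F1 x)) has_derivative (\<lambda>y. inner (grad f0 w - c0 *\<^sub>R w) y / h)) (at w)"
      using E.has_derivative_potential[OF w] by (simp add: E.F1_def)
    then have "GDERIV (\<lambda>x. ln (E.F1 x)) w :> (1 / h) *\<^sub>R (grad f0 w - c0 *\<^sub>R w)"
      by (simp add: gderiv_def inner_commute[of _ "_ - _"])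
    then have "grad (\<lambda>x. ln (E.F1 x)) w = (1 / h) *\<^sub>R (grad f0 w - c0 *\<^sub>R w)"
      by (rule grad_eqI)
    then have hG: "h *\<^sub>R grad (\<lambda>x. ln (E.F1 x)) w = grad f0 w - c0 *\<^sub>R w"
      using assms(1) by simp
    have Wd: "enn2real (wasserstein2_sq F0 E.F1) / real CARD('n) = 1 - c0 + h"
      by (simp add: W)
    have "grad f0 w = w + h *\<^sub>R grad (\<lambda>x. ln (E.F1 x)) w + h *\<^sub>R w
        - (enn2real (wasserstein2_sq F0 E.F1) / real CARD('n)) *\<^sub>R w"
      \<comment> \<open>With h \<nabla>ln F1 = \<nabla>f0 - c0 w, the remaining multiples of
        \<open>w\<close> have coefficient 1 - c0 + h - (1 - c0 + h) = 0.\<close>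
      unfolding hG Wd by (simp add: algebra_simps)
    with deriv show ?thesis
      unfolding differentiable_def by blast
  qed
  have F1_deriv: "deriv eta_star ((inner 0 w + - c0 * (norm w)\<^sup>2 / 2 + f0 w) / h) = E.F1 w" for w
    by (simp add: deriv_eta_star F1_eq)
  have psi: "(\<lambda>w. real_of_ereal (\<psi>0 w)) = f0"
    by (simp add: \<psi>0_def)
  show ?thesis
  proof (intro exI conjI)
    show "(0, - c0, \<phi>0, \<psi>0) \<in> admissible R"
      unfolding \<phi>0_def \<psi>0_def by (rule admissible_legendre[OF min(2)])
    show "\<forall>(a, b, \<phi>, \<psi>) \<in> admissible R. dual_J h F0 (0, - c0, \<phi>0, \<psi>0) \<ge> dual_J h F0 (a, b, \<phi>, \<psi>)"
      unfolding J_opt using J_le by blast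
    show "let psi = (\<lambda>w. real_of_ereal (\<psi>0 w));
         F1 = (\<lambda>w. deriv eta_star ((inner 0 w + - c0 * (norm w)\<^sup>2 / 2 + psi w) / h))
     in F1 \<in> centered_densities \<and>
        pushes_forward (grad psi) F1 F0 \<and>
        (AE w in lborel. psi differentiable (at w)) \<and>
        (\<forall>w. psi differentiable (at w) \<longrightarrow>
           (\<lambda>x. ln (F1 x)) differentiable (at w) \<and>
           grad psi w = w + h *\<^sub>R grad (\<lambda>x. ln (F1 x)) w + h *\<^sub>R w
             - (enn2real (wasserstein2_sq F0 F1) / real CARD('n)) *\<^sub>R w)"
      unfolding Let_def psi F1_deriv
      by (rule conjI[OF F1_centered conjI[OF push
          conjI[OF subgradients_in_ball_AE_differentiable[OF min(2)]]]]) (intro allI impI euler)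
  qed
qed

end
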